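(* Let $G$ be a graph (finite, connected, loopless, possibly with multiple edges). Consider the following three conditions: (1) $\operatorname{gon}(G)=3$. (2) There exists a non-degenerate harmonic morphism $\varphi: G\to T$ with $\deg(\varphi)=3$, where $T$ is a tree. (3) There exists a cyclic automorphism $\sigma: G\to G$ of order $3$ that does not fix any edge of $G$, such that the quotient graph $G/\sigma$ is a tree. If $G$ is $3$-edge-connected, then (1) and (2) are equivalent. Moreover, if $G$ is simple and $3$-vertex-connected, then (3) implies (1) and (2); and if in addition $G$ satisfies the zero-three condition, then (1) implies (3).
   Context: A graph is finite, connected, loopless, and may have multiple edges; it is simple if it has no multiple edges. $E(u,v)$ denotes the set of edges joining $u$ and $v$; $\mathrm{val}(v)$ is the number of edges incident to $v$. A graph is $k$-edge-connected if deleting any $k-1$ edges leaves it connected, and $k$-vertex-connected if deleting any $k-1$ vertices leaves it connected. A divisor is an element $D=\sum_v D(v)(v)$ of the free abelian group on $V(G)$; $\deg D=\sum_v D(v)$; $D$ is effective if all $D(v)\ge 0$, and $\mathrm{supp}(D)=\{v: D(v)>0\}$. The Laplacian $\Delta$ has $\Delta_{v,v}=\mathrm{val}(v)$ and $\Delta_{v,w}=-|E(v,w)|$ for $v\ne w$; divisors $D,D'$ are linearly equivalent, $D\sim D'$, if $D-D'$ lies in the image of $\Delta$ (acting on $\mathbb{Z}^{V(G)}$). The rank $r(D)$ is $-1$ if no effective divisor is equivalent to $D$, and otherwise the largest $k$ such that for every effective divisor $F$ of degree $k$ there is an effective divisor equivalent to $D-F$. The (divisorial) gonality $\operatorname{gon}(G)$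 is the minimum degree of an effective divisor of rank $\ge 1$. A morphism $\varphi:G\to G'$ maps $V(G)\to V(G')$ and $E(G)\to E(G')\cup V(G')$ such that an edge $uv$ with $\varphi(u)=\varphi(v)$ is sent to the vertex $\varphi(u)$, and an edge $uv$ with $\varphi(u)\ne\varphi(v)$ is sent to an edge joining $\varphi(u)$ and $\varphi(v)$. For $v\in V(G)$ and an edge $e'$ of $G'$ incident to $\varphi(v)$, let $m_\varphi(v,e')$ be the number of edges $e$ incident to $v$ with $\varphi(e)=e'$; $\varphi$ is harmonic if this number is independent of the choice of $e'$ (call it $m_\varphi(v)$), non-degenerate if $m_\varphi(v)>0$ for all $v$, and its degree is $|\varphi^{-1}(e')|$ for any edge $e'$ of $G'$ (independent of $e'$). A tree is a connected graph with $|E|=|V|-1$. An automorphism fixes an edge $e$ if it maps $e$ to itself. $G/\sigma$ is the graph whose vertices are the $\sigma$-orbits of vertices and whose edges are the $\sigma$-orbits of edges whose endpoints lie in different vertex orbits. A graph $G$ of gonality $3$ satisfies the zero-three condition if there exists a divisor $D$ with $\deg D=3$ and $r(D)=1$ such that for any three distinct vertices $a,b,c$ with $D\sim (a)+(b)+(c)$, the number of edges among $a,b,c$ is either $0$ or $3$.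
   Formalization: The literal claim fails for tiny graphs, so some are excluded: (1)⇒(2) omits graphs with 3 vertices (e.g. a triangle with all multiplicities 10), (2)⇒(1) omits 2 vertices joined by 3 edges, and (3)⇒(1),(2) omits the triangle K_3. *)

theory Defs
  imports "HOL-Combinatorics.Orbits"
begin

section \<open>Multigraphs\<close>

record ('v, 'e) mgraph =
  verts :: "'v set"
  edges :: "'e set"
  ends :: "'e \<Rightarrow> 'v set"  (* only meaningful on edges *)

definition connected :: "('v, 'e) mgraph \<Rightarrow> bool" where
  "connected G \<longleftrightarrow> verts G \<noteq> {} \<and>
     (\<forall>u\<in>verts G. \<forall>v\<in>verts G. (u, v) \<in> {(x, y). \<exists>e\<in>edges G. ends G e = {x, y}}\<^sup>*)"

definition is_graph :: "('v, 'e) mgraph \<Rightarrow> bool" where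
  "is_graph G \<longleftrightarrow> finite (verts G) \<and> finite (edges G) \<and>
     (\<forall>e\<in>edges G. ends G e \<subseteq> verts G \<and> card (ends G e) = 2) \<and> connected G"

definition simple :: "('v, 'e) mgraph \<Rightarrow> bool" where
  "simple G \<longleftrightarrow> inj_on (ends G) (edges G)"

definition edges_between :: "('v, 'e) mgraph \<Rightarrow> 'v \<Rightarrow> 'v \<Rightarrow> 'e set" where
  "edges_between G u v = {e \<in> edges G. ends G e = {u, v}}"

definition val :: "('v, 'e) mgraph \<Rightarrow> 'v \<Rightarrow> nat" where
  "val G v = card {e \<in> edges G. v \<in> ends G e}"

definition delete_edges :: "('v, 'e) mgraph \<Rightarrow> 'e set \<Rightarrow> ('v, 'e) mgraph" where
  "delete_edges G S = G\<lparr>edges := edges G - S\<rparr>"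

definition delete_verts :: "('v, 'e) mgraph \<Rightarrow> 'v set \<Rightarrow> ('v, 'e) mgraph" where
  "delete_verts G S =
     G\<lparr>verts := verts G - S, edges := {e \<in> edges G. ends G e \<inter> S = {}}\<rparr>"

definition edge_connected :: "nat \<Rightarrow> ('v, 'e) mgraph \<Rightarrow> bool" where
  "edge_connected k G \<longleftrightarrow>
     (\<forall>S \<subseteq> edges G. card S = k - 1 \<longrightarrow> connected (delete_edges G S))"

(* No lower bound on the number of vertices is built in; in particular the triangle
   is 3-vertex-connected in this sense. *)
definition vertex_connected :: "nat \<Rightarrow> ('v, 'e) mgraph \<Rightarrow> bool" where
  "vertex_connected k G \<longleftrightarrow>
     (\<forall>S \<subseteq> verts G. card S = k - 1 \<longrightarrow> connected (delete_verts G S))"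

definition is_tree :: "('v, 'e) mgraph \<Rightarrow> bool" where
  "is_tree G \<longleftrightarrow> is_graph G \<and> card (verts G) = card (edges G) + 1"


section \<open>Divisors, rank and gonality\<close>

(* The free abelian group on the vertex set, as integer functions supported on it. *)
definition divisors :: "('v, 'e) mgraph \<Rightarrow> ('v \<Rightarrow> int) set" where
  "divisors G = {D. \<forall>v. v \<notin> verts G \<longrightarrow> D v = 0}"

definition point :: "'v \<Rightarrow> 'v \<Rightarrow> int" where
  "point a = (\<lambda>v. if v = a then 1 else 0)"

definition deg :: "('v, 'e) mgraph \<Rightarrow> ('v \<Rightarrow> int) \<Rightarrow> int" where
  "deg G D = (\<Sum>v\<in>verts G. D v)"

definition effective :: "('v, 'e) mgraph \<Rightarrow> ('v \<Rightarrow> int) \<Rightarrow> bool" where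
  "effective G D \<longleftrightarrow> D \<in> divisors G \<and> (\<forall>v\<in>verts G. 0 \<le> D v)"

definition laplacian :: "('v, 'e) mgraph \<Rightarrow> 'v \<Rightarrow> 'v \<Rightarrow> int" where
  "laplacian G v w = (if v = w then int (val G v) else - int (card (edges_between G v w)))"

definition lin_equiv :: "('v, 'e) mgraph \<Rightarrow> ('v \<Rightarrow> int) \<Rightarrow> ('v \<Rightarrow> int) \<Rightarrow> bool" where
  "lin_equiv G D D' \<longleftrightarrow> D \<in> divisors G \<and> D' \<in> divisors G \<and>
     (\<exists>f. \<forall>v\<in>verts G. D v - D' v = (\<Sum>w\<in>verts G. laplacian G v w * f w))"

definition rank :: "('v, 'e) mgraph \<Rightarrow> ('v \<Rightarrow> int) \<Rightarrow> int" where
  "rank G D =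
     (if \<exists>D'. effective G D' \<and> lin_equiv G D D'
      then int (GREATEST k::nat. \<forall>F. effective G F \<and> deg G F = int k \<longrightarrow>
                  (\<exists>D'. effective G D' \<and> lin_equiv G (\<lambda>v. D v - F v) D'))
      else - 1)"

definition gonality :: "('v, 'e) mgraph \<Rightarrow> nat" where
  "gonality G = (LEAST d. \<exists>D. effective G D \<and> deg G D = int d \<and> rank G D \<ge> 1)"

definition zero_three :: "('v, 'e) mgraph \<Rightarrow> bool" where
  "zero_three G \<longleftrightarrow>
     (\<exists>D\<in>divisors G. deg G D = 3 \<and> rank G D = 1 \<and>
        (\<forall>a\<in>verts G. \<forall>b\<in>verts G. \<forall>c\<in>verts G.
           a \<noteq> b \<and> b \<noteq> c \<and> a \<noteq> c \<and>
           lin_equiv G D (\<lambda>v. point a v + point b v + point c v) \<longrightarrow>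
           card {e \<in> edges G. ends G e \<subseteq> {a, b, c}} \<in> {0, 3}))"


section \<open>Harmonic morphisms\<close>

(* A morphism is a pair (p, q): p acts on vertices, and q sends an edge either to an
   edge (Inl) or to a vertex (Inr). *)
definition morphism ::
  "('v, 'e) mgraph \<Rightarrow> ('w, 'f) mgraph \<Rightarrow> ('v \<Rightarrow> 'w) \<Rightarrow> ('e \<Rightarrow> 'f + 'w) \<Rightarrow> bool" where
  "morphism G H p q \<longleftrightarrow> p ` verts G \<subseteq> verts H \<and>
     (\<forall>e\<in>edges G. \<forall>u v. ends G e = {u, v} \<longrightarrow>
        (if p u = p v then q e = Inr (p u)
         else \<exists>e'\<in>edges H. q e = Inl e' \<and> ends H e' = {p u, p v}))"

definition local_mult :: "('v, 'e) mgraph \<Rightarrow> ('e \<Rightarrow> 'f + 'w) \<Rightarrow> 'v \<Rightarrow> 'f \<Rightarrow> nat" where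
  "local_mult G q v e' = card {e \<in> edges G. v \<in> ends G e \<and> q e = Inl e'}"

definition harmonic ::
  "('v, 'e) mgraph \<Rightarrow> ('w, 'f) mgraph \<Rightarrow> ('v \<Rightarrow> 'w) \<Rightarrow> ('e \<Rightarrow> 'f + 'w) \<Rightarrow> bool" where
  "harmonic G H p q \<longleftrightarrow> morphism G H p q \<and>
     (\<forall>v\<in>verts G. \<forall>e1\<in>edges H. \<forall>e2\<in>edges H.
        p v \<in> ends H e1 \<and> p v \<in> ends H e2 \<longrightarrow> local_mult G q v e1 = local_mult G q v e2)"

(* If the target is a single vertex there is no edge to choose; as usual the
   multiplicities and the degree are then 0, so such a morphism is degenerate. *)
definition mult ::
  "('v, 'e) mgraph \<Rightarrow> ('w, 'f) mgraph \<Rightarrow> ('v \<Rightarrow> 'w) \<Rightarrow> ('e \<Rightarrow> 'f + 'w) \<Rightarrow> 'v \<Rightarrow> nat" where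
  "mult G H p q v =
     (if \<exists>e'\<in>edges H. p v \<in> ends H e'
      then local_mult G q v (SOME e'. e' \<in> edges H \<and> p v \<in> ends H e') else 0)"

definition nondegenerate ::
  "('v, 'e) mgraph \<Rightarrow> ('w, 'f) mgraph \<Rightarrow> ('v \<Rightarrow> 'w) \<Rightarrow> ('e \<Rightarrow> 'f + 'w) \<Rightarrow> bool" where
  "nondegenerate G H p q \<longleftrightarrow> (\<forall>v\<in>verts G. mult G H p q v > 0)"

definition morphism_degree ::
  "('v, 'e) mgraph \<Rightarrow> ('w, 'f) mgraph \<Rightarrow> ('e \<Rightarrow> 'f + 'w) \<Rightarrow> nat" where
  "morphism_degree G H q =
     (if edges H = {} then 0
      else card {e \<in> edges G. q e = Inl (SOME e'. e' \<in> edges H)})"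

(* Trees are finite, so up to isomorphism they all live over the type nat. *)
definition has_tree_morphism :: "('v, 'e) mgraph \<Rightarrow> nat \<Rightarrow> bool" where
  "has_tree_morphism G d \<longleftrightarrow>
     (\<exists>(T :: (nat, nat) mgraph) p q. is_tree T \<and> harmonic G T p q \<and>
        nondegenerate G T p q \<and> morphism_degree G T q = d)"


section \<open>Automorphisms and quotients\<close>

(* In a multigraph an automorphism consists of a vertex part s and an edge part t. *)
definition automorphism :: "('v, 'e) mgraph \<Rightarrow> ('v \<Rightarrow> 'v) \<Rightarrow> ('e \<Rightarrow> 'e) \<Rightarrow> bool" where
  "automorphism G s t \<longleftrightarrow>
     bij_betw s (verts G) (verts G) \<and> bij_betw t (edges G) (edges G) \<and>
     (\<forall>e\<in>edges G. ends G (t e) = s ` ends G e)"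

definition aut_order :: "('v, 'e) mgraph \<Rightarrow> ('v \<Rightarrow> 'v) \<Rightarrow> ('e \<Rightarrow> 'e) \<Rightarrow> nat" where
  "aut_order G s t =
     (LEAST n. n > 0 \<and> (\<forall>v\<in>verts G. (s ^^ n) v = v) \<and> (\<forall>e\<in>edges G. (t ^^ n) e = e))"

definition quotient ::
  "('v, 'e) mgraph \<Rightarrow> ('v \<Rightarrow> 'v) \<Rightarrow> ('e \<Rightarrow> 'e) \<Rightarrow> ('v set, 'e set) mgraph" where
  "quotient G s t =
     \<lparr>verts = orbit s ` verts G,
      edges = orbit t ` {e \<in> edges G. \<forall>u v. ends G e = {u, v} \<longrightarrow> orbit s u \<noteq> orbit s v},
      ends = (\<lambda>X. orbit s ` (\<Union>e\<in>X. ends G e))\<rparr>"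

definition has_tree_quotient :: "('v, 'e) mgraph \<Rightarrow> nat \<Rightarrow> bool" where
  "has_tree_quotient G n \<longleftrightarrow>
     (\<exists>s t. automorphism G s t \<and> aut_order G s t = n \<and>
        (\<forall>e\<in>edges G. t e \<noteq> e) \<and> is_tree (quotient G s t))"

end

theory Submission
  imports Defs "HOL-Combinatorics.Cycles"
begin

text \<open>
  Write \<open>\<delta>(U)\<close> for the cut of a vertex set \<open>U\<close>. Firing \<open>U\<close> sends the divisor of inner end points of
  \<open>\<delta>(U)\<close> to the divisor of its outer end points. If two effective divisors are equivalent and
  distinct, the set where the connecting function is maximal can be fired legally; when all
  cuts have at least three edges and the degree is three, that cut has exactly three edges and uses
  all chips. Hence two distinct effective divisors in a linear system of degree three have disjoint
  supports, so a system of rank one partitions the vertices into classes. Any two adjacent classes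
  are joined by exactly three edges, which form a cut splitting no class, so contracting the classes
  yields a harmonic morphism of degree three onto a tree. Conversely, the fibres of such a
  morphism are equivalent because every edge of a tree is a bridge.

  In a simple 3-vertex-connected graph a class is a single vertex or has three vertices, and adjacent
  classes of three vertices are joined by a perfect matching. Going along the tree, one colors each
  class by \<open>0, 1, 2\<close> so that matched vertices get the same color. The automorphism of order three
  increases the color by one modulo three within each class; under the zero-three condition it preserves the
  edges inside the classes.
\<close>

section \<open>Cuts and trees\<close>

text \<open>The degree equals the lower bound on cuts, so a firing set can leave no chip idle; this
  is what makes the system rigid. The bound is carried as \<open>cuts_ge 3\<close>, a common
  consequence of both kinds of connectivity once there are enough vertices. Some very small graphs
  are genuine exceptions to the implications, and \<open>theorem1p2\<close> names them. The delicate
  point for the tree is that the cut between two adjacent classes must not split a third class;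
  otherwise the corresponding edge of the contracted graph need not be a bridge. For the
  automorphism, matchings composed around a cycle could give a nontrivial permutation; it is the
  absence of cycles in the tree that lets colors extend from class to class. A one-vertex class
  imposes nothing, since its three edges to an adjacent class reach all three vertices there. The
  matchings do not control the edges inside a class: a class with one or two inner edges would not
  be preserved by the rotation, and the zero-three condition excludes it.\<close>

definition incidence :: "('v, 'e) mgraph \<Rightarrow> bool" where
  "incidence G \<longleftrightarrow> (\<forall>e\<in>edges G. ends G e \<subseteq> verts G \<and> card (ends G e) = 2)"

definition edge_cut :: "('v, 'e) mgraph \<Rightarrow> 'v set \<Rightarrow> 'e set" where
  "edge_cut G U = {e \<in> edges G. ends G e \<inter> U \<noteq> {} \<and> ends G e - U \<noteq> {}}"

lemma is_graphD:
  assumes "is_graph G"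
  shows "finite (verts G)" "finite (edges G)" "incidence G" "connected G" "verts G \<noteq> {}"
  using assms by (auto simp: is_graph_def incidence_def connected_def)

lemma edge_endsE:
  assumes "incidence G" "e \<in> edges G"
  obtains u v where "ends G e = {u, v}" "u \<noteq> v" "u \<in> verts G" "v \<in> verts G"
proof -
  have "card (ends G e) = 2" and sub: "ends G e \<subseteq> verts G"
    using assms by (auto simp: incidence_def)
  then obtain u v where uv: "ends G e = {u, v}" "u \<noteq> v" by (auto simp: card_2_iff)
  with sub show thesis by (intro that[OF uv]) auto
qed

lemma edge_other_endE:
  assumes "incidence G" "e \<in> edges G" "u \<in> ends G e"
  obtains v where "ends G e = {u, v}" "u \<noteq> v" "u \<in> verts G" "v \<in> verts G"
proof -
  obtain a b where ab: "ends G e = {a, b}" "a \<noteq> b" "a \<in> verts G" "b \<in> verts G"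
    by (rule edge_endsE[OF assms(1,2)])
  then consider "u = a" | "u = b" using assms(3) by blast
  then show thesis
    by cases (use that[of b] that[of a] ab in \<open>simp_all add: doubleton_eq_iff\<close>)
qed

lemma cut_endsE:
  assumes "incidence G" "e \<in> edge_cut G U"
  obtains u v where "ends G e = {u, v}" "u \<in> U" "v \<notin> U" "u \<in> verts G" "v \<in> verts G"
proof -
  from assms(2) have e: "e \<in> edges G" and "ends G e \<inter> U \<noteq> {}" and out: "ends G e - U \<noteq> {}"
    by (simp_all add: edge_cut_def)
  then obtain u where u: "u \<in> ends G e" "u \<in> U" by blast
  obtain v where v: "ends G e = {u, v}" "u \<noteq> v" "u \<in> verts G" "v \<in> verts G"
    by (rule edge_other_endE[OF assms(1) e u(1)])
  with out u(2) have "v \<notin> U" by auto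
  with v u show thesis by (intro that)
qed

lemma cutI: "e \<in> edges G \<Longrightarrow> u \<in> ends G e \<Longrightarrow> v \<in> ends G e \<Longrightarrow> u \<in> U \<Longrightarrow> v \<notin> U \<Longrightarrow> e \<in> edge_cut G U"
  by (auto simp: edge_cut_def)

lemma edge_cut_iff:
  assumes "e \<in> edges G" "ends G e = {u, v}"
  shows "e \<in> edge_cut G U \<longleftrightarrow> (u \<in> U) \<noteq> (v \<in> U)"
  using assms by (auto simp: edge_cut_def)

lemma cut_edgesD: "e \<in> edge_cut G U \<Longrightarrow> e \<in> edges G"
  by (simp add: edge_cut_def)

lemma finite_cut: "finite (edges G) \<Longrightarrow> finite (edge_cut G U)"
  by (simp add: edge_cut_def)

lemma cut_compl:
  assumes "incidence G"
  shows "edge_cut G (verts G - U) = edge_cut G U"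
  using assms by (auto simp: edge_cut_def incidence_def)

lemma connected_cutI:
  assumes "verts G \<noteq> {}"
    and "incidence G"
    and cut: "\<And>U. U \<subseteq> verts G \<Longrightarrow> U \<noteq> {} \<Longrightarrow> U \<noteq> verts G \<Longrightarrow> edge_cut G U \<noteq> {}"
  shows "connected G"
  unfolding connected_def
proof (intro conjI ballI)
  fix u v assume u: "u \<in> verts G" and v: "v \<in> verts G"
  let ?R = "{(x, y). \<exists>e\<in>edges G. ends G e = {x, y}}"
  let ?U = "{x \<in> verts G. (u, x) \<in> ?R\<^sup>*}"
  have "?U = verts G"
  proof (rule ccontr)
    assume "?U \<noteq> verts G"
    moreover have "?U \<noteq> {}" using u by blast
    ultimately have "edge_cut G ?U \<noteq> {}" by (intro cut) blast+
    then obtain e where e: "e \<in> edge_cut G ?U" by blast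
    obtain x y where xy: "ends G e = {x, y}" "x \<in> ?U" "y \<notin> ?U" "y \<in> verts G"
      using cut_endsE[OF assms(2) e] by blast
    have "(x, y) \<in> ?R" using e xy(1) by (auto simp: edge_cut_def)
    with xy(2) have "(u, y) \<in> ?R\<^sup>*" by (auto intro: rtrancl_into_rtrancl)
    with xy(3,4) show False by blast
  qed
  with v show "(u, v) \<in> ?R\<^sup>*" by blast
qed (fact assms(1))

lemma connected_cutD:
  assumes "connected G" "U \<inter> verts G \<noteq> {}" "verts G - U \<noteq> {}"
  shows "edge_cut G U \<noteq> {}"
proof
  assume empty: "edge_cut G U = {}"
  obtain u v where u: "u \<in> U" "u \<in> verts G" and v: "v \<notin> U" "v \<in> verts G" using assms by blast
  from assms(1) u v have "(u, v) \<in> {(x, y). \<exists>e\<in>edges G. ends G e = {x, y}}\<^sup>*"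
    by (simp add: connected_def)
  then have "v \<in> U"
  proof (induction rule: rtrancl_induct)
    case base show ?case by (fact u(1))
  next
    case (step x y)
    then obtain e where "e \<in> edges G" "ends G e = {x, y}" by blast
    with step.IH empty show ?case by (auto simp: edge_cut_def)
  qed
  with v show False by blast
qed

text \<open>A cut of \<open>H\<close> pulls back along \<open>p\<close> to a cut of
  \<open>G\<close>, and an edge crossing the latter yields one crossing the former. Edges may be
  collapsed: only those with distinct image ends must appear in \<open>H\<close>.\<close>

lemma connected_image:
  assumes "connected G" "incidence H" "verts H = p ` verts G" "incidence G"
    and edge: "\<And>e u v. e \<in> edges G \<Longrightarrow> ends G e = {u, v} \<Longrightarrow> p u \<noteq> p v \<Longrightarrow>
      \<exists>h\<in>edges H. ends H h = {p u, p v}"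
  shows "connected H"
proof (rule connected_cutI)
  show "verts H \<noteq> {}" using assms(1,3) by (simp add: connected_def)
next
  fix W assume W: "W \<subseteq> verts H" "W \<noteq> {}" "W \<noteq> verts H"
  let ?U = "{v \<in> verts G. p v \<in> W}"
  obtain w w' where w: "w \<in> W" "w' \<in> verts H" "w' \<notin> W" using W by blast
  then have "w \<in> verts H" using W(1) by blast
  with w obtain v v' where v: "v \<in> verts G" "p v \<in> W" "v' \<in> verts G" "p v' \<notin> W"
    unfolding assms(3) by blast
  then have "edge_cut G ?U \<noteq> {}" by (intro connected_cutD[OF assms(1)]) blast+
  then obtain e where e: "e \<in> edge_cut G ?U" by blast
  obtain x y where xy: "ends G e = {x, y}" "x \<in> ?U" "y \<notin> ?U" "y \<in> verts G"
    by (rule cut_endsE[OF assms(4) e])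
  then have p: "p x \<in> W" "p y \<notin> W" by blast+
  then have "p x \<noteq> p y" by metis
  from edge[OF cut_edgesD[OF e] xy(1) this] obtain h where h: "h \<in> edges H" "ends H h = {p x, p y}"
    by blast
  then have "h \<in> edge_cut H W" using p by (auto simp: edge_cut_def)
  then show "edge_cut H W \<noteq> {}" by blast
qed (fact assms(2))

text \<open>A spanning tree grown one vertex at a time. Its connectedness is recorded as meeting
  every cut that separates vertices, which is the form that combines with bridges and edge
  counts.\<close>

lemma spanning_edges:
  assumes G: "is_graph G"
  shows "\<exists>S\<subseteq>edges G. card S + 1 = card (verts G) \<and>
    (\<forall>A. A \<inter> verts G \<noteq> {} \<longrightarrow> verts G - A \<noteq> {} \<longrightarrow> S \<inter> edge_cut G A \<noteq> {})"
proof -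
  note g = is_graphD[OF G]
  have grow: "\<exists>W S. W \<subseteq> verts G \<and> S \<subseteq> edges G \<and> card W = Suc k \<and> card S = k \<and>
      (\<forall>e\<in>S. ends G e \<subseteq> W) \<and> (\<forall>A. A \<inter> W \<noteq> {} \<longrightarrow> W - A \<noteq> {} \<longrightarrow> S \<inter> edge_cut G A \<noteq> {})"
    if "k < card (verts G)" for k
    using that
  proof (induction k)
    case 0
    obtain v where "v \<in> verts G" using g(5) by blast
    then show ?case by (intro exI[of _ "{v}"] exI[of _ "{}"]) auto
  next
    case (Suc k)
    from Suc.IH[OF Suc_lessD[OF Suc.prems]]
    obtain W S where W: "W \<subseteq> verts G" "S \<subseteq> edges G" "card W = Suc k" "card S = k"
      "\<forall>e\<in>S. ends G e \<subseteq> W"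
      and cross: "\<forall>A. A \<inter> W \<noteq> {} \<longrightarrow> W - A \<noteq> {} \<longrightarrow> S \<inter> edge_cut G A \<noteq> {}"
      by (elim exE conjE)
    have fin: "finite W" "finite S" using W g finite_subset by blast+
    have "W \<noteq> {}" "W \<noteq> verts G" using W(3) Suc.prems by auto
    then have "edge_cut G W \<noteq> {}" using W(1) by (intro connected_cutD[OF g(4)]) blast+
    then obtain e where e: "e \<in> edge_cut G W" by blast
    then obtain x y where xy: "ends G e = {x, y}" "x \<in> W" "y \<notin> W" "y \<in> verts G"
      using cut_endsE[OF g(3)] by blast
    have eE: "e \<in> edges G" using e by (rule cut_edgesD)
    have "e \<notin> S" using W(5) xy by blast
    have "insert e S \<inter> edge_cut G A \<noteq> {}" if A: "A \<inter> insert y W \<noteq> {}" "insert y W - A \<noteq> {}" for A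
    proof (cases "A \<inter> W \<noteq> {} \<and> W - A \<noteq> {}")
      case True then show ?thesis using cross by blast
    next
      case False
      \<comment> \<open>\<open>A\<close> does not split \<open>W\<close>, so it separates
        \<open>y\<close> from all of \<open>W\<close>, in particular from \<open>x\<close>.\<close>
      then have "(x \<in> A \<and> y \<notin> A) \<or> (x \<notin> A \<and> y \<in> A)" using A xy(2) by blast
      then have "e \<in> edge_cut G A" using eE xy(1) by (auto simp: edge_cut_def)
      then show ?thesis by blast
    qed
    then show ?case
      using W xy \<open>e \<notin> S\<close> fin eE by (intro exI[of _ "insert y W"] exI[of _ "insert e S"]) auto
  qed
  have "card (verts G) > 0" using g by (simp add: card_gt_0_iff)
  then obtain k where k: "card (verts G) = Suc k" using gr0_implies_Suc by blast
  then obtain W S where W: "W \<subseteq> verts G" "S \<subseteq> edges G" "card W = Suc k" "card S = k"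
      "\<forall>A. A \<inter> W \<noteq> {} \<longrightarrow> W - A \<noteq> {} \<longrightarrow> S \<inter> edge_cut G A \<noteq> {}"
    using grow[of k] by auto
  have "W = verts G" using W(1,3) k g(1) by (simp add: card_subset_eq)
  then show ?thesis using W k by (intro exI[of _ S]) simp
qed

text \<open>A spanning edge set meets every separating cut, so it contains every bridge. If all
  edges are bridges it is the whole edge set, and the count follows.\<close>

lemma is_tree_if_bridges:
  assumes G: "is_graph G" and bridge: "\<And>e. e \<in> edges G \<Longrightarrow> \<exists>U. edge_cut G U = {e}"
  shows "is_tree G"
proof -
  note g = is_graphD[OF G]
  from spanning_edges[OF G] obtain S where S: "S \<subseteq> edges G" "card S + 1 = card (verts G)"
    "\<forall>A. A \<inter> verts G \<noteq> {} \<longrightarrow> verts G - A \<noteq> {} \<longrightarrow> S \<inter> edge_cut G A \<noteq> {}"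
    by (elim exE conjE)
  have "edges G \<subseteq> S"
  proof
    fix e assume "e \<in> edges G"
    then obtain U where U: "edge_cut G U = {e}" using bridge by blast
    then have "e \<in> edge_cut G U" by simp
    then obtain x y where "x \<in> U" "y \<notin> U" "x \<in> verts G" "y \<in> verts G"
      by (rule cut_endsE[OF g(3)])
    then have "S \<inter> edge_cut G U \<noteq> {}" using S(3) by blast
    then show "e \<in> S" using U by simp
  qed
  then show ?thesis using S G by (auto simp: is_tree_def)
qed

text \<open>Without \<open>e\<close> there would be too few edges for a spanning set, so deleting
  \<open>e\<close> disconnects; the resulting separation is crossed by \<open>e\<close>
  alone.\<close>

lemma tree_bridge:
  assumes T: "is_tree T" and e: "e \<in> edges T"
  obtains W where "W \<subseteq> verts T" "edge_cut T W = {e}"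
proof -
  have G: "is_graph T" and card: "card (verts T) = card (edges T) + 1"
    using T by (auto simp: is_tree_def)
  note g = is_graphD[OF G]
  let ?T = "delete_edges T {e}"
  have T': "verts ?T = verts T" "edges ?T = edges T - {e}" "ends ?T = ends T"
    by (auto simp: delete_edges_def)
  have "\<not> is_graph ?T"
  proof
    assume "is_graph ?T"
    from spanning_edges[OF this] obtain S where "S \<subseteq> edges T - {e}" "card S + 1 = card (verts T)"
      unfolding T' by blast
    moreover from this g e have "card S < card (edges T)" by (intro psubset_card_mono) auto
    ultimately show False using card by simp
  qed
  then have "\<not> connected ?T" using G by (auto simp: is_graph_def T')
  moreover have "incidence ?T" using g by (auto simp: incidence_def T')
  ultimately have "\<not> (\<forall>W\<subseteq>verts T. W \<noteq> {} \<longrightarrow> W \<noteq> verts T \<longrightarrow> edge_cut ?T W \<noteq> {})"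
    using connected_cutI[of ?T] g(5) unfolding T' by fast
  then obtain W where W: "W \<subseteq> verts T" "W \<noteq> {}" "W \<noteq> verts T" "edge_cut ?T W = {}"
    by blast
  then have "edge_cut T W \<noteq> {}" by (intro connected_cutD[OF g(4)]) blast+
  moreover have "edge_cut T W \<subseteq> {e}" using W(4) by (auto simp: edge_cut_def T')
  ultimately have "edge_cut T W = {e}" by blast
  with W(1) show thesis using that by blast
qed

text \<open>The extra premise of \<open>step\<close>, that \<open>h\<close> is the only edge from
  \<open>y\<close> back to \<open>W\<close>, lets a construction on \<open>W\<close> be extended
  under the constraints of one edge only. To obtain it, the growing set is kept connected by edges
  inside itself.\<close>

lemma tree_induct:
  assumes T: "is_tree T" and root: "r \<in> verts T" "P {r}"
    and step: "\<And>W x y h. \<lbrakk>P W; W \<subseteq> verts T; h \<in> edges T; ends T h = {x, y}; x \<in> W; y \<in> verts T - W;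
      \<And>h'. \<lbrakk>h' \<in> edges T; y \<in> ends T h'; ends T h' \<inter> W \<noteq> {}\<rbrakk> \<Longrightarrow> h' = h\<rbrakk> \<Longrightarrow> P (insert y W)"
  shows "P (verts T)"
proof -
  have G: "is_graph T" using T by (auto simp: is_tree_def)
  note g = is_graphD[OF G]
  have grow: "\<exists>W. W \<subseteq> verts T \<and> card W = Suc k \<and> P W \<and>
      (\<forall>A. A \<inter> W \<noteq> {} \<longrightarrow> W - A \<noteq> {} \<longrightarrow> (\<exists>e\<in>edge_cut T A. ends T e \<subseteq> W))"
    if "k < card (verts T)" for k
    using that
  proof (induction k)
    case 0
    show ?case using root by (intro exI[of _ "{r}"]) auto
  next
    case (Suc k)
    from Suc.IH[OF Suc_lessD[OF Suc.prems]]
    obtain W where W: "W \<subseteq> verts T" "card W = Suc k" "P W"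
      and cross: "\<forall>A. A \<inter> W \<noteq> {} \<longrightarrow> W - A \<noteq> {} \<longrightarrow> (\<exists>e\<in>edge_cut T A. ends T e \<subseteq> W)"
      by (elim exE conjE)
    have fin: "finite W" using W g finite_subset by blast
    have "W \<noteq> {}" "W \<noteq> verts T" using W(2) Suc.prems by auto
    then have "edge_cut T W \<noteq> {}" using W(1) by (intro connected_cutD[OF g(4)]) blast+
    then obtain h where h: "h \<in> edge_cut T W" by blast
    then obtain x y where xy: "ends T h = {x, y}" "x \<in> W" "y \<notin> W" "y \<in> verts T"
      using cut_endsE[OF g(3)] by blast
    have hE: "h \<in> edges T" using h by (rule cut_edgesD)
    have uniq: "h' = h" if h': "h' \<in> edges T" "y \<in> ends T h'" "ends T h' \<inter> W \<noteq> {}" for h'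
    proof -
      obtain A where A: "edge_cut T A = {h}" by (rule tree_bridge[OF T hE])
      have "h \<in> edge_cut T A" using A by simp
      then have side: "(x \<in> A \<and> y \<notin> A) \<or> (x \<notin> A \<and> y \<in> A)"
        using xy(1) by (auto simp: edge_cut_def)
      \<comment> \<open>\<open>A\<close> is a side of the bridge \<open>h\<close>. If it split
        \<open>W\<close>, an edge inside \<open>W\<close> would cross it, but only \<open>h\<close>
        crosses and \<open>h\<close> leaves \<open>W\<close>.\<close>
      have "\<not> (A \<inter> W \<noteq> {} \<and> W - A \<noteq> {})"
      proof
        assume "A \<inter> W \<noteq> {} \<and> W - A \<noteq> {}"
        with cross have "\<exists>e\<in>edge_cut T A. ends T e \<subseteq> W" by blast
        with A have "ends T h \<subseteq> W" by simp
        with xy show False by simp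
      qed
      moreover obtain z where z: "z \<in> ends T h'" "z \<in> W" using h'(3) by auto
      ultimately have "(z \<in> A \<and> y \<notin> A) \<or> (z \<notin> A \<and> y \<in> A)" using side xy(2) by blast
      then have "h' \<in> edge_cut T A" using h'(1,2) z(1) by (auto simp: edge_cut_def)
      then show "h' = h" using A by simp
    qed
    have "\<forall>A. A \<inter> insert y W \<noteq> {} \<longrightarrow> insert y W - A \<noteq> {} \<longrightarrow>
        (\<exists>e\<in>edge_cut T A. ends T e \<subseteq> insert y W)"
    proof (intro allI impI)
      fix A assume A: "A \<inter> insert y W \<noteq> {}" "insert y W - A \<noteq> {}"
      show "\<exists>e\<in>edge_cut T A. ends T e \<subseteq> insert y W"
      proof (cases "A \<inter> W \<noteq> {} \<and> W - A \<noteq> {}")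
        case True
        with cross obtain e where "e \<in> edge_cut T A" "ends T e \<subseteq> W" by blast
        then show ?thesis by blast
      next
        case False
        then have "(x \<in> A \<and> y \<notin> A) \<or> (x \<notin> A \<and> y \<in> A)" using A xy(2) by blast
        then have "h \<in> edge_cut T A" using hE xy(1) by (auto simp: edge_cut_def)
        moreover have "ends T h \<subseteq> insert y W" using xy by simp
        ultimately show ?thesis by blast
      qed
    qed
    moreover have "P (insert y W)"
    proof (rule step[OF W(3,1) hE xy(1,2)])
      show "y \<in> verts T - W" using xy by simp
    qed (rule uniq)
    moreover have "card (insert y W) = Suc (Suc k)" using W(2) fin xy(3) by simp
    ultimately show ?case using W(1) xy(4) by (intro exI[of _ "insert y W"] conjI) simp_all
  qed
  have "card (verts T) > 0" using g by (simp add: card_gt_0_iff)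
  then obtain k where k: "card (verts T) = Suc k" using gr0_implies_Suc by blast
  then obtain W where "W \<subseteq> verts T" "card W = Suc k" "P W" using grow[of k] by auto
  moreover from this have "W = verts T" using k g(1) by (simp add: card_subset_eq)
  ultimately show ?thesis by simp
qed

section \<open>Chip firing\<close>

definition cut_degree :: "('v, 'e) mgraph \<Rightarrow> 'v set \<Rightarrow> 'v \<Rightarrow> nat" where
  "cut_degree G U v = card {e \<in> edge_cut G U. v \<in> ends G e}"

definition boundary :: "('v, 'e) mgraph \<Rightarrow> 'v set \<Rightarrow> 'v \<Rightarrow> int" where
  "boundary G U = (\<lambda>v. if v \<in> U then int (cut_degree G U v) else 0)"

text \<open>Stated on cuts because \<open>edge_connected\<close> and \<open>vertex_connected\<close>
  quantify over deleted sets of exact size and are weak or vacuous on small graphs.\<close>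

definition cuts_ge :: "nat \<Rightarrow> ('v, 'e) mgraph \<Rightarrow> bool" where
  "cuts_ge k G \<longleftrightarrow> (\<forall>U\<subseteq>verts G. U \<noteq> {} \<longrightarrow> U \<noteq> verts G \<longrightarrow> k \<le> card (edge_cut G U))"

lemma sum_incident_edges:
  fixes f :: "'v \<Rightarrow> int"
  assumes G: "is_graph G" and v: "v \<in> verts G"
  shows "(\<Sum>e | e \<in> edges G \<and> v \<in> ends G e. \<Sum>w\<in>ends G e - {v}. f w)
    = (\<Sum>w\<in>verts G - {v}. int (card (edges_between G v w)) * f w)"
proof -
  note g = is_graphD[OF G]
  let ?E = "{e \<in> edges G. v \<in> ends G e}"
  have "(\<Sum>w\<in>ends G e - {v}. f w) = (\<Sum>w\<in>verts G - {v}. if w \<in> ends G e then f w else 0)"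
    if "e \<in> ?E" for e
  proof -
    have "ends G e - {v} = {w \<in> verts G - {v}. w \<in> ends G e}"
      using that g(3) by (auto simp: incidence_def)
    then show ?thesis using g(1) by (simp add: sum.If_cases Int_def)
  qed
  then have "(\<Sum>e\<in>?E. \<Sum>w\<in>ends G e - {v}. f w)
      = (\<Sum>e\<in>?E. \<Sum>w\<in>verts G - {v}. if w \<in> ends G e then f w else 0)"
    by (rule sum.cong[OF refl])
  also have "\<dots> = (\<Sum>w\<in>verts G - {v}. \<Sum>e\<in>?E. if w \<in> ends G e then f w else 0)"
    by (rule sum.swap)
  also have "\<dots> = (\<Sum>w\<in>verts G - {v}. int (card (edges_between G v w)) * f w)"
  proof (rule sum.cong[OF refl])
    fix w assume w: "w \<in> verts G - {v}"
    have "ends G e = {v, w}" if e: "e \<in> edges G" "v \<in> ends G e" "w \<in> ends G e" for e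
    proof -
      obtain u where "ends G e = {v, u}" by (rule edge_other_endE[OF g(3) e(1,2)])
      with e w show ?thesis by auto
    qed
    then have "edges_between G v w = {e \<in> ?E. w \<in> ends G e}"
      by (auto simp: edges_between_def)
    then show "(\<Sum>e\<in>?E. if w \<in> ends G e then f w else 0) = int (card (edges_between G v w)) * f w"
      using g(2) by (simp add: sum.If_cases Int_def)
  qed
  finally show ?thesis .
qed

text \<open>The inner sum has one term, for the other end of \<open>e\<close>; summing over
  \<open>ends G e - {v}\<close> avoids naming that end. Parallel edges are counted one by one, so
  that cuts can be compared edge by edge.\<close>

lemma laplacian_apply:
  fixes f :: "'v \<Rightarrow> int"
  assumes G: "is_graph G" and v: "v \<in> verts G"
  shows "(\<Sum>w\<in>verts G. laplacian G v w * f w)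
    = (\<Sum>e | e \<in> edges G \<and> v \<in> ends G e. \<Sum>w\<in>ends G e - {v}. f v - f w)"
proof -
  note g = is_graphD[OF G]
  let ?E = "{e \<in> edges G. v \<in> ends G e}"
  have one: "card (ends G e - {v}) = 1" if "e \<in> ?E" for e
    using that g(3) by (auto simp: incidence_def)
  have "(\<Sum>w\<in>verts G. laplacian G v w * f w)
      = laplacian G v v * f v + (\<Sum>w\<in>verts G - {v}. laplacian G v w * f w)"
    using g(1) v by (rule sum.remove)
  also have "(\<Sum>w\<in>verts G - {v}. laplacian G v w * f w)
      = - (\<Sum>w\<in>verts G - {v}. int (card (edges_between G v w)) * f w)"
    unfolding sum_negf[symmetric] by (rule sum.cong) (auto simp: laplacian_def)
  also have "\<dots> = - (\<Sum>e\<in>?E. \<Sum>w\<in>ends G e - {v}. f w)"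
    using sum_incident_edges[OF G v, of f] by simp
  also have "laplacian G v v * f v = (\<Sum>e\<in>?E. \<Sum>w\<in>ends G e - {v}. f v)"
    using one by (simp add: laplacian_def val_def)
  finally show ?thesis by (simp add: sum_subtractf)
qed

lemma laplacian_edge_term:
  fixes f :: "'v \<Rightarrow> int"
  assumes "is_graph G" "e \<in> edges G" "v \<in> ends G e"
  obtains w where "ends G e = {v, w}" "w \<noteq> v" "w \<in> verts G"
    "(\<Sum>w\<in>ends G e - {v}. f v - f w) = f v - f w"
proof -
  obtain w where w: "ends G e = {v, w}" "v \<noteq> w" "v \<in> verts G" "w \<in> verts G"
    by (rule edge_other_endE[OF is_graphD(3)[OF assms(1)] assms(2,3)])
  then have "ends G e - {v} = {w}" by blast
  then show thesis using w by (intro that[of w]) auto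
qed

lemma cut_degree_sum:
  assumes "is_graph G"
  shows "int (cut_degree G U v) =
    (\<Sum>e | e \<in> edges G \<and> v \<in> ends G e. if e \<in> edge_cut G U then 1 else 0)"
proof -
  have "{e \<in> edge_cut G U. v \<in> ends G e} = {e \<in> edges G. v \<in> ends G e} \<inter> {e. e \<in> edge_cut G U}"
    by (auto simp: edge_cut_def)
  then show ?thesis using is_graphD(2)[OF assms] by (simp add: cut_degree_def sum.If_cases)
qed

text \<open>The difference along an edge is nonzero only on the cut, with the sign given by the side
  of \<open>v\<close>: the Laplacian of an indicator is the effect of firing
  \<open>U\<close>.\<close>

lemma laplacian_indicator:
  assumes G: "is_graph G" and v: "v \<in> verts G"
  shows "(\<Sum>w\<in>verts G. laplacian G v w * (if w \<in> U then 1 else 0))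
    = (if v \<in> U then int (cut_degree G U v) else - int (cut_degree G U v))"
proof -
  let ?f = "\<lambda>w. if w \<in> U then 1 else 0 :: int"
  have "(\<Sum>w\<in>ends G e - {v}. ?f v - ?f w)
      = (if v \<in> U then 1 else - 1) * (if e \<in> edge_cut G U then 1 else 0)"
    if e: "e \<in> edges G" "v \<in> ends G e" for e
    by (rule laplacian_edge_term[OF G e, of ?f]) (use e in \<open>auto simp: edge_cut_def\<close>)
  then show ?thesis
    unfolding laplacian_apply[OF G v] cut_degree_sum[OF G]
    by (simp add: sum_distrib_left[symmetric] sum_negf)
qed

text \<open>At a maximum all differences along edges are nonnegative, and by integrality at least
  one along each edge that leaves the maximum set.\<close>

lemma laplacian_at_max:
  fixes f :: "'v \<Rightarrow> int"
  assumes G: "is_graph G" and U: "U = {w \<in> verts G. f w = M}" and v: "v \<in> U"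
    and max: "\<And>w. w \<in> verts G \<Longrightarrow> f w \<le> M"
  shows "int (cut_degree G U v) \<le> (\<Sum>w\<in>verts G. laplacian G v w * f w)"
proof -
  have vV: "v \<in> verts G" using U v by simp
  have "(if e \<in> edge_cut G U then 1 else 0) \<le> (\<Sum>w\<in>ends G e - {v}. f v - f w)"
    if e: "e \<in> edges G" "v \<in> ends G e" for e
  proof (rule laplacian_edge_term[OF G e, of f])
    fix w assume w: "ends G e = {v, w}" "w \<in> verts G"
      "(\<Sum>w\<in>ends G e - {v}. f v - f w) = f v - f w"
    then have "f w \<le> f v" using max U v by auto
    moreover have "f w \<noteq> f v" if "e \<in> edge_cut G U"
      using that w(1,2) U v by (auto simp: edge_cut_def)
    ultimately show ?thesis using w(3) by auto
  qed
  then show ?thesis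
    unfolding laplacian_apply[OF G vV] cut_degree_sum[OF G] by (intro sum_mono) auto
qed

lemma boundary_in_divisors: "U \<subseteq> verts G \<Longrightarrow> boundary G U \<in> divisors G"
  by (auto simp: boundary_def divisors_def)

lemma effective_boundary: "U \<subseteq> verts G \<Longrightarrow> effective G (boundary G U)"
  by (auto simp: effective_def boundary_in_divisors) (simp add: boundary_def)

lemma cut_degree_compl: "incidence G \<Longrightarrow> cut_degree G (verts G - U) v = cut_degree G U v"
  by (simp add: cut_degree_def cut_compl)

lemma boundary_compl_equiv:
  assumes G: "is_graph G" and U: "U \<subseteq> verts G"
  shows "lin_equiv G (boundary G U) (boundary G (verts G - U))"
  unfolding lin_equiv_def
proof (intro conjI exI ballI)
  fix v assume v: "v \<in> verts G"
  show "boundary G U v - boundary G (verts G - U) v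
      = (\<Sum>w\<in>verts G. laplacian G v w * (if w \<in> U then 1 else 0))"
    unfolding laplacian_indicator[OF G v]
    using v by (simp add: boundary_def cut_degree_compl[OF is_graphD(3)[OF G]])
qed (use U in \<open>auto intro: boundary_in_divisors\<close>)

lemma sum_cut_degree:
  assumes G: "is_graph G" and U: "U \<subseteq> verts G"
  shows "(\<Sum>v\<in>U. cut_degree G U v) = card (edge_cut G U)"
proof -
  note g = is_graphD[OF G]
  have "edge_cut G U = (\<Union>v\<in>U. {e \<in> edge_cut G U. v \<in> ends G e})"
    by (auto simp: edge_cut_def)
  moreover have "card (\<Union>v\<in>U. {e \<in> edge_cut G U. v \<in> ends G e}) = (\<Sum>v\<in>U. cut_degree G U v)"
    unfolding cut_degree_def
  proof (rule card_UN_disjoint)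
    show "finite U" using U g(1) by (rule finite_subset)
    show "\<forall>v\<in>U. finite {e \<in> edge_cut G U. v \<in> ends G e}" using g(2) by (simp add: finite_cut)
    show "\<forall>i\<in>U. \<forall>j\<in>U. i \<noteq> j \<longrightarrow>
        {e \<in> edge_cut G U. i \<in> ends G e} \<inter> {e \<in> edge_cut G U. j \<in> ends G e} = {}"
    proof (intro ballI impI equals0I)
      fix i j e assume *: "i \<in> U" "j \<in> U" "i \<noteq> j"
        and "e \<in> {e \<in> edge_cut G U. i \<in> ends G e} \<inter> {e \<in> edge_cut G U. j \<in> ends G e}"
      then have e: "e \<in> edge_cut G U" "i \<in> ends G e" "j \<in> ends G e" by auto
      obtain x y where "ends G e = {x, y}" "y \<notin> U" by (rule cut_endsE[OF g(3) e(1)])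
      with e * show False by auto
    qed
  qed
  ultimately show ?thesis by simp
qed

lemma deg_boundary:
  assumes "is_graph G" "U \<subseteq> verts G"
  shows "deg G (boundary G U) = int (card (edge_cut G U))"
proof -
  have "deg G (boundary G U) = (\<Sum>v\<in>U. int (cut_degree G U v))"
    unfolding deg_def boundary_def using is_graphD(1)[OF assms(1)] assms(2)
    by (simp add: sum.If_cases Int_absorb1)
  then show ?thesis by (simp add: sum_cut_degree[OF assms, symmetric])
qed

section \<open>Linear equivalence and legal firing\<close>

lemma lin_equiv_refl: "D \<in> divisors G \<Longrightarrow> lin_equiv G D D"
  unfolding lin_equiv_def by (auto intro!: exI[of _ "\<lambda>_. 0"])

lemma lin_equiv_sym:
  assumes "lin_equiv G D D'" shows "lin_equiv G D' D"
proof -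
  obtain f where f: "\<forall>v\<in>verts G. D v - D' v = (\<Sum>w\<in>verts G. laplacian G v w * f w)"
    using assms by (auto simp: lin_equiv_def)
  have "\<forall>v\<in>verts G. D' v - D v = (\<Sum>w\<in>verts G. laplacian G v w * (- f w))"
    using f by (simp add: sum_negf) (metis minus_diff_eq)
  then show ?thesis using assms unfolding lin_equiv_def
    by (intro conjI exI[of _ "\<lambda>w. - f w"]) simp_all
qed

lemma lin_equiv_trans:
  assumes "lin_equiv G D D'" "lin_equiv G D' D''" shows "lin_equiv G D D''"
proof -
  obtain f g where f: "\<forall>v\<in>verts G. D v - D' v = (\<Sum>w\<in>verts G. laplacian G v w * f w)"
    and g: "\<forall>v\<in>verts G. D' v - D'' v = (\<Sum>w\<in>verts G. laplacian G v w * g w)"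
    using assms by (auto simp: lin_equiv_def)
  have "\<forall>v\<in>verts G. D v - D'' v = (\<Sum>w\<in>verts G. laplacian G v w * (f w + g w))"
  proof
    fix v assume "v \<in> verts G"
    then show "D v - D'' v = (\<Sum>w\<in>verts G. laplacian G v w * (f w + g w))"
      using f g by (simp add: ring_distribs sum.distrib flip: f g)
  qed
  then show ?thesis using assms unfolding lin_equiv_def
    by (intro conjI exI[of _ "\<lambda>w. f w + g w"]) simp_all
qed

lemma lin_equiv_diff_iff:
  assumes "D \<in> divisors G" "F \<in> divisors G" "D' \<in> divisors G"
  shows "lin_equiv G (\<lambda>v. D v - F v) D' \<longleftrightarrow> lin_equiv G D (\<lambda>v. D' v + F v)"
  using assms by (auto simp: lin_equiv_def divisors_def algebra_simps)

text \<open>The Laplacian is symmetric and kills constants, so everything in its image has degree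
  zero.\<close>

lemma lin_equiv_deg:
  assumes G: "is_graph G" and "lin_equiv G D D'" shows "deg G D = deg G D'"
proof -
  obtain f where f: "\<forall>v\<in>verts G. D v - D' v = (\<Sum>w\<in>verts G. laplacian G v w * f w)"
    using assms by (auto simp: lin_equiv_def)
  have sym: "laplacian G v w = laplacian G w v" for v w
    by (simp add: laplacian_def edges_between_def insert_commute)
  have "deg G D - deg G D' = (\<Sum>v\<in>verts G. \<Sum>w\<in>verts G. laplacian G v w * f w)"
    using f by (simp add: deg_def flip: sum_subtractf)
  also have "\<dots> = (\<Sum>w\<in>verts G. (\<Sum>v\<in>verts G. laplacian G w v * 1) * f w)"
    unfolding sum_distrib_right by (subst sum.swap) (simp add: sym)
  also have "\<dots> = 0"
    by (intro sum.neutral ballI) (subst laplacian_apply[OF G], simp_all)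
  finally show ?thesis by simp
qed

text \<open>A constant connecting function would give \<open>D = D'\<close>, so its maximum set is
  proper. The bound says more than legality: after firing, at least \<open>D' v\<close> chips remain
  at each \<open>v\<close> in \<open>U\<close>, which in the tight case forces \<open>D'\<close> to
  vanish there.\<close>

lemma firing_set:
  assumes G: "is_graph G" and eq: "lin_equiv G D D'" and neq: "D \<noteq> D'"
  obtains U where "U \<subseteq> verts G" "U \<noteq> {}" "U \<noteq> verts G"
    "\<And>v. v \<in> U \<Longrightarrow> D' v + int (cut_degree G U v) \<le> D v"
proof -
  note g = is_graphD[OF G]
  obtain f where f: "\<forall>v\<in>verts G. D v - D' v = (\<Sum>w\<in>verts G. laplacian G v w * f w)"
    using eq by (auto simp: lin_equiv_def)
  define M where "M = Max (f ` verts G)"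
  define U where "U = {v \<in> verts G. f v = M}"
  have max: "f w \<le> M" if "w \<in> verts G" for w using that g(1) by (simp add: M_def)
  have "M \<in> f ` verts G" unfolding M_def using g(1,5) by simp
  then have "U \<noteq> {}" by (auto simp: U_def)
  moreover have "U \<noteq> verts G"
  proof
    assume "U = verts G"
    then have const: "f w = M" if "w \<in> verts G" for w using that by (auto simp: U_def)
    have "D v = D' v" for v
    proof (cases "v \<in> verts G")
      case True
      have "(\<Sum>w\<in>ends G e - {v}. f v - f w) = 0" if e: "e \<in> edges G" "v \<in> ends G e" for e
        by (rule laplacian_edge_term[OF G e, of f]) (use True const in auto)
      then have "(\<Sum>w\<in>verts G. laplacian G v w * f w) = 0"
        unfolding laplacian_apply[OF G True] by simp
      with f True have "D v - D' v = 0" by simp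
      then show ?thesis by simp
    next
      case False with eq show ?thesis by (auto simp: lin_equiv_def divisors_def)
    qed
    with neq show False by blast
  qed
  moreover have "D' v + int (cut_degree G U v) \<le> D v" if "v \<in> U" for v
  proof -
    have "int (cut_degree G U v) \<le> (\<Sum>w\<in>verts G. laplacian G v w * f w)"
      using that max by (intro laplacian_at_max[OF G U_def]) auto
    with f that show ?thesis by (auto simp: U_def)
  qed
  moreover have "U \<subseteq> verts G" by (auto simp: U_def)
  ultimately show thesis by (intro that)
qed

lemma effective_nonneg: "effective G D \<Longrightarrow> 0 \<le> D v"
  by (cases "v \<in> verts G") (auto simp: effective_def divisors_def)

lemma sum_le_deg:
  assumes "finite (verts G)" "effective G D" "U \<subseteq> verts G"
  shows "(\<Sum>v\<in>U. D v) \<le> deg G D"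
  unfolding deg_def using assms by (intro sum_mono2) (auto intro: effective_nonneg)

lemma cut_le_deg:
  assumes G: "is_graph G" and D: "effective G D" and D': "effective G D'" and U: "U \<subseteq> verts G"
    and fire: "\<And>v. v \<in> U \<Longrightarrow> D' v + int (cut_degree G U v) \<le> D v"
  shows "int (card (edge_cut G U)) \<le> deg G D"
proof -
  have "int (card (edge_cut G U)) = (\<Sum>v\<in>U. int (cut_degree G U v))"
    by (simp add: sum_cut_degree[OF G U, symmetric])
  also have "\<dots> \<le> (\<Sum>v\<in>U. D v)"
    by (rule sum_mono) (use fire effective_nonneg[OF D'] in \<open>smt (verit)\<close>)
  also have "\<dots> \<le> deg G D" using is_graphD(1)[OF G] D U by (rule sum_le_deg)
  finally show ?thesis .
qed

lemma deg_ge_of_equiv: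
  assumes G: "is_graph G" and "cuts_ge k G" and "effective G D" "effective G D'"
    and "lin_equiv G D D'" "D \<noteq> D'"
  shows "int k \<le> deg G D"
proof -
  obtain U where U: "U \<subseteq> verts G" "U \<noteq> {}" "U \<noteq> verts G"
    "\<And>v. v \<in> U \<Longrightarrow> D' v + int (cut_degree G U v) \<le> D v"
    by (rule firing_set[OF G assms(5,6)]) blast
  then have "k \<le> card (edge_cut G U)" using assms(2) by (auto simp: cuts_ge_def)
  also have "int (card (edge_cut G U)) \<le> deg G D"
    by (rule cut_le_deg[OF G assms(3,4) U(1)]) (rule U(4))
  finally show ?thesis by simp
qed

text \<open>If the degree equals the smallest cut size, the first firing set uses up all chips, so
  it determines the divisor and misses the support of the target.\<close>

lemma tight_firing_set:
  assumes G: "is_graph G" and k: "cuts_ge k G" and D: "effective G D" and D': "effective G D'"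
    and deg: "deg G D = int k" and eq: "lin_equiv G D D'" "D \<noteq> D'"
  obtains U where "U \<subseteq> verts G" "card (edge_cut G U) = k" "D = boundary G U"
    "\<And>v. v \<in> U \<Longrightarrow> D' v = 0"
proof -
  note g = is_graphD[OF G]
  obtain U where U: "U \<subseteq> verts G" "U \<noteq> {}" "U \<noteq> verts G"
    "\<And>v. v \<in> U \<Longrightarrow> D' v + int (cut_degree G U v) \<le> D v"
    by (rule firing_set[OF G eq]) blast
  have "k \<le> card (edge_cut G U)" using U(1-3) k by (simp add: cuts_ge_def)
  moreover have "int (card (edge_cut G U)) \<le> deg G D"
    by (rule cut_le_deg[OF G D D' U(1)]) (rule U(4))
  ultimately have cut: "card (edge_cut G U) = k" using deg by simp
  have ge: "0 \<le> D v - boundary G U v" for v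
    using U(4)[of v] effective_nonneg[OF D', of v] effective_nonneg[OF D, of v]
    by (cases "v \<in> U") (simp_all add: boundary_def)
  have "(\<Sum>v\<in>verts G. D v - boundary G U v) = 0"
    using deg deg_boundary[OF G U(1)] cut by (simp add: deg_def sum_subtractf)
  then have "D v = boundary G U v" if "v \<in> verts G" for v
    using g(1) ge that by (simp add: sum_nonneg_eq_0_iff)
  moreover have "D v = boundary G U v" if "v \<notin> verts G" for v
    using that D U(1) by (auto simp: effective_def divisors_def boundary_def)
  ultimately have B: "D = boundary G U" by blast
  have "D' v = 0" if "v \<in> U" for v
    using U(4)[OF that] that effective_nonneg[OF D', of v] unfolding B by (simp add: boundary_def)
  with U(1) cut B show thesis by (intro that)
qed

section \<open>Rank one and gonality\<close>

lemma deg_point: "finite (verts G) \<Longrightarrow> v \<in> verts G \<Longrightarrow> deg G (\<lambda>w. c * point v w) = c"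
  by (simp add: deg_def point_def flip: sum_distrib_left)

lemma effective_point: "v \<in> verts G \<Longrightarrow> 0 \<le> c \<Longrightarrow> effective G (\<lambda>w. c * point v w)"
  by (simp add: effective_def divisors_def point_def)

text \<open>An effective divisor of degree one is a single vertex, and subtracting it leaves an
  effective class exactly when some effective divisor equivalent to \<open>D\<close> has a chip
  there.\<close>

lemma rank_ge_1_iff:
  assumes G: "is_graph G" and D: "D \<in> divisors G"
  shows "1 \<le> rank G D \<longleftrightarrow> (\<forall>v\<in>verts G. \<exists>D'. effective G D' \<and> lin_equiv G D D' \<and> 1 \<le> D' v)"
proof -
  note g = is_graphD[OF G]
  define P where "P k \<longleftrightarrow> (\<forall>F. effective G F \<and> deg G F = int k \<longrightarrow>
      (\<exists>D'. effective G D' \<and> lin_equiv G (\<lambda>v. D v - F v) D'))" for k :: nat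
  have rank: "rank G D = (if \<exists>D'. effective G D' \<and> lin_equiv G D D' then int (Greatest P) else - 1)"
    unfolding rank_def P_def ..
  obtain r where r: "r \<in> verts G" using g(5) by blast
  \<comment> \<open>Testing with \<open>k\<close> chips at one vertex bounds \<open>k\<close> by the
    degree, so \<open>GREATEST\<close> ranges over a bounded set.\<close>
  have bound: "k \<le> nat (deg G D)" if "P k" for k
  proof -
    have "effective G (\<lambda>w. int k * point r w)" "deg G (\<lambda>w. int k * point r w) = int k"
      using r g(1) by (simp_all add: effective_point deg_point)
    with \<open>P k\<close> obtain D' where D': "effective G D'" "lin_equiv G (\<lambda>v. D v - int k * point r v) D'"
      unfolding P_def by blast
    have "deg G D - int k = deg G (\<lambda>v. D v - int k * point r v)"
      using deg_point[OF g(1) r, of "int k"] by (simp add: deg_def sum_subtractf)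
    also have "\<dots> = deg G D'" using G D'(2) by (rule lin_equiv_deg)
    also have "\<dots> \<ge> 0" unfolding deg_def by (intro sum_nonneg effective_nonneg[OF D'(1)])
    finally show ?thesis by simp
  qed
  show ?thesis
  proof
    assume "1 \<le> rank G D"
    then have ex: "\<exists>D'. effective G D' \<and> lin_equiv G D D'" and ge: "1 \<le> Greatest P"
      by (auto simp: rank split: if_splits)
    \<comment> \<open>\<open>P 0\<close> only asks for one effective divisor equivalent to
      \<open>D\<close>; it is the witness that \<open>GreatestI_nat\<close> needs.\<close>
    have "P 0"
      unfolding P_def
    proof (intro allI impI)
      fix F assume F: "effective G F \<and> deg G F = int 0"
      then have "(\<Sum>v\<in>verts G. F v) = 0" by (simp add: deg_def)
      then have "\<forall>v\<in>verts G. F v = 0"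
        using F g(1) effective_nonneg[of G F] by (simp add: sum_nonneg_eq_0_iff)
      then have "F = (\<lambda>_. 0)" using F by (auto simp: effective_def divisors_def)
      then show "\<exists>D'. effective G D' \<and> lin_equiv G (\<lambda>v. D v - F v) D'" using ex by simp
    qed
    then have P: "P (Greatest P)" by (rule GreatestI_nat) (use bound in blast)
    show "\<forall>v\<in>verts G. \<exists>D'. effective G D' \<and> lin_equiv G D D' \<and> 1 \<le> D' v"
    proof
      fix v assume v: "v \<in> verts G"
      \<comment> \<open>The rank may exceed one. Removing all \<open>c\<close> chips at
        \<open>v\<close> and adding them back avoids showing that \<open>P\<close> is downward
        closed.\<close>
      define c where "c = int (Greatest P)"
      have c: "1 \<le> c" using ge by (simp add: c_def)
      have F: "effective G (\<lambda>w. c * point v w)" "deg G (\<lambda>w. c * point v w) = c"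
        using c v g(1) by (simp_all add: effective_point deg_point)
      then obtain D' where D': "effective G D'" "lin_equiv G (\<lambda>w. D w - c * point v w) D'"
        using P unfolding P_def c_def by blast
      have eq: "lin_equiv G D (\<lambda>w. D' w + c * point v w)"
        using D' F(1) D by (subst lin_equiv_diff_iff[symmetric]) (auto simp: effective_def)
      moreover have "effective G (\<lambda>w. D' w + c * point v w)"
        using D'(1) F(1) by (auto simp: effective_def divisors_def)
      moreover have "1 \<le> D' v + c * point v v"
        using c effective_nonneg[OF D'(1), of v] by (simp add: point_def)
      ultimately show "\<exists>D'. effective G D' \<and> lin_equiv G D D' \<and> 1 \<le> D' v" by blast
    qed
  next
    assume R: "\<forall>v\<in>verts G. \<exists>D'. effective G D' \<and> lin_equiv G D D' \<and> 1 \<le> D' v"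
    have "P 1"
      unfolding P_def
    proof (intro allI impI)
      fix F assume F: "effective G F \<and> deg G F = int 1"
      then have one: "(\<Sum>v\<in>verts G. F v) = 1" by (simp add: deg_def)
      then obtain v where v: "v \<in> verts G" "F v \<noteq> 0"
        by (metis sum.neutral zero_neq_one)
      then have Fv: "1 \<le> F v" using F effective_nonneg[of G F v] by linarith
      have "(\<Sum>w\<in>verts G. F w) = F v + (\<Sum>w\<in>verts G - {v}. F w)"
        using g(1) v(1) by (rule sum.remove)
      moreover have nn: "0 \<le> (\<Sum>w\<in>verts G - {v}. F w)"
        using F effective_nonneg[of G F] by (intro sum_nonneg) auto
      ultimately have "F v = 1" and "(\<Sum>w\<in>verts G - {v}. F w) = 0" using Fv one by linarith+
      then have "\<forall>w\<in>verts G - {v}. F w = 0"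
        using F g(1) effective_nonneg[of G F] by (simp add: sum_nonneg_eq_0_iff)
      have F_eq: "F = point v"
      proof
        fix w show "F w = point v w"
          using F \<open>F v = 1\<close> \<open>\<forall>w\<in>verts G - {v}. F w = 0\<close>
          by (cases "w = v"; cases "w \<in> verts G") (simp_all add: effective_def divisors_def point_def)
      qed
      obtain D' where D': "effective G D'" "lin_equiv G D D'" "1 \<le> D' v" using R v(1) by blast
      have pt: "point v \<in> divisors G" using v(1) by (auto simp: divisors_def point_def)
      have "effective G (\<lambda>w. D' w - point v w)"
        using D'(1,3) v(1) by (auto simp: effective_def divisors_def point_def)
      moreover from this have "lin_equiv G (\<lambda>w. D w - point v w) (\<lambda>w. D' w - point v w)"
        using D'(2) pt D by (subst lin_equiv_diff_iff) (auto simp: effective_def)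
      ultimately show "\<exists>D'. effective G D' \<and> lin_equiv G (\<lambda>v. D v - F v) D'"
        unfolding F_eq by blast
    qed
    then have "1 \<le> Greatest P" by (rule Greatest_le_nat) (use bound in blast)
    moreover have "\<exists>D'. effective G D' \<and> lin_equiv G D D'" using R r by blast
    ultimately show "1 \<le> rank G D" by (simp add: rank)
  qed
qed

text \<open>The divisor with one chip on every vertex shows that the minimum in
  \<open>gonality\<close> is taken over a nonempty set.\<close>

lemma gonality_divisor:
  assumes G: "is_graph G"
  obtains D where "effective G D" "deg G D = int (gonality G)" "1 \<le> rank G D"
proof -
  define D where "D = (\<lambda>v. if v \<in> verts G then 1 else 0 :: int)"
  have "effective G D" by (auto simp: D_def effective_def divisors_def)
  moreover have "deg G D = int (card (verts G))" by (simp add: deg_def D_def)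
  moreover have "1 \<le> rank G D"
  proof (rule iffD2[OF rank_ge_1_iff[OF G]], goal_cases)
    case 1 show ?case by (simp add: D_def divisors_def)
  next
    case 2
    have "lin_equiv G D D" by (rule lin_equiv_refl) (simp add: D_def divisors_def)
    moreover have "1 \<le> D v" if "v \<in> verts G" for v using that by (simp add: D_def)
    ultimately show ?case using \<open>effective G D\<close> by blast
  qed
  ultimately have "\<exists>D. effective G D \<and> deg G D = int (card (verts G)) \<and> rank G D \<ge> 1" by blast
  then have "\<exists>D. effective G D \<and> deg G D = int (gonality G) \<and> rank G D \<ge> 1"
    unfolding gonality_def by (rule LeastI)
  then show thesis using that by blast
qed

text \<open>For the lower bound: a divisor of positive rank either has a chip everywhere, hence
  degree at least the number of vertices, or must reach an empty vertex through a different
  equivalent divisor, and then the cut bound applies.\<close>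

lemma gonality_eqI:
  assumes G: "is_graph G" and k: "cuts_ge k G" "k \<le> card (verts G)"
    and D: "effective G D" "deg G D = int k" "1 \<le> rank G D"
  shows "gonality G = k"
  unfolding gonality_def
proof (rule Least_equality)
  fix d assume "\<exists>D. effective G D \<and> deg G D = int d \<and> rank G D \<ge> 1"
  then obtain E where E: "effective G E" "deg G E = int d" "1 \<le> rank G E" by blast
  note g = is_graphD[OF G]
  show "k \<le> d"
  proof (cases "\<exists>v\<in>verts G. E v = 0")
    case True
    then obtain v where v: "v \<in> verts G" "E v = 0" by blast
    have "E \<in> divisors G" using E(1) by (simp add: effective_def)
    from iffD1[OF rank_ge_1_iff[OF G this] E(3)] v(1)
    obtain E' where E': "effective G E'" "lin_equiv G E E'" "1 \<le> E' v" by blast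
    with v(2) have "E \<noteq> E'" by auto
    from deg_ge_of_equiv[OF G k(1) E(1) E'(1,2) this] E(2) show ?thesis by simp
  next
    case False
    then have "1 \<le> E v" if "v \<in> verts G" for v
      using effective_nonneg[OF E(1), of v] that by fastforce
    then have "(\<Sum>v\<in>verts G. 1) \<le> deg G E" unfolding deg_def by (intro sum_mono)
    then show ?thesis using E(2) k(2) by simp
  qed
qed (use D in blast)

section \<open>Connectivity\<close>

text \<open>\<open>edge_connected 3\<close> deletes exactly two edges, so a smaller cut is padded to
  two; three vertices guarantee that two edges exist.\<close>

lemma cuts_ge_if_edge_connected:
  assumes G: "is_graph G" and conn: "edge_connected 3 G" and V: "3 \<le> card (verts G)"
  shows "cuts_ge 3 G"
  unfolding cuts_ge_def
proof (intro allI impI)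
  fix U assume U: "U \<subseteq> verts G" "U \<noteq> {}" "U \<noteq> verts G"
  note g = is_graphD[OF G]
  show "3 \<le> card (edge_cut G U)"
  proof (rule ccontr)
    assume "\<not> 3 \<le> card (edge_cut G U)"
    then have "card (edge_cut G U) \<le> 2" by simp
    moreover from spanning_edges[OF G] obtain S where "S \<subseteq> edges G" "card S + 1 = card (verts G)"
      by (elim exE conjE)
    then have "2 \<le> card (edges G)" using V card_mono[OF g(2), of S] by simp
    moreover have "edge_cut G U \<subseteq> edges G" by (auto simp: edge_cut_def)
    ultimately obtain S where S: "edge_cut G U \<subseteq> S" "S \<subseteq> edges G" "card S = 2"
      using exists_subset_between[OF _ _ _ g(2), of "edge_cut G U" 2] by blast
    then have "connected (delete_edges G S)" using conn by (simp add: edge_connected_def)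
    then have "edge_cut (delete_edges G S) U \<noteq> {}"
      by (rule connected_cutD) (use U in \<open>auto simp: delete_edges_def\<close>)
    then show False using S(1) by (auto simp: edge_cut_def delete_edges_def)
  qed
qed

lemma separating_pair:
  assumes conn: "vertex_connected 3 G" and S: "S \<subseteq> verts G" "card S = 2"
    and U: "U \<inter> verts G - S \<noteq> {}" "verts G - U - S \<noteq> {}"
  obtains e where "e \<in> edge_cut G U" "ends G e \<inter> S = {}"
proof -
  have "connected (delete_verts G S)" using conn S by (simp add: vertex_connected_def)
  then have "edge_cut (delete_verts G S) U \<noteq> {}"
    by (rule connected_cutD) (use U in \<open>auto simp: delete_verts_def\<close>)
  then obtain e where "e \<in> edge_cut (delete_verts G S) U" by blast
  then have "e \<in> edge_cut G U \<and> ends G e \<inter> S = {}"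
    by (simp add: edge_cut_def delete_verts_def)
  then show thesis using that by blast
qed

text \<open>With at most two cut edges, their ends in \<open>U\<close> fit into a pair
  \<open>S\<close> inside \<open>U\<close>. Deleting \<open>S\<close> still leaves a vertex of
  \<open>U\<close>, now cut off from the outside.\<close>

lemma large_side_cut:
  assumes G: "is_graph G" and conn: "vertex_connected 3 G"
    and U: "U \<subseteq> verts G" "U \<noteq> verts G" "3 \<le> card U"
  shows "3 \<le> card (edge_cut G U)"
proof (rule ccontr)
  assume "\<not> 3 \<le> card (edge_cut G U)"
  note g = is_graphD[OF G]
  have finU: "finite U" using U(1) g(1) by (rule finite_subset)
  define f where "f e = (SOME v. v \<in> ends G e \<and> v \<in> U)" for e
  have f: "f e \<in> ends G e \<and> f e \<in> U" if "e \<in> edge_cut G U" for e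
  proof -
    have "\<exists>v. v \<in> ends G e \<and> v \<in> U" using that by (auto simp: edge_cut_def)
    then show ?thesis unfolding f_def by (rule someI_ex)
  qed
  have "card (f ` edge_cut G U) \<le> card (edge_cut G U)"
    using g(2) by (intro card_image_le finite_cut)
  then have "card (f ` edge_cut G U) \<le> 2" using \<open>\<not> 3 \<le> card (edge_cut G U)\<close> by simp
  then obtain S where S: "f ` edge_cut G U \<subseteq> S" "S \<subseteq> U" "card S = 2"
    using exists_subset_between[OF _ _ _ finU, of "f ` edge_cut G U" 2] f U(3) by fastforce
  have "U - S \<noteq> {}"
  proof
    assume "U - S = {}"
    then have "U = S" using S(2) by blast
    with S(3) U(3) show False by simp
  qed
  then have "U \<inter> verts G - S \<noteq> {}" "verts G - U - S \<noteq> {}" using U S(2) by blast+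
  then obtain e where "e \<in> edge_cut G U" "ends G e \<inter> S = {}"
    by (rule separating_pair[OF conn subset_trans[OF S(2) U(1)] S(3)])
  with f S(1) show False by blast
qed

text \<open>Either one side has at least three vertices, or both have exactly two. In the latter
  case, deleting an inner end of one cut edge and an outer end of the other leaves one vertex on
  each side.\<close>

lemma cuts_ge_if_vertex_connected:
  assumes G: "is_graph G" and conn: "vertex_connected 3 G" and V: "4 \<le> card (verts G)"
  shows "cuts_ge 3 G"
  unfolding cuts_ge_def
proof (intro allI impI)
  fix U assume U: "U \<subseteq> verts G" "U \<noteq> {}" "U \<noteq> verts G"
  note g = is_graphD[OF G]
  have card: "card (verts G - U) = card (verts G) - card U"
    using U(1) g(1) finite_subset by (intro card_Diff_subset) blast+
  consider "3 \<le> card U" | "3 \<le> card (verts G - U)" | "card U = 2" "card (verts G - U) = 2"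
    using V card by linarith
  then show "3 \<le> card (edge_cut G U)"
  proof cases
    case 1 then show ?thesis by (intro large_side_cut[OF G conn U(1,3)])
  next
    case 2
    then have "3 \<le> card (edge_cut G (verts G - U))"
      using U by (intro large_side_cut[OF G conn]) blast+
    then show ?thesis by (simp add: cut_compl[OF g(3)])
  next
    case 3
    show ?thesis
    proof (rule ccontr)
      assume small: "\<not> 3 \<le> card (edge_cut G U)"
      have ne: "edge_cut G U \<noteq> {}" using U by (intro connected_cutD[OF g(4)]) blast+
      then have "card (edge_cut G U) \<noteq> 0" using g(2) by (simp add: finite_cut)
      then consider "card (edge_cut G U) = 1" | "card (edge_cut G U) = 2" using small by linarith
      \<comment> \<open>\<open>e1 = e2\<close> is allowed: this covers a cut with a single
        edge.\<close>
      then obtain e1 e2 where e: "edge_cut G U = {e1, e2}"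
        by cases (auto simp: card_1_singleton_iff card_2_iff)
      then have "e1 \<in> edge_cut G U" "e2 \<in> edge_cut G U" by simp_all
      obtain a where a: "a \<in> ends G e1" "a \<in> U"
        by (rule cut_endsE[OF g(3) \<open>e1 \<in> edge_cut G U\<close>]) blast
      obtain b where b: "b \<in> ends G e2" "b \<notin> U" "b \<in> verts G"
        by (rule cut_endsE[OF g(3) \<open>e2 \<in> edge_cut G U\<close>]) blast
      have "a \<noteq> b" using a b by blast
      have "U \<noteq> {a}" "verts G - U \<noteq> {b}" using 3 by auto
      then have "U \<inter> verts G - {a, b} \<noteq> {}" "verts G - U - {a, b} \<noteq> {}" "{a, b} \<subseteq> verts G"
        using a b U by auto
      moreover have "card {a, b} = 2" using \<open>a \<noteq> b\<close> by simp
      ultimately obtain e' where "e' \<in> edge_cut G U" "ends G e' \<inter> {a, b} = {}"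
        by (rule_tac separating_pair[OF conn])
      then show False using e a b by auto
    qed
  qed
qed

section \<open>Tree morphisms\<close>

lemma tree_incident_edge:
  assumes T: "is_tree T" and "edges T \<noteq> {}" and x: "x \<in> verts T"
  obtains h where "h \<in> edges T" "x \<in> ends T h"
proof -
  note t = is_graphD[OF conjunct1[OF T[unfolded is_tree_def]]]
  obtain h where "h \<in> edges T" using assms(2) by blast
  then obtain y z where "y \<in> verts T" "z \<in> verts T" "y \<noteq> z" by (rule edge_endsE[OF t(3)])
  then have "edge_cut T {x} \<noteq> {}" using x by (intro connected_cutD[OF t(4)]) blast+
  then show thesis using that by (auto simp: edge_cut_def)
qed

lemma morphism_edge:
  assumes "morphism G T p q" "incidence G" "e \<in> edges G" "q e = Inl h"
  shows "h \<in> edges T" "ends T h = p ` ends G e"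
proof -
  obtain u v where uv: "ends G e = {u, v}" by (rule edge_endsE[OF assms(2,3)])
  from assms(1,3) uv have "if p u = p v then q e = Inr (p u)
      else \<exists>e'\<in>edges T. q e = Inl e' \<and> ends T e' = {p u, p v}"
    unfolding morphism_def by blast
  with assms(4) uv show "h \<in> edges T" "ends T h = p ` ends G e" by (auto split: if_splits)
qed

text \<open>Moves a morphism onto a tree over arbitrary types to a copy over \<open>nat\<close>.
  Since \<open>T\<close> has an edge, neither the multiplicities nor the degree take their default
  value 0.\<close>

lemma has_tree_morphismI:
  fixes G :: "('v, 'e) mgraph" and T :: "('w, 'f) mgraph"
  assumes G: "is_graph G" and T: "is_tree T" and mor: "morphism G T p q" and ne: "edges T \<noteq> {}"
    and fibre: "\<And>h. h \<in> edges T \<Longrightarrow> card {e \<in> edges G. q e = Inl h} = d"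
    and pos: "\<And>v. v \<in> verts G \<Longrightarrow> 0 < (m v :: nat)"
    and loc: "\<And>v h. \<lbrakk>v \<in> verts G; h \<in> edges T; p v \<in> ends T h\<rbrakk> \<Longrightarrow> local_mult G q v h = m v"
  shows "has_tree_morphism G d"
proof -
  note g = is_graphD[OF G]
  have GT: "is_graph T" using T by (simp add: is_tree_def)
  note t = is_graphD[OF GT]
  obtain i :: "'w \<Rightarrow> nat" where i: "inj_on i (verts T)"
    using finite_imp_inj_to_nat_seg[OF t(1)] by blast
  obtain j :: "'f \<Rightarrow> nat" where j: "inj_on j (edges T)"
    using finite_imp_inj_to_nat_seg[OF t(2)] by blast
  define T' where "T' = \<lparr>verts = i ` verts T, edges = j ` edges T,
    ends = \<lambda>n. i ` ends T (inv_into (edges T) j n)\<rparr>"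
  define q' where "q' e = (case q e of Inl h \<Rightarrow> Inl (j h) | Inr x \<Rightarrow> Inr (i x))" for e
  have T': "verts T' = i ` verts T" "edges T' = j ` edges T"
    "\<And>h. h \<in> edges T \<Longrightarrow> ends T' (j h) = i ` ends T h"
    using j by (auto simp: T'_def)
  have pV: "p v \<in> verts T" if "v \<in> verts G" for v using mor that by (auto simp: morphism_def)
  have sub: "ends T h \<subseteq> verts T" "card (ends T h) = 2" if "h \<in> edges T" for h
    using t(3) that by (auto simp: incidence_def)
  have inc: "incidence T'"
    unfolding incidence_def T'(1,2)
  proof (clarify, intro conjI)
    fix h assume h: "h \<in> edges T"
    show "ends T' (j h) \<subseteq> i ` verts T" using sub(1)[OF h] T'(3)[OF h] by auto
    show "card (ends T' (j h)) = 2"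
      using sub[OF h] T'(3)[OF h] card_image[OF inj_on_subset[OF i sub(1)[OF h]]] by simp
  qed
  have "connected T'"
  proof (rule connected_image[OF t(4) inc T'(1) t(3)])
    fix e u v assume "e \<in> edges T" "ends T e = {u, v}"
    then show "\<exists>h\<in>edges T'. ends T' h = {i u, i v}"
      using T'(2) T'(3)[of e] by (intro bexI[of _ "j e"]) auto
  qed
  then have "is_graph T'" using inc t(1,2) by (simp add: is_graph_def incidence_def T'(1,2))
  then have tree: "is_tree T'"
    using T i j by (simp add: is_tree_def T'(1,2) card_image)
  have mor': "morphism G T' (i \<circ> p) q'"
    unfolding morphism_def
  proof (intro conjI ballI allI impI)
    show "(i \<circ> p) ` verts G \<subseteq> verts T'" using pV T'(1) by auto
    fix e u v assume e: "e \<in> edges G" "ends G e = {u, v}"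
    then have "u \<in> verts G" "v \<in> verts G" using g(3) by (auto simp: incidence_def)
    then have eq: "(i \<circ> p) u = (i \<circ> p) v \<longleftrightarrow> p u = p v" using i pV by (simp add: inj_on_eq_iff)
    have m: "if p u = p v then q e = Inr (p u)
        else \<exists>e'\<in>edges T. q e = Inl e' \<and> ends T e' = {p u, p v}"
      using mor e unfolding morphism_def by blast
    show "if (i \<circ> p) u = (i \<circ> p) v then q' e = Inr ((i \<circ> p) u)
        else \<exists>e'\<in>edges T'. q' e = Inl e' \<and> ends T' e' = {(i \<circ> p) u, (i \<circ> p) v}"
    proof (cases "p u = p v")
      case True then show ?thesis using m by (simp add: q'_def)
    next
      case False
      then obtain h where "h \<in> edges T" "q e = Inl h" "ends T h = {p u, p v}" using m by auto
      then show ?thesis using False eq T'(2) T'(3)[of h]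
        by (auto simp: q'_def intro!: bexI[of _ "j h"])
    qed
  qed
  have q': "q' e = Inl (j h) \<longleftrightarrow> q e = Inl h" if "e \<in> edges G" "h \<in> edges T" for e h
    using morphism_edge(1)[OF mor g(3) that(1)] j that(2)
    by (auto simp: q'_def inj_on_eq_iff split: sum.splits)
  have loc': "local_mult G q' v n = m v" 
    if v: "v \<in> verts G" and n: "n \<in> edges T'" and inc: "(i \<circ> p) v \<in> ends T' n" for v n
  proof -
    obtain h where h: "h \<in> edges T" "n = j h" using n T'(2) by auto
    have "i (p v) \<in> i ` ends T h" using inc T'(3)[OF h(1)] h(2) by simp
    then have "p v \<in> ends T h"
      using i pV[OF v] sub(1)[OF h(1)] by (simp add: inj_on_image_mem_iff)
    moreover have "local_mult G q' v n = local_mult G q v h"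
      unfolding local_mult_def h(2) using q'[OF _ h(1)] by (intro arg_cong[where f = card]) auto
    ultimately show ?thesis using loc[OF v h(1)] by simp
  qed
  have "harmonic G T' (i \<circ> p) q'"
    unfolding harmonic_def using mor' loc' by simp
  moreover have "nondegenerate G T' (i \<circ> p) q'"
    unfolding nondegenerate_def
  proof
    fix v assume v: "v \<in> verts G"
    have "edges T' \<noteq> {}" using ne T'(2) by simp
    moreover have "(i \<circ> p) v \<in> verts T'" using pV[OF v] T'(1) by simp
    ultimately obtain n where n: "n \<in> edges T'" "(i \<circ> p) v \<in> ends T' n"
      by (rule tree_incident_edge[OF tree])
    let ?n = "SOME e'. e' \<in> edges T' \<and> (i \<circ> p) v \<in> ends T' e'"
    have "?n \<in> edges T' \<and> (i \<circ> p) v \<in> ends T' ?n"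
      by (rule someI[of _ n]) (use n in simp)
    then have "local_mult G q' v ?n = m v" using loc'[OF v] by blast
    then show "0 < mult G T' (i \<circ> p) q' v" using n pos[OF v] unfolding mult_def by auto
  qed
  moreover have "morphism_degree G T' q' = d"
  proof -
    have ne': "edges T' \<noteq> {}" using ne T'(2) by simp
    then have "(SOME n. n \<in> edges T') \<in> edges T'" by (simp add: some_in_eq)
    then obtain h where h: "h \<in> edges T" "(SOME n. n \<in> edges T') = j h" using T'(2) by auto
    have "{e \<in> edges G. q' e = Inl (j h)} = {e \<in> edges G. q e = Inl h}" using q'[OF _ h(1)] by auto
    then show ?thesis using fibre[OF h(1)] h(2) ne' by (simp add: morphism_degree_def)
  qed
  ultimately show ?thesis using tree unfolding has_tree_morphism_def by blast
qed

text \<open>The divisors \<open>M x\<close> obtained by pulling back the vertices \<open>x\<close> of the tree are all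
  equivalent, because every edge of a tree is a bridge and its preimage is a cut.\<close>

lemma gonality_if_tree_morphism:
  assumes G: "is_graph G" and k: "cuts_ge d G" "d \<le> card (verts G)" "0 < d"
    and mor: "has_tree_morphism G d"
  shows "gonality G = d"
proof -
  note g = is_graphD[OF G]
  obtain T :: "(nat, nat) mgraph" and p q where T: "is_tree T" and har: "harmonic G T p q"
    and nd: "nondegenerate G T p q" and dg: "morphism_degree G T q = d"
    using mor unfolding has_tree_morphism_def by blast
  have GT: "is_graph T" using T by (simp add: is_tree_def)
  note t = is_graphD[OF GT]
  have mor: "morphism G T p q" using har by (simp add: harmonic_def)
  have pV: "p v \<in> verts T" if "v \<in> verts G" for v using mor that by (auto simp: morphism_def)
  define h0 where "h0 = (SOME h. h \<in> edges T)"
  have ne: "edges T \<noteq> {}" using dg k(3) by (auto simp: morphism_degree_def)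
  then have h0: "h0 \<in> edges T" unfolding h0_def by (simp add: some_in_eq)
  have fib0: "card {e \<in> edges G. q e = Inl h0} = d"
    using dg ne by (simp add: morphism_degree_def h0_def)
  let ?m = "mult G T p q"
  have loc: "local_mult G q v h = (if p v \<in> ends T h then ?m v else 0)"
    if v: "v \<in> verts G" and h: "h \<in> edges T" for v h
  proof (cases "p v \<in> ends T h")
    case True
    let ?h = "SOME e'. e' \<in> edges T \<and> p v \<in> ends T e'"
    have "?h \<in> edges T \<and> p v \<in> ends T ?h" by (rule someI[of _ h]) (use True h in simp)
    then have "local_mult G q v h = local_mult G q v ?h"
      using har v h True unfolding harmonic_def by blast
    moreover have "\<exists>e'\<in>edges T. p v \<in> ends T e'" using True h by blast
    ultimately show ?thesis using True by (simp add: mult_def)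
  next
    case False
    then have "{e \<in> edges G. v \<in> ends G e \<and> q e = Inl h} = {}"
      using morphism_edge(2)[OF mor g(3)] by auto
    then have "local_mult G q v h = 0" unfolding local_mult_def by (simp only: card.empty)
    then show ?thesis using False by simp
  qed
  define M where "M x = (\<lambda>v. if v \<in> verts G \<and> p v = x then int (?m v) else 0)" for x
  have eff: "effective G (M x)" for x by (auto simp: M_def effective_def divisors_def)
  \<comment> \<open>\<open>W\<close> is the side of the bridge \<open>h\<close> that contains
    \<open>x\<close>. Its preimage is cut exactly by the fibre over \<open>h\<close>, so firing it
    turns \<open>M x\<close> into \<open>M y\<close>.\<close>
  have step: "lin_equiv G (M x) (M y) \<and> deg G (M x) = int (card {e \<in> edges G. q e = Inl h})"
    if h: "h \<in> edges T" "ends T h = {x, y}" "x \<in> W" "y \<notin> W" and W: "edge_cut T W = {h}" for h x y W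
  proof -
    define U where "U = {v \<in> verts G. p v \<in> W}"
    have U: "U \<subseteq> verts G" by (auto simp: U_def)
    have cut: "e \<in> edge_cut G U \<longleftrightarrow> q e = Inl h" if e: "e \<in> edges G" for e
    proof -
      obtain u v where uv: "ends G e = {u, v}" "u \<in> verts G" "v \<in> verts G"
        by (rule edge_endsE[OF g(3) e])
      have "e \<in> edge_cut G U \<longleftrightarrow> (p u \<in> W) \<noteq> (p v \<in> W)"
        using e uv by (auto simp: edge_cut_def U_def)
      also have "\<dots> \<longleftrightarrow> q e = Inl h"
      proof
        assume side: "(p u \<in> W) \<noteq> (p v \<in> W)"
        then have "p u \<noteq> p v" by metis
        moreover have "if p u = p v then q e = Inr (p u)
            else \<exists>e'\<in>edges T. q e = Inl e' \<and> ends T e' = {p u, p v}"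
          using mor e uv(1) unfolding morphism_def by blast
        ultimately obtain h' where h': "h' \<in> edges T" "q e = Inl h'" "ends T h' = {p u, p v}"
          by auto
        then have "h' \<in> edge_cut T W" using side by (auto simp: edge_cut_def)
        then show "q e = Inl h" using W h'(2) by simp
      next
        assume "q e = Inl h"
        then have "{x, y} = {p u, p v}" using morphism_edge(2)[OF mor g(3) e] uv h(2) by simp
        then show "(p u \<in> W) \<noteq> (p v \<in> W)" using h(3,4) by (auto simp: doubleton_eq_iff)
      qed
      finally show ?thesis .
    qed
    have cutset: "edge_cut G U = {e \<in> edges G. q e = Inl h}"
      using cut cut_edgesD[of _ G U] by auto
    have cd: "cut_degree G U v = (if p v = x \<or> p v = y then ?m v else 0)" if "v \<in> verts G" for v
    proof -
      have "{e \<in> edge_cut G U. v \<in> ends G e} = {e \<in> edges G. v \<in> ends G e \<and> q e = Inl h}"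
        unfolding cutset by auto
      then have "cut_degree G U v = local_mult G q v h" by (simp add: cut_degree_def local_mult_def)
      then show ?thesis using loc[OF that h(1)] h(2) by simp
    qed
    have "boundary G U = M x"
      by (rule ext) (use cd h(3,4) in \<open>auto simp: boundary_def M_def U_def\<close>)
    moreover have "boundary G (verts G - U) = M y"
      by (rule ext)
        (use cd h(3,4) in \<open>auto simp: boundary_def M_def U_def cut_degree_compl[OF g(3)]\<close>)
    ultimately show ?thesis
      using boundary_compl_equiv[OF G U] deg_boundary[OF G U] cutset by simp
  qed
  obtain x0 y0 W0 where x0: "ends T h0 = {x0, y0}" "x0 \<in> W0" "y0 \<notin> W0" "edge_cut T W0 = {h0}"
      "x0 \<in> verts T"
  proof -
    obtain W where W: "edge_cut T W = {h0}" by (rule tree_bridge[OF T h0])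
    then have "h0 \<in> edge_cut T W" by simp
    then show thesis by (rule cut_endsE[OF t(3)]) (use that W in blast)
  qed
  have deg0: "deg G (M x0) = int d" using step[OF h0 x0(1-4)] fib0 by simp
  \<comment> \<open>Otherwise some tree edge would leave the set of vertices where the equivalence
    holds, against \<open>step\<close> for that edge.\<close>
  have all: "lin_equiv G (M x0) (M x)" if "x \<in> verts T" for x
  proof (rule ccontr)
    assume x: "\<not> lin_equiv G (M x0) (M x)"
    let ?A = "{x \<in> verts T. lin_equiv G (M x0) (M x)}"
    have "x0 \<in> ?A" using x0(5) eff[of x0] by (simp add: lin_equiv_refl effective_def)
    then have "edge_cut T ?A \<noteq> {}"
      using that x by (intro connected_cutD[OF t(4)]) blast+
    then obtain h where h: "h \<in> edge_cut T ?A" by blast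
    obtain y z where yz: "ends T h = {y, z}" "y \<in> ?A" "z \<notin> ?A" "z \<in> verts T"
      by (rule cut_endsE[OF t(3) h])
    obtain W where W: "edge_cut T W = {h}" by (rule tree_bridge[OF T cut_edgesD[OF h]])
    have "h \<in> edge_cut T W" using W by simp
    then have "y \<in> W \<and> z \<notin> W \<or> z \<in> W \<and> y \<notin> W" using yz(1) by (auto simp: edge_cut_def)
    then have "lin_equiv G (M y) (M z)"
    proof
      assume "y \<in> W \<and> z \<notin> W"
      then show ?thesis using step[OF cut_edgesD[OF h] yz(1) _ _ W] by blast
    next
      assume "z \<in> W \<and> y \<notin> W"
      moreover have "ends T h = {z, y}" using yz(1) by auto
      ultimately show ?thesis using step[OF cut_edgesD[OF h] _ _ _ W] lin_equiv_sym by blast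
    qed
    with yz(2) have "lin_equiv G (M x0) (M z)" by (blast intro: lin_equiv_trans)
    with yz(3,4) show False by blast
  qed
  have "1 \<le> rank G (M x0)"
  proof (rule iffD2[OF rank_ge_1_iff[OF G]], goal_cases)
    case 1 show ?case using eff[of x0] by (simp add: effective_def)
  next
    case 2
    show ?case
    proof (intro ballI exI conjI)
      fix v assume v: "v \<in> verts G"
      show "effective G (M (p v))" by (rule eff)
      show "lin_equiv G (M x0) (M (p v))" using all pV[OF v] .
      have "0 < ?m v" using nd v by (simp add: nondegenerate_def)
      then show "1 \<le> M (p v) v" using v by (simp add: M_def)
    qed
  qed
  from gonality_eqI[OF G k(1,2) eff deg0 this] show ?thesis .
qed

section \<open>Quotients by automorphisms of order three\<close>

text \<open>Outside \<open>A\<close> the function \<open>f\<close> is arbitrary; replacing it by the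
  identity there gives a permutation.\<close>

lemma finite_bij_power:
  assumes "finite A" "bij_betw f A A"
  shows "\<exists>n>0. \<forall>x\<in>A. (f ^^ n) x = x"
proof -
  define f' where "f' x = (if x \<in> A then f x else x)" for x
  have "bij_betw f' A A" using assms(2) by (simp add: f'_def bij_betw_def inj_on_def image_def)
  then have "f' permutes A" by (rule bij_imp_permutes) (simp add: f'_def)
  then have "permutation f'" using assms(1) unfolding permutation_permutes by blast
  then obtain n where n: "f' ^^ n = id" "0 < n" by (rule permutation_is_nilpotent)
  have "(f ^^ k) x = (f' ^^ k) x \<and> (f ^^ k) x \<in> A" if "x \<in> A" for x k
    using that assms(2) by (induction k) (auto simp: f'_def bij_betw_def)
  with n show ?thesis by (intro exI[of _ n]) auto
qed

lemma funpow_mult_fixed: "(f ^^ n) x = x \<Longrightarrow> (f ^^ (n * k)) x = x"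
  by (induction k) (auto simp: funpow_add)

text \<open>The product of an exponent for the vertices and one for the edges works for both, so
  \<open>LEAST\<close> in \<open>aut_order\<close> is attained.\<close>

lemma aut_order_power:
  assumes G: "is_graph G" and aut: "automorphism G s t"
  shows "0 < aut_order G s t"
    and "\<And>v. v \<in> verts G \<Longrightarrow> (s ^^ aut_order G s t) v = v"
    and "\<And>e. e \<in> edges G \<Longrightarrow> (t ^^ aut_order G s t) e = e"
proof -
  note g = is_graphD[OF G]
  have bij: "bij_betw s (verts G) (verts G)" "bij_betw t (edges G) (edges G)"
    using aut by (auto simp: automorphism_def)
  obtain n where n: "0 < n" "\<forall>v\<in>verts G. (s ^^ n) v = v"
    using finite_bij_power[OF g(1) bij(1)] by blast
  obtain m where m: "0 < m" "\<forall>e\<in>edges G. (t ^^ m) e = e"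
    using finite_bij_power[OF g(2) bij(2)] by blast
  let ?P = "\<lambda>n. n > 0 \<and> (\<forall>v\<in>verts G. (s ^^ n) v = v) \<and> (\<forall>e\<in>edges G. (t ^^ n) e = e)"
  have "(t ^^ (n * m)) e = e" if "e \<in> edges G" for e
    using funpow_mult_fixed[of m t e n] m(2) that by (simp add: mult.commute)
  then have "?P (n * m)" using n m funpow_mult_fixed[of n s] by simp
  then have "?P (aut_order G s t)" unfolding aut_order_def by (rule LeastI)
  then show "0 < aut_order G s t"
    and "\<And>v. v \<in> verts G \<Longrightarrow> (s ^^ aut_order G s t) v = v"
    and "\<And>e. e \<in> edges G \<Longrightarrow> (t ^^ aut_order G s t) e = e" by auto
qed

lemma orbit_order_3:
  assumes "f (f (f x)) = x"
  shows "orbit f x = {x, f x, f (f x)}"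
proof
  show "orbit f x \<subseteq> {x, f x, f (f x)}"
  proof
    fix y assume "y \<in> orbit f x"
    then show "y \<in> {x, f x, f (f x)}" by induction (use assms in auto)
  qed
  have "f x \<in> orbit f x" "f (f x) \<in> orbit f x" "f (f (f x)) \<in> orbit f x"
    by (intro orbit.intros)+
  then show "{x, f x, f (f x)} \<subseteq> orbit f x" by (simp add: assms)
qed

text \<open>Vertices may be fixed but edges may not: every edge orbit has three elements, and this
  number becomes the degree of the quotient map.\<close>

locale order_3_automorphism =
  fixes G :: "('v, 'e) mgraph" and s t
  assumes G: "is_graph G" and aut: "automorphism G s t"
    and s3: "\<And>v. v \<in> verts G \<Longrightarrow> s (s (s v)) = v"
    and t3: "\<And>e. e \<in> edges G \<Longrightarrow> t (t (t e)) = e"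
    and t_neq: "\<And>e. e \<in> edges G \<Longrightarrow> t e \<noteq> e"
begin

lemmas g = is_graphD[OF G]

lemma s_verts: "v \<in> verts G \<Longrightarrow> s v \<in> verts G"
  and t_edges: "e \<in> edges G \<Longrightarrow> t e \<in> edges G"
  and ends_t: "e \<in> edges G \<Longrightarrow> ends G (t e) = s ` ends G e"
  using aut by (auto simp: automorphism_def bij_betw_def)

lemma orbit_s: "v \<in> verts G \<Longrightarrow> orbit s v = {v, s v, s (s v)}"
  by (intro orbit_order_3 s3)

lemma orbit_t: "e \<in> edges G \<Longrightarrow> orbit t e = {e, t e, t (t e)}"
  by (intro orbit_order_3 t3)

lemma orbit_s_step: "v \<in> verts G \<Longrightarrow> orbit s (s v) = orbit s v"
  using s3[of v] by (auto simp: orbit_s s_verts)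

lemma orbit_t_step: "e \<in> edges G \<Longrightarrow> orbit t (t e) = orbit t e"
  using t3[of e] by (auto simp: orbit_t t_edges)

lemma card_orbit_t:
  assumes "e \<in> edges G"
  shows "card (orbit t e) = 3"
proof -
  have "t e \<noteq> e" "t (t e) \<noteq> t e" "t (t (t e)) \<noteq> t (t e)"
    using t_neq[OF assms] t_neq[OF t_edges[OF assms]] t_neq[OF t_edges[OF t_edges[OF assms]]]
    by blast+
  then show ?thesis using assms t3[of e] by (auto simp: orbit_t card_insert_if)
qed

definition cross :: "'e \<Rightarrow> bool" where
  "cross e \<longleftrightarrow> (\<forall>u v. ends G e = {u, v} \<longrightarrow> orbit s u \<noteq> orbit s v)"

lemma cross_iff: "ends G e = {u, v} \<Longrightarrow> cross e \<longleftrightarrow> orbit s u \<noteq> orbit s v"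
  by (auto simp: cross_def doubleton_eq_iff)

lemma cross_t:
  assumes "e \<in> edges G"
  shows "cross (t e) \<longleftrightarrow> cross e"
proof -
  obtain u v where uv: "ends G e = {u, v}" "u \<in> verts G" "v \<in> verts G"
    by (rule edge_endsE[OF g(3) assms])
  then have "ends G (t e) = {s u, s v}" using assms by (simp add: ends_t)
  with uv show ?thesis by (simp add: cross_iff orbit_s_step)
qed

lemma orbit_ends_t:
  assumes "e \<in> edges G"
  shows "orbit s ` ends G (t e) = orbit s ` ends G e"
proof -
  have "ends G e \<subseteq> verts G" using assms g(3) by (simp add: incidence_def)
  then have "orbit s (s v) = orbit s v" if "v \<in> ends G e" for v using that orbit_s_step by blast
  then show ?thesis using assms by (simp add: ends_t image_image)
qed

abbreviation "Q \<equiv> quotient G s t"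

lemma edges_Q: "edges Q = orbit t ` {e \<in> edges G. cross e}"
  by (simp add: quotient_def cross_def)

lemma ends_Q: "e \<in> edges G \<Longrightarrow> ends Q (orbit t e) = orbit s ` ends G e"
  by (simp add: quotient_def orbit_t image_Un orbit_ends_t t_edges)

text \<open>An edge that is not \<open>cross\<close> has both ends in one orbit, so the choice of
  the end is immaterial.\<close>

definition edge_map :: "'e \<Rightarrow> 'e set + 'v set" where
  "edge_map e = (if cross e then Inl (orbit t e) else Inr (orbit s (SOME v. v \<in> ends G e)))"

lemma edge_map_fibre:
  assumes e: "e \<in> edges G" "cross e"
  shows "{e' \<in> edges G. edge_map e' = Inl (orbit t e)} = orbit t e"
proof
  show "{e' \<in> edges G. edge_map e' = Inl (orbit t e)} \<subseteq> orbit t e"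
  proof clarify
    fix e' assume e': "e' \<in> edges G" "edge_map e' = Inl (orbit t e)"
    then have "orbit t e' = orbit t e" by (simp add: edge_map_def split: if_splits)
    moreover have "e' \<in> orbit t e'" using e'(1) by (simp add: orbit_t)
    ultimately show "e' \<in> orbit t e" by simp
  qed
  have "e' \<in> edges G \<and> cross e' \<and> orbit t e' = orbit t e" if "e' \<in> {e, t e, t (t e)}" for e'
    using that e by (elim insertE) (simp_all add: t_edges cross_t orbit_t_step)
  then show "orbit t e \<subseteq> {e' \<in> edges G. edge_map e' = Inl (orbit t e)}"
    unfolding edge_map_def using orbit_t[OF e(1)] by (intro subsetI) simp
qed

lemma morphism_Q: "morphism G Q (orbit s) edge_map"
  unfolding morphism_def
proof (intro conjI ballI allI impI)
  show "orbit s ` verts G \<subseteq> verts Q" by (simp add: quotient_def)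
  fix e u v assume e: "e \<in> edges G" "ends G e = {u, v}"
  show "if orbit s u = orbit s v then edge_map e = Inr (orbit s u)
    else \<exists>e'\<in>edges Q. edge_map e = Inl e' \<and> ends Q e' = {orbit s u, orbit s v}"
  proof (cases "orbit s u = orbit s v")
    case True
    obtain x where x: "x = (SOME w. w \<in> ends G e)" by blast
    have "x \<in> ends G e" unfolding x by (rule someI[of _ u]) (simp add: e(2))
    then have "orbit s x = orbit s u" using True e(2) by auto
    moreover have "\<not> cross e" using True e(2) by (simp add: cross_iff)
    ultimately show ?thesis using True by (simp add: edge_map_def x)
  next
    case False
    then have "cross e" using e(2) by (simp add: cross_iff)
    then have "orbit t e \<in> edges Q" using e(1) by (simp add: edges_Q)
    moreover have "ends Q (orbit t e) = {orbit s u, orbit s v}" using e by (simp add: ends_Q)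
    ultimately show ?thesis using False \<open>cross e\<close> by (simp add: edge_map_def)
  qed
qed

text \<open>A fixed vertex lies on all three edges of the orbit; a moved vertex lies on exactly one,
  since the rotation carries it away and the other ends are in a different orbit.\<close>

lemma local_mult_Q:
  assumes v: "v \<in> verts G" and h: "h \<in> edges Q" and inc: "orbit s v \<in> ends Q h"
  shows "local_mult G edge_map v h = (if s v = v then 3 else 1)"
proof -
  obtain e0 where e0: "e0 \<in> edges G" "cross e0" "h = orbit t e0" using h by (auto simp: edges_Q)
  then have "orbit s v \<in> orbit s ` ends G e0" using inc by (simp add: ends_Q)
  then obtain a where a: "a \<in> ends G e0" "orbit s v = orbit s a" by blast
  have "a \<in> verts G" using a(1) e0(1) g(3) by (auto simp: incidence_def)
  then have "v \<in> {a, s a, s (s a)}" using a(2) v orbit_s[of v] orbit_s[of a] by auto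
  then have "v \<in> ends G e0 \<or> v \<in> ends G (t e0) \<or> v \<in> ends G (t (t e0))"
    using a(1) e0(1) by (auto simp: ends_t t_edges)
  moreover have "orbit t (t e0) = orbit t e0" "orbit t (t (t e0)) = orbit t e0"
    "cross (t e0)" "cross (t (t e0))" "t e0 \<in> edges G" "t (t e0) \<in> edges G"
    using e0 by (simp_all add: orbit_t_step t_edges cross_t)
  \<comment> \<open>\<open>e0\<close> contains some vertex of the orbit of \<open>v\<close>;
    rotating it gives an edge over \<open>h\<close> that contains \<open>v\<close> itself.\<close>
  ultimately obtain e where e: "e \<in> edges G" "cross e" "h = orbit t e" "v \<in> ends G e"
    using e0 by metis
  obtain w where w: "ends G e = {v, w}" "w \<in> verts G" by (rule edge_other_endE[OF g(3) e(1,4)])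
  have orb: "orbit s v \<noteq> orbit s w" using e(2) w(1) by (simp add: cross_iff)
  have ends: "ends G (t e) = {s v, s w}" "ends G (t (t e)) = {s (s v), s (s w)}"
    using w e(1) by (simp_all add: ends_t t_edges)
  have "{e' \<in> edges G. v \<in> ends G e' \<and> edge_map e' = Inl h} = {e' \<in> orbit t e. v \<in> ends G e'}"
    using edge_map_fibre[OF e(1,2)] e(3) by auto
  also have "card \<dots> = (if s v = v then 3 else 1)"
  proof (cases "s v = v")
    case True
    then have "{e' \<in> orbit t e. v \<in> ends G e'} = orbit t e"
      using ends w by (auto simp: orbit_t e(1))
    then show ?thesis using True card_orbit_t[OF e(1)] by simp
  next
    case False
    have "s w \<noteq> v" "s (s w) \<noteq> v"
      using orb orbit_s_step[OF w(2)] orbit_s_step[OF s_verts[OF w(2)]] by metis+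
    moreover have "s (s v) \<noteq> v" using False s3[OF v] by metis
    ultimately have "{e' \<in> orbit t e. v \<in> ends G e'} = {e}"
      using ends w False by (auto simp: orbit_t e(1))
    then show ?thesis using False by simp
  qed
  finally show ?thesis by (simp add: local_mult_def)
qed

lemma has_tree_morphism_if_quotient:
  assumes T: "is_tree Q" and ne: "edges Q \<noteq> {}"
  shows "has_tree_morphism G 3"
proof (rule has_tree_morphismI[OF G T morphism_Q ne])
  show "card {e \<in> edges G. edge_map e = Inl h} = 3" if h: "h \<in> edges Q" for h
  proof -
    obtain e where "e \<in> edges G" "cross e" "h = orbit t e" using h by (auto simp: edges_Q)
    then show ?thesis using edge_map_fibre card_orbit_t by simp
  qed
  show "local_mult G edge_map v h = (if s v = v then 3 else 1)"
    if "v \<in> verts G" "h \<in> edges Q" "orbit s v \<in> ends Q h" for v h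
    using that by (rule local_mult_Q)
qed simp

end

section \<open>The classes of a divisor of degree three\<close>

text \<open>If no edge inside \<open>U\<close> crossed \<open>A\<close>, the cuts of
  \<open>A \<inter> U\<close> and \<open>U - A\<close> would be disjoint parts of the cut of
  \<open>U\<close>, giving \<open>2 * k \<le> k\<close>.\<close>

lemma tight_cut_connected:
  assumes G: "is_graph G" and k: "cuts_ge k G" "0 < k"
    and U: "U \<subseteq> verts G" "card (edge_cut G U) = k"
    and A: "A \<inter> U \<noteq> {}" "U - A \<noteq> {}"
  shows "\<exists>e\<in>edge_cut G A. ends G e \<subseteq> U"
proof (rule ccontr)
  note g = is_graphD[OF G]
  assume "\<not> ?thesis"
  then have none: "\<not> ends G e \<subseteq> U" if "e \<in> edge_cut G A" for e using that by blast
  have ge': "k \<le> card (edge_cut G B)" if "B \<subseteq> verts G" "B \<noteq> {}" "B \<noteq> verts G" for B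
    using k(1) that by (simp add: cuts_ge_def)
  have "A \<inter> U \<noteq> verts G" "U - A \<noteq> verts G" using A U(1) by auto
  then have ge: "k \<le> card (edge_cut G (A \<inter> U))" "k \<le> card (edge_cut G (U - A))"
    using U(1) A by (auto intro!: ge')
  have no_inner: "ends G e \<subseteq> A \<or> ends G e \<inter> A = {}" if "e \<in> edges G" "ends G e \<subseteq> U" for e
    using none[of e] that by (auto simp: edge_cut_def)
  have disj: "edge_cut G (A \<inter> U) \<inter> edge_cut G (U - A) = {}"
  proof (intro equals0I)
    fix e assume e: "e \<in> edge_cut G (A \<inter> U) \<inter> edge_cut G (U - A)"
    then have eE: "e \<in> edges G" by (auto simp: edge_cut_def)
    obtain x y where xy: "ends G e = {x, y}" by (rule edge_endsE[OF g(3) eE])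
    have *: "ends G e \<inter> (A \<inter> U) \<noteq> {}" "ends G e \<inter> (U - A) \<noteq> {}"
      using e by (auto simp: edge_cut_def)
    then have "ends G e \<subseteq> U" unfolding xy by auto
    from no_inner[OF eE this] * show False by blast
  qed
  have "edge_cut G (A \<inter> U) \<union> edge_cut G (U - A) \<subseteq> edge_cut G U"
  proof
    fix e assume e: "e \<in> edge_cut G (A \<inter> U) \<union> edge_cut G (U - A)"
    then have eE: "e \<in> edges G" by (auto simp: edge_cut_def)
    have inner: "ends G e \<inter> U \<noteq> {}" using e by (auto simp: edge_cut_def)
    moreover have "\<not> ends G e \<subseteq> U"
    proof
      assume sub: "ends G e \<subseteq> U"
      with no_inner[OF eE] inner have "ends G e \<subseteq> A \<inter> U \<or> ends G e \<subseteq> U - A" by blast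
      moreover have "ends G e - (A \<inter> U) \<noteq> {} \<and> ends G e \<inter> (A \<inter> U) \<noteq> {} \<or>
          ends G e - (U - A) \<noteq> {} \<and> ends G e \<inter> (U - A) \<noteq> {}"
        using e by (auto simp: edge_cut_def)
      ultimately show False by blast
    qed
    ultimately show "e \<in> edge_cut G U" using eE by (auto simp: edge_cut_def)
  qed
  then have "card (edge_cut G (A \<inter> U) \<union> edge_cut G (U - A)) \<le> k"
    unfolding U(2)[symmetric] by (rule card_mono[OF finite_cut[OF g(2)]])
  then show False
    using ge k(2) card_Un_disjoint[OF finite_cut[OF g(2)] finite_cut[OF g(2)] disj] by simp
qed

text \<open>\<open>k\<close> is both the degree and the cut bound, which makes every first firing
  tight. The assumption \<open>large\<close> prevents a class from filling the graph.\<close>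

locale tight_system =
  fixes G :: "('v, 'e) mgraph" and k :: nat and D0 :: "'v \<Rightarrow> int"
  assumes G: "is_graph G" and k: "cuts_ge k G" "0 < k" and D0: "D0 \<in> divisors G" "deg G D0 = int k"
    and rank: "1 \<le> rank G D0" and large: "k < card (verts G)"
begin

lemmas g = is_graphD[OF G]

definition sys :: "('v \<Rightarrow> int) set" where
  "sys = {D. effective G D \<and> lin_equiv G D0 D}"

text \<open>The choice in \<open>dv\<close> is unique by \<open>sys_unique\<close>.\<close>

definition dv :: "'v \<Rightarrow> 'v \<Rightarrow> int" where
  "dv v = (THE D. D \<in> sys \<and> 1 \<le> D v)"

definition cls :: "'v \<Rightarrow> 'v set" where
  "cls v = {w \<in> verts G. 1 \<le> dv v w}"

text \<open>These numbers become the local multiplicities of the morphism onto the tree of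
  classes.\<close>

definition mlt :: "'v \<Rightarrow> nat" where
  "mlt v = nat (dv v v)"

lemma sysD:
  assumes "D \<in> sys"
  shows "effective G D" "deg G D = int k" "lin_equiv G D0 D"
  using assms lin_equiv_deg[OF G, of D0 D] D0(2) by (auto simp: sys_def)

lemma sys_equiv: "D \<in> sys \<Longrightarrow> D' \<in> sys \<Longrightarrow> lin_equiv G D D'"
  unfolding sys_def by (blast intro: lin_equiv_trans lin_equiv_sym)

lemma sys_fire:
  assumes "D \<in> sys" "D' \<in> sys" "D \<noteq> D'"
  obtains U where "U \<subseteq> verts G" "card (edge_cut G U) = k" "D = boundary G U"
    "\<forall>v\<in>U. D' v = 0" "boundary G (verts G - U) \<in> sys"
proof -
  obtain U where U: "U \<subseteq> verts G" "card (edge_cut G U) = k" "D = boundary G U"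
    "\<And>v. v \<in> U \<Longrightarrow> D' v = 0"
    by (rule tight_firing_set[OF G k(1) sysD(1)[OF assms(1)] sysD(1)[OF assms(2)]
      sysD(2)[OF assms(1)] sys_equiv[OF assms(1,2)] assms(3)]) blast
  have "lin_equiv G D0 (boundary G (verts G - U))"
    using sysD(3)[OF assms(1)] boundary_compl_equiv[OF G U(1)] unfolding U(3)
    by (rule lin_equiv_trans)
  then have "boundary G (verts G - U) \<in> sys" by (simp add: sys_def effective_boundary)
  moreover have "\<forall>v\<in>U. D' v = 0" using U(4) by blast
  ultimately show thesis using U(1-3) by (intro that)
qed

text \<open>The first firing set from \<open>D\<close> to \<open>D'\<close> contains the support of \<open>D\<close> and misses that of \<open>D'\<close>.\<close>

lemma sys_unique:
  assumes "D \<in> sys" "D' \<in> sys" "1 \<le> D v" "1 \<le> D' v"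
  shows "D = D'"
proof (rule ccontr)
  assume "D \<noteq> D'"
  then obtain U where U: "U \<subseteq> verts G" "card (edge_cut G U) = k" "D = boundary G U"
    "\<forall>v\<in>U. D' v = 0" "boundary G (verts G - U) \<in> sys"
    by (rule sys_fire[OF assms(1,2)])
  have "v \<in> U" using assms(3) U(3) by (auto simp: boundary_def split: if_splits)
  then show False using U(4) assms(4) by auto
qed

lemma dv:
  assumes "v \<in> verts G"
  shows "dv v \<in> sys" "1 \<le> dv v v"
proof -
  obtain D where "effective G D" "lin_equiv G D0 D" "1 \<le> D v"
    using iffD1[OF rank_ge_1_iff[OF G D0(1)] rank] assms by blast
  then have D: "D \<in> sys \<and> 1 \<le> D v" by (simp add: sys_def)
  have "dv v \<in> sys \<and> 1 \<le> dv v v"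
    unfolding dv_def
  proof (rule theI[of _ D])
    fix D' assume "D' \<in> sys \<and> 1 \<le> D' v"
    then show "D' = D" using D sys_unique[of D' D v] by simp
  qed (fact D)
  then show "dv v \<in> sys" "1 \<le> dv v v" by simp_all
qed

lemma dv_eqI: "D \<in> sys \<Longrightarrow> 1 \<le> D v \<Longrightarrow> v \<in> verts G \<Longrightarrow> dv v = D"
  by (rule sys_unique[OF dv(1) _ dv(2)])

lemma cls_subset: "cls v \<subseteq> verts G"
  by (auto simp: cls_def)

lemma self_in_cls: "v \<in> verts G \<Longrightarrow> v \<in> cls v"
  using dv(2) by (simp add: cls_def)

lemma dv_cong: "v \<in> verts G \<Longrightarrow> w \<in> cls v \<Longrightarrow> dv w = dv v"
  using dv(1) by (intro dv_eqI) (auto simp: cls_def)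

lemma cls_cong: "v \<in> verts G \<Longrightarrow> w \<in> cls v \<Longrightarrow> cls w = cls v"
  unfolding cls_def[of w] by (subst dv_cong) (simp_all add: cls_def)

lemma cls_eq_iff: "v \<in> verts G \<Longrightarrow> w \<in> verts G \<Longrightarrow> cls w = cls v \<longleftrightarrow> w \<in> cls v"
  by (rule iffI, use self_in_cls[of w] in simp, rule cls_cong)

lemma dv_mlt: "v \<in> verts G \<Longrightarrow> w \<in> cls v \<Longrightarrow> dv v w = int (mlt w)"
  using dv_cong[of v w] by (simp add: mlt_def cls_def)

lemma mlt_pos: "v \<in> verts G \<Longrightarrow> 0 < mlt v"
  using dv(2)[of v] by (simp add: mlt_def)

lemma sum_mlt:
  assumes "v \<in> verts G"
  shows "(\<Sum>w\<in>cls v. mlt w) = k"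
proof -
  have "(\<Sum>w\<in>cls v. dv v w) = (\<Sum>w\<in>verts G. dv v w)"
  proof (rule sum.mono_neutral_left[OF g(1) cls_subset], rule ballI)
    fix w assume "w \<in> verts G - cls v"
    then have "\<not> 1 \<le> dv v w" by (auto simp: cls_def)
    moreover have "0 \<le> dv v w" by (rule effective_nonneg[OF sysD(1)[OF dv(1)[OF assms]]])
    ultimately show "dv v w = 0" by simp
  qed
  also have "\<dots> = int k" using sysD(2)[OF dv(1)[OF assms]] by (simp add: deg_def)
  finally have "(\<Sum>w\<in>cls v. int (mlt w)) = int k" using dv_mlt[OF assms] by simp
  then show ?thesis by (simp flip: of_nat_sum)
qed

lemma cls_neq_verts:
  assumes "v \<in> verts G"
  shows "cls v \<noteq> verts G"
proof
  assume "cls v = verts G"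
  then have "card (verts G) = (\<Sum>w\<in>cls v. 1)" by simp
  also have "\<dots> \<le> (\<Sum>w\<in>cls v. mlt w)"
  proof (rule sum_mono)
    fix w assume "w \<in> cls v"
    then have "w \<in> verts G" using cls_subset by blast
    then show "1 \<le> mlt w" using mlt_pos[of w] by simp
  qed
  finally show False using sum_mlt[OF assms] large by simp
qed

text \<open>An inner end of a cut edge carries a chip of \<open>boundary G U\<close>, and by
  uniqueness the only divisor of the system with a chip at \<open>v\<close> is
  \<open>dv v\<close>.\<close>

lemma boundary_cls:
  assumes U: "U \<subseteq> verts G" "boundary G U \<in> sys" and e: "e \<in> edge_cut G U"
    and v: "v \<in> ends G e" "v \<in> U"
  shows "dv v = boundary G U"
proof (rule dv_eqI[OF U(2)])
  have "cut_degree G U v \<noteq> 0"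
    unfolding cut_degree_def using e v(1) finite_cut[OF g(2), of U] by auto
  then show "1 \<le> boundary G U v" using v(2) by (simp add: boundary_def)
qed (use U v in blast)

lemma supp_boundary:
  assumes v: "v \<in> verts G" and "dv v = boundary G U" and U: "U \<subseteq> verts G"
  shows "cls v = {w \<in> U. 0 < cut_degree G U w}"
  using assms by (auto simp: cls_def boundary_def)

text \<open>The first firing set from \<open>dv u\<close> towards \<open>dv v\<close> is crossed by
  \<open>e\<close>, so \<open>v\<close> receives a chip at once: a single firing carries a class
  onto an adjacent one.\<close>

lemma class_cut:
  assumes e: "e \<in> edges G" "ends G e = {u, v}" and neq: "cls u \<noteq> cls v"
  obtains U where "U \<subseteq> verts G" "card (edge_cut G U) = k"
    "dv u = boundary G U" "dv v = boundary G (verts G - U)" "cls u \<subseteq> U" "cls v \<subseteq> verts G - U"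
proof -
  have uv: "u \<in> verts G" "v \<in> verts G" using e g(3) by (auto simp: incidence_def)
  have "dv u \<noteq> dv v" using neq by (auto simp: cls_def)
  then obtain U where U: "U \<subseteq> verts G" "card (edge_cut G U) = k" "dv u = boundary G U"
    "\<forall>w\<in>U. dv v w = 0" "boundary G (verts G - U) \<in> sys"
    by (rule sys_fire[OF dv(1)[OF uv(1)] dv(1)[OF uv(2)]])
  have "cls u \<subseteq> U" using supp_boundary[OF uv(1) U(3,1)] by blast
  then have "u \<in> U" using self_in_cls[OF uv(1)] by blast
  moreover have "v \<notin> U" using U(4) dv(2)[OF uv(2)] by auto
  ultimately have "e \<in> edge_cut G U" using e by (auto simp: edge_cut_def)
  then have "e \<in> edge_cut G (verts G - U)" by (simp add: cut_compl[OF g(3)])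
  then have "dv v = boundary G (verts G - U)"
    by (rule boundary_cls[OF Diff_subset U(5)]) (use e uv \<open>v \<notin> U\<close> in auto)
  moreover from this have "cls v \<subseteq> verts G - U"
    using supp_boundary[OF uv(2) _ Diff_subset] by blast
  ultimately show thesis using U(1-3) \<open>cls u \<subseteq> U\<close> by (intro that)
qed

section \<open>Edges between two adjacent classes\<close>

definition fib :: "'e \<Rightarrow> 'e set" where
  "fib e = {e' \<in> edges G. cls ` ends G e' = cls ` ends G e}"

definition cross :: "'e \<Rightarrow> bool" where
  "cross e \<longleftrightarrow> card (cls ` ends G e) = 2"

lemma cross_iff: "ends G e = {u, v} \<Longrightarrow> cross e \<longleftrightarrow> cls u \<noteq> cls v"
  by (auto simp: cross_def card_2_iff card_insert_if)

lemma fib_eq_iff: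
  assumes "e' \<in> edges G"
  shows "fib e' = fib e \<longleftrightarrow> e' \<in> fib e"
proof
  assume "fib e' = fib e"
  moreover have "e' \<in> fib e'" using assms by (simp add: fib_def)
  ultimately show "e' \<in> fib e" by simp
qed (simp add: fib_def)

lemma fib_edges: "e' \<in> fib e \<Longrightarrow> e' \<in> edges G"
  by (simp add: fib_def)

lemma cross_fib: "cross e \<Longrightarrow> e' \<in> fib e \<Longrightarrow> cross e'"
  by (simp add: cross_def fib_def)

text \<open>Inner ends of the cut carry chips of \<open>dv u\<close> and outer ends carry chips of
  \<open>dv v\<close>, so every cut edge joins these two classes. Conversely, \<open>U\<close>
  contains the one class and misses the other.\<close>

lemma class_cut_eq_fib:
  assumes e: "ends G e = {u, v}" and uv: "u \<in> verts G" "v \<in> verts G" and U: "U \<subseteq> verts G"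
    "dv u = boundary G U" "dv v = boundary G (verts G - U)" "cls u \<subseteq> U" "cls v \<subseteq> verts G - U"
  shows "edge_cut G U = fib e"
proof (intro set_eqI iffI)
  fix e' assume e': "e' \<in> edge_cut G U"
  obtain a b where ab: "ends G e' = {a, b}" "a \<in> U" "b \<notin> U" "a \<in> verts G" "b \<in> verts G"
    by (rule cut_endsE[OF g(3) e'])
  have "dv a = dv u"
    unfolding U(2) by (rule boundary_cls[OF U(1) _ e']) (use ab dv(1)[OF uv(1)] U(2) in auto)
  moreover have "dv b = dv v"
    unfolding U(3)
  proof (rule boundary_cls[OF Diff_subset])
    show "e' \<in> edge_cut G (verts G - U)" using e' by (simp add: cut_compl[OF g(3)])
  qed (use ab dv(1)[OF uv(2)] U(3) in auto)
  ultimately have "cls a = cls u" "cls b = cls v" by (simp_all add: cls_def)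
  then show "e' \<in> fib e" using ab e cut_edgesD[OF e'] by (simp add: fib_def)
next
  fix e' assume e': "e' \<in> fib e"
  then have eE: "e' \<in> edges G" and im: "cls ` ends G e' = {cls u, cls v}"
    by (simp_all add: fib_def e)
  have sub: "ends G e' \<subseteq> verts G" using eE g(3) by (simp add: incidence_def)
  have "cls u \<in> cls ` ends G e'" "cls v \<in> cls ` ends G e'" unfolding im by simp_all
  then obtain a b where "a \<in> ends G e'" "cls a = cls u" "b \<in> ends G e'" "cls b = cls v" by auto
  moreover from this have "a \<in> cls u" "b \<in> cls v" using sub self_in_cls by blast+
  ultimately show "e' \<in> edge_cut G U" using U(4,5) eE by (intro cutI[of _ _ a b]) auto
qed

text \<open>The cut between adjacent classes splits no other class: by \<open>tight_cut_connected\<close> the first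
  firing set towards the class of \<open>x\<close> contains one whole side of the cut.\<close>

lemma class_cut_saturated:
  assumes e: "e \<in> edges G" "ends G e = {u, v}" and U: "U \<subseteq> verts G" "card (edge_cut G U) = k"
    "dv u = boundary G U" "dv v = boundary G (verts G - U)" "cls u \<subseteq> U" "cls v \<subseteq> verts G - U"
    and x: "x \<in> verts G"
  shows "cls x \<subseteq> U \<or> cls x \<subseteq> verts G - U"
proof (cases "cls x = cls u \<or> cls x = cls v")
  case True then show ?thesis using U(5,6) by auto
next
  case False
  have uv: "u \<in> verts G" "v \<in> verts G" using e g(3) by (auto simp: incidence_def)
  have "dv u \<noteq> dv x" using False by (auto simp: cls_def)
  then obtain W where W: "W \<subseteq> verts G" "card (edge_cut G W) = k" "dv u = boundary G W"
    "\<forall>w\<in>W. dv x w = 0" "boundary G (verts G - W) \<in> sys"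
    by (rule sys_fire[OF dv(1)[OF uv(1)] dv(1)[OF x]])
  have xW: "cls x \<inter> W = {}" using W(4) by (auto simp: cls_def)
  have uW: "cls u \<subseteq> W" using supp_boundary[OF uv(1) W(3,1)] by blast
  have inner: "w \<in> cls u" if "e' \<in> edge_cut G W" "w \<in> ends G e'" "w \<in> W" for e' w
  proof -
    have "dv w = dv u"
      unfolding W(3) by (rule boundary_cls[OF W(1) _ that]) (use dv(1)[OF uv(1)] W(3) in simp)
    moreover have "w \<in> verts G" using that(3) W(1) by blast
    ultimately show ?thesis using self_in_cls[of w] by (simp add: cls_def)
  qed
  show ?thesis
  proof (cases "cls v \<subseteq> W")
    case True
    \<comment> \<open>Otherwise the tight side \<open>verts G - U\<close> contains an edge that
      crosses \<open>W\<close>; but inner ends of the cut of \<open>W\<close> lie in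
      \<open>cls u\<close>, hence in \<open>U\<close>. It follows that \<open>cls x\<close>, which
      avoids \<open>W\<close>, lies in \<open>U\<close>.\<close>
    have "verts G - U \<subseteq> W"
    proof (rule ccontr)
      assume "\<not> verts G - U \<subseteq> W"
      then have "verts G - U - W \<noteq> {}" by blast
      moreover have "W \<inter> (verts G - U) \<noteq> {}" using True U(6) self_in_cls[OF uv(2)] by blast
      moreover have "card (edge_cut G (verts G - U)) = k" using U(2) by (simp add: cut_compl[OF g(3)])
      ultimately have "\<exists>e'\<in>edge_cut G W. ends G e' \<subseteq> verts G - U"
        by (intro tight_cut_connected[OF G k Diff_subset])
      then obtain e' where e': "e' \<in> edge_cut G W" "ends G e' \<subseteq> verts G - U" by blast
      obtain a where "a \<in> ends G e'" "a \<in> W" using e'(1) by (auto simp: edge_cut_def)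
      then have "a \<in> cls u" using inner[OF e'(1)] by blast
      then show False using \<open>a \<in> ends G e'\<close> e'(2) U(5) by blast
    qed
    then show ?thesis using xW cls_subset[of x] by blast
  next
    case False
    \<comment> \<open>A cut edge from \<open>w\<close> back to \<open>cls u\<close> also crosses
      \<open>W\<close>. So \<open>w\<close> receives a chip when \<open>W\<close> is fired, and the
      outer divisor of \<open>W\<close> is \<open>dv v\<close>.\<close>
    then obtain w where w: "w \<in> cls v" "w \<notin> W" by blast
    have wV: "w \<in> verts G" using w(1) cls_subset by blast
    have "0 < cut_degree G (verts G - U) w"
      using w(1) supp_boundary[OF uv(2) U(4) Diff_subset] by blast
    then have "card {e' \<in> edge_cut G U. w \<in> ends G e'} \<noteq> 0"
      by (simp add: cut_compl[OF g(3)] cut_degree_def)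
    then have "{e' \<in> edge_cut G U. w \<in> ends G e'} \<noteq> {}" by (intro notI) (simp only: card.empty)
    then obtain e1 where e1: "e1 \<in> edge_cut G U" "w \<in> ends G e1" by blast
    then have "e1 \<in> fib e" by (simp add: class_cut_eq_fib[OF e(2) uv U(1,3-6)])
    then have im: "cls ` ends G e1 = {cls u, cls v}" by (simp add: fib_def e)
    then have "cls u \<in> cls ` ends G e1" by simp
    then obtain a where a: "a \<in> ends G e1" "cls a = cls u" by auto
    have "a \<in> cls u"
      using a self_in_cls[of a] g(3) cut_edgesD[OF e1(1)] by (auto simp: incidence_def)
    then have e1W: "e1 \<in> edge_cut G W"
      using uW w(2) a(1) e1 by (intro cutI[of _ _ a w]) (auto dest: cut_edgesD)
    then have "dv w = boundary G (verts G - W)"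
      using wV w(2) e1(2) by (intro boundary_cls[OF Diff_subset W(5), of e1]) (auto simp: cut_compl[OF g(3)])
    then have vW: "dv v = boundary G (verts G - W)" using dv_cong[OF uv(2) w(1)] by simp
    have outer: "b \<in> cls v" if "e' \<in> edge_cut G W" "b \<in> ends G e'" "b \<notin> W" for e' b
    proof -
      have bV: "b \<in> verts G" using that(2) cut_edgesD[OF that(1)] g(3) by (auto simp: incidence_def)
      have "dv b = dv v"
        unfolding vW using W(5) that bV
        by (intro boundary_cls[OF Diff_subset, of _ e']) (auto simp: cut_compl[OF g(3)])
      then show ?thesis using self_in_cls[OF bV] by (simp add: cls_def)
    qed
    \<comment> \<open>The argument of the other case, mirrored: outer ends of the cut of
      \<open>W\<close> lie in \<open>cls v\<close>, so no edge inside \<open>U\<close> crosses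
      \<open>W\<close>.\<close>
    have "U \<subseteq> W"
    proof (rule ccontr)
      assume "\<not> U \<subseteq> W"
      then have "U - W \<noteq> {}" by blast
      moreover have "W \<inter> U \<noteq> {}" using uW U(5) self_in_cls[OF uv(1)] by blast
      ultimately have "\<exists>e'\<in>edge_cut G W. ends G e' \<subseteq> U"
        by (intro tight_cut_connected[OF G k U(1,2)])
      then obtain e' where e': "e' \<in> edge_cut G W" "ends G e' \<subseteq> U" by blast
      obtain b where "b \<in> ends G e'" "b \<notin> W" using e'(1) by (auto simp: edge_cut_def)
      then have "b \<in> cls v" using outer[OF e'(1)] by blast
      then show False using \<open>b \<in> ends G e'\<close> e'(2) U(6) by blast
    qed
    then show ?thesis using xW cls_subset[of x] by blast
  qed
qed

lemma class_edge:
  assumes e: "e \<in> edges G" "ends G e = {u, v}" and neq: "cls u \<noteq> cls v"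
  obtains U where "U \<subseteq> verts G" "edge_cut G U = fib e" "cls u \<subseteq> U" "cls v \<subseteq> verts G - U"
    "\<forall>x\<in>verts G. cls x \<subseteq> U \<or> cls x \<subseteq> verts G - U"
    "card (fib e) = k" "\<forall>w\<in>cls u \<union> cls v. card {e' \<in> fib e. w \<in> ends G e'} = mlt w"
proof -
  have uv: "u \<in> verts G" "v \<in> verts G" using e g(3) by (auto simp: incidence_def)
  obtain U where U: "U \<subseteq> verts G" "card (edge_cut G U) = k"
    "dv u = boundary G U" "dv v = boundary G (verts G - U)" "cls u \<subseteq> U" "cls v \<subseteq> verts G - U"
    by (rule class_cut[OF e neq])
  have fib: "edge_cut G U = fib e" by (rule class_cut_eq_fib[OF e(2) uv U(1,3-6)])
  have "card {e' \<in> fib e. w \<in> ends G e'} = mlt w" if w: "w \<in> cls u \<union> cls v" for w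
  proof -
    have "int (cut_degree G U w) = int (mlt w)"
    proof (cases "w \<in> cls u")
      case True
      then show ?thesis using dv_mlt[OF uv(1) True] U(3,5) by (auto simp: boundary_def)
    next
      case False
      then have "w \<in> cls v" using w by blast
      then show ?thesis using dv_mlt[OF uv(2), of w] U(4,6)
        by (auto simp: boundary_def cut_degree_compl[OF g(3)])
    qed
    then show ?thesis by (simp add: cut_degree_def fib)
  qed
  moreover have "cls x \<subseteq> U \<or> cls x \<subseteq> verts G - U" if "x \<in> verts G" for x
    by (rule class_cut_saturated[OF e U that])
  ultimately show thesis using U(1,2,5,6) fib by (intro that[of U]) simp_all
qed

lemma card_fib:
  assumes "e \<in> edges G" "cross e"
  shows "card (fib e) = k"
proof -
  obtain u v where uv: "ends G e = {u, v}" by (rule edge_endsE[OF g(3) assms(1)])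
  then have "cls u \<noteq> cls v" using assms(2) by (simp add: cross_iff)
  then show ?thesis by (rule class_edge[OF assms(1) uv])
qed

lemma card_fib_at:
  assumes "e \<in> edges G" "cross e" "w \<in> verts G" "cls w \<in> cls ` ends G e"
  shows "card {e' \<in> fib e. w \<in> ends G e'} = mlt w"
proof -
  obtain u v where uv: "ends G e = {u, v}" "u \<in> verts G" "v \<in> verts G"
    by (rule edge_endsE[OF g(3) assms(1)])
  then have neq: "cls u \<noteq> cls v" using assms(2) by (simp add: cross_iff)
  have "w \<in> cls u \<union> cls v" using assms(4) self_in_cls[OF assms(3)] uv(1) by auto
  moreover have "\<forall>w\<in>cls u \<union> cls v. card {e' \<in> fib e. w \<in> ends G e'} = mlt w"
    by (rule class_edge[OF assms(1) uv(1) neq])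
  ultimately show ?thesis by blast
qed

lemma exists_cross_edge:
  assumes "v \<in> verts G"
  obtains e where "e \<in> edges G" "cross e" "cls v \<in> cls ` ends G e"
proof -
  have "edge_cut G (cls v) \<noteq> {}"
    using cls_neq_verts[OF assms] cls_subset[of v] self_in_cls[OF assms] assms
    by (intro connected_cutD[OF g(4)]) blast+
  then obtain e where e: "e \<in> edge_cut G (cls v)" by blast
  obtain a b where ab: "ends G e = {a, b}" "a \<in> cls v" "b \<notin> cls v" "b \<in> verts G"
    by (rule cut_endsE[OF g(3) e])
  have "cls a = cls v" using cls_cong[OF assms ab(2)] .
  moreover have "cls b \<noteq> cls v" using cls_eq_iff[OF assms ab(4)] ab(3) by simp
  ultimately show thesis
    using ab(1) cut_edgesD[OF e] by (intro that[of e]) (auto simp: cross_iff)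
qed

text \<open>Stated for any \<open>H\<close> of this shape, since it serves both \<open>T\<close> and
  the quotient by the automorphism. A cut that splits no class descends to \<open>H\<close>, where
  its fibre becomes a single edge, hence a bridge.\<close>

lemma is_tree_class_graph:
  assumes H: "verts H = cls ` verts G" "edges H = fib ` {e \<in> edges G. cross e}"
    "\<And>e. e \<in> edges G \<Longrightarrow> cross e \<Longrightarrow> ends H (fib e) = cls ` ends G e"
  shows "is_tree H"
proof (rule is_tree_if_bridges)
  have inc: "incidence H"
    unfolding incidence_def H(1,2)
  proof (clarify, intro conjI)
    fix e assume e: "e \<in> edges G" "cross e"
    then show "ends H (fib e) \<subseteq> cls ` verts G" "card (ends H (fib e)) = 2"
      using g(3) by (auto simp: H(3) incidence_def cross_def)
  qed
  have "connected H"
  proof (rule connected_image[OF g(4) inc H(1) g(3)])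
    fix e u v assume e: "e \<in> edges G" "ends G e = {u, v}" "cls u \<noteq> cls v"
    then have "cross e" by (simp add: cross_iff)
    then show "\<exists>h\<in>edges H. ends H h = {cls u, cls v}"
      using e H(2,3) by (intro bexI[of _ "fib e"]) auto
  qed
  then show "is_graph H" using inc g(1,2) by (simp add: is_graph_def incidence_def H(1,2))
  fix h assume "h \<in> edges H"
  then obtain e where e: "e \<in> edges G" "cross e" "h = fib e" using H(2) by auto
  obtain u v where uv: "ends G e = {u, v}" "u \<in> verts G" "v \<in> verts G"
    by (rule edge_endsE[OF g(3) e(1)])
  then have neq: "cls u \<noteq> cls v" using e(2) by (simp add: cross_iff)
  obtain U where U: "U \<subseteq> verts G" "edge_cut G U = fib e"
    "\<forall>x\<in>verts G. cls x \<subseteq> U \<or> cls x \<subseteq> verts G - U"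
    by (rule class_edge[OF e(1) uv(1) neq])
  have mem: "cls x \<in> cls ` U \<longleftrightarrow> x \<in> U" if x: "x \<in> verts G" for x
  proof
    assume "cls x \<in> cls ` U"
    then obtain y where y: "y \<in> U" "cls x = cls y" by auto
    then have "y \<in> cls x" using self_in_cls[of y] U(1) by auto
    then show "x \<in> U" using U(3) x y(1) self_in_cls[OF x] by blast
  qed simp
  have cut: "fib e' \<in> edge_cut H (cls ` U) \<longleftrightarrow> e' \<in> fib e" if e': "e' \<in> edges G" "cross e'" for e'
  proof -
    obtain a b where ab: "ends G e' = {a, b}" "a \<in> verts G" "b \<in> verts G"
      by (rule edge_endsE[OF g(3) e'(1)])
    have "fib e' \<in> edges H" "ends H (fib e') = {cls a, cls b}"
      using e' ab(1) by (simp_all add: H(2,3))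
    from edge_cut_iff[OF this] have "fib e' \<in> edge_cut H (cls ` U) \<longleftrightarrow> (a \<in> U) \<noteq> (b \<in> U)"
      by (simp only: mem ab)
    also have "\<dots> \<longleftrightarrow> e' \<in> edge_cut G U" using edge_cut_iff[OF e'(1) ab(1)] by simp
    finally show ?thesis using U(2) by simp
  qed
  have "edge_cut H (cls ` U) = {h}"
  proof (intro set_eqI iffI)
    fix h' assume h': "h' \<in> edge_cut H (cls ` U)"
    then have "h' \<in> fib ` {e \<in> edges G. cross e}" using cut_edgesD[OF h'] by (simp only: H(2))
    then obtain e' where e': "e' \<in> edges G" "cross e'" "h' = fib e'" by blast
    then have "e' \<in> fib e" using cut h' by simp
    then have "cls ` ends G e' = cls ` ends G e" by (simp add: fib_def)
    then show "h' \<in> {h}" unfolding e(3) e'(3) fib_def by simp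
  next
    fix h' assume "h' \<in> {h}"
    then show "h' \<in> edge_cut H (cls ` U)" using cut[OF e(1,2)] e by (simp add: fib_def)
  qed
  then show "\<exists>W. edge_cut H W = {h}" by blast
qed

section \<open>The tree of classes and the morphism onto it\<close>

definition T :: "('v set, 'e set) mgraph" where
  "T = \<lparr>verts = cls ` verts G, edges = fib ` {e \<in> edges G. cross e},
    ends = \<lambda>X. \<Union>e\<in>X. cls ` ends G e\<rparr>"

lemma T_simps:
  "verts T = cls ` verts G" "edges T = fib ` {e \<in> edges G. cross e}"
  by (simp_all add: T_def)

lemma ends_T:
  assumes "e \<in> edges G"
  shows "ends T (fib e) = cls ` ends G e"
proof -
  have "(\<Union>e'\<in>fib e. cls ` ends G e') = (\<Union>e'\<in>fib e. cls ` ends G e)"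
    by (intro SUP_cong) (simp_all add: fib_def)
  moreover have "fib e \<noteq> {}" using assms by (auto simp: fib_def)
  ultimately show ?thesis by (simp add: T_def)
qed

lemma is_tree_T: "is_tree T"
  using T_simps ends_T by (rule is_tree_class_graph)

lemma has_tree_morphism_T: "has_tree_morphism G k"
proof -
  \<comment> \<open>The ends of an edge that is not \<open>cross\<close> have one common class, and
    \<open>THE\<close> returns it.\<close>
  define q where "q e = (if cross e then Inl (fib e) else Inr (THE X. X \<in> cls ` ends G e))" for e
  have q: "q e' = Inl (fib e) \<longleftrightarrow> e' \<in> fib e" if "e \<in> edges G" "cross e" "e' \<in> edges G" for e e'
    using fib_eq_iff[OF that(3), of e] cross_fib[OF that(2), of e'] by (auto simp: q_def)
  have mor: "morphism G T cls q"
    unfolding morphism_def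
  proof (intro conjI ballI allI impI)
    show "cls ` verts G \<subseteq> verts T" by (simp add: T_simps)
    fix e u v assume e: "e \<in> edges G" "ends G e = {u, v}"
    show "if cls u = cls v then q e = Inr (cls u)
      else \<exists>e'\<in>edges T. q e = Inl e' \<and> ends T e' = {cls u, cls v}"
    proof (cases "cls u = cls v")
      case True
      then show ?thesis using e by (simp add: q_def cross_iff)
    next
      case False
      then have "cross e" using e(2) by (simp add: cross_iff)
      then have "fib e \<in> edges T" "q e = Inl (fib e)" using e(1) by (simp_all add: q_def T_simps)
      moreover have "ends T (fib e) = {cls u, cls v}" using e by (simp add: ends_T)
      ultimately show ?thesis using False by auto
    qed
  qed
  show ?thesis
  proof (rule has_tree_morphismI[OF G is_tree_T mor])
    obtain v where "v \<in> verts G" using g(5) by blast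
    then obtain e where "e \<in> edges G" "cross e" by (rule exists_cross_edge)
    then show "edges T \<noteq> {}" by (auto simp: T_simps)
  next
    fix h assume "h \<in> edges T"
    then obtain e where e: "e \<in> edges G" "cross e" "h = fib e" by (auto simp: T_simps)
    then have "{e' \<in> edges G. q e' = Inl h} = fib e"
      using q[OF e(1,2)] by (auto dest: fib_edges)
    then show "card {e \<in> edges G. q e = Inl h} = k" using card_fib[OF e(1,2)] by simp
  next
    fix v h assume v: "v \<in> verts G" and h: "h \<in> edges T" "cls v \<in> ends T h"
    obtain e where e: "e \<in> edges G" "cross e" "h = fib e" using h(1) by (auto simp: T_simps)
    have "{e' \<in> edges G. v \<in> ends G e' \<and> q e' = Inl h} = {e' \<in> fib e. v \<in> ends G e'}"
      using q[OF e(1,2)] e(3) by (auto dest: fib_edges)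
    then show "local_mult G q v h = mlt v"
      using card_fib_at[OF e(1,2) v] h(2) e by (simp add: local_mult_def ends_T)
  qed (rule mlt_pos)
qed

end

section \<open>The automorphism under the zero-three condition\<close>

locale zero_three_system = tight_system G 3 D0
  for G :: "('v, 'e) mgraph" and D0 :: "'v \<Rightarrow> int" +
  assumes simple: "simple G" and conn: "vertex_connected 3 G"
    and zero_three: "\<lbrakk>a \<in> verts G; b \<in> verts G; c \<in> verts G; a \<noteq> b; b \<noteq> c; a \<noteq> c;
      lin_equiv G D0 (\<lambda>v. point a v + point b v + point c v)\<rbrakk> \<Longrightarrow>
      card {e \<in> edges G. ends G e \<subseteq> {a, b, c}} \<in> {0, 3}"
begin

lemma simple_eq: "e \<in> edges G \<Longrightarrow> e' \<in> edges G \<Longrightarrow> ends G e = ends G e' \<Longrightarrow> e = e'"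
  using simple by (simp add: simple_def inj_on_eq_iff)

lemma finite_cls: "finite (cls v)"
  using cls_subset g(1) by (rule finite_subset)

text \<open>A class \<open>{a, b}\<close> would have two adjacent classes, since \<open>b\<close> has degree at least three, at most
  one edge to \<open>a\<close> and at most one edge to each adjacent class. So \<open>{a, b}\<close> would separate \<open>G\<close>.\<close>

lemma no_pair_class:
  assumes b: "b \<in> verts G" "cls b = {a, b}" "a \<noteq> b" "mlt b = 1"
  shows False
proof -
  obtain e0 where e0: "e0 \<in> edges G" "cross e0" "cls b \<in> cls ` ends G e0"
    by (rule exists_cross_edge[OF b(1)])
  have one: "card {e' \<in> fib e0. b \<in> ends G e'} = 1"
    using card_fib_at[OF e0(1,2) b(1) e0(3)] b(4) by simp
  then obtain e1 where e1: "{e' \<in> fib e0. b \<in> ends G e'} = {e1}" by (auto simp: card_1_singleton_iff)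
  then have e1': "e1 \<in> fib e0" "b \<in> ends G e1" by blast+
  have e1E: "e1 \<in> edges G" "cross e1"
    using fib_edges[OF e1'(1)] cross_fib[OF e0(2) e1'(1)] by simp_all
  have "fib e1 = fib e0" using fib_eq_iff[OF e1E(1)] e1'(1) by simp
  have "{b} \<noteq> verts G"
  proof
    assume "{b} = verts G"
    then have "card (verts G) = card {b}" by simp
    with large show False by simp
  qed
  then have three: "3 \<le> card (edge_cut G {b})" using k(1) b(1) by (simp add: cuts_ge_def)
  \<comment> \<open>Simplicity allows one edge to \<open>a\<close>; together with \<open>e1\<close>
    this accounts for only two of the at least three edges at \<open>b\<close>.\<close>
  have "\<not> edge_cut G {b} \<subseteq> {e \<in> edges G. ends G e = {a, b}} \<union> {e1}"
  proof
    assume sub: "edge_cut G {b} \<subseteq> {e \<in> edges G. ends G e = {a, b}} \<union> {e1}"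
    have "card {e \<in> edges G. ends G e = {a, b}} \<le> 1"
      using g(2) simple_eq by (simp add: card_le_Suc0_iff_eq)
    then have "card ({e \<in> edges G. ends G e = {a, b}} \<union> {e1}) \<le> 2"
      using card_Un_le[of "{e \<in> edges G. ends G e = {a, b}}" "{e1}"] by simp
    moreover have "card (edge_cut G {b}) \<le> card ({e \<in> edges G. ends G e = {a, b}} \<union> {e1})"
      using sub g(2) by (intro card_mono) simp_all
    ultimately show False using three by simp
  qed
  then obtain e2 where e2: "e2 \<in> edge_cut G {b}" "ends G e2 \<noteq> {a, b}" "e2 \<noteq> e1"
    using cut_edgesD by fastforce
  have e2E: "e2 \<in> edges G" "b \<in> ends G e2" using e2(1) by (auto simp: edge_cut_def)
  obtain c2 where c2: "ends G e2 = {b, c2}" "b \<noteq> c2" "b \<in> verts G" "c2 \<in> verts G"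
    by (rule edge_other_endE[OF g(3) e2E])
  obtain c1 where c1: "ends G e1 = {b, c1}" "b \<noteq> c1" "b \<in> verts G" "c1 \<in> verts G"
    by (rule edge_other_endE[OF g(3) e1E(1) e1'(2)])
  have "c2 \<notin> {a, b}" using c2(1,2) e2(2) by auto
  have neq: "cls b \<noteq> cls c1" using cross_iff[OF c1(1)] e1E(2) by simp
  obtain U where U: "U \<subseteq> verts G" "edge_cut G U = fib e1" "cls b \<subseteq> U" "cls c1 \<subseteq> verts G - U"
    by (rule class_edge[OF e1E(1) c1(1) neq])
  have "c1 \<notin> U" using U(4) self_in_cls[OF c1(4)] by blast
  have "e2 \<notin> fib e1" using e1 e2(3) e2E(2) \<open>fib e1 = fib e0\<close> by auto
  \<comment> \<open>\<open>e2\<close> is not in the cut of \<open>U\<close>, so \<open>c2\<close>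
    stays on the side of \<open>b\<close>.\<close>
  then have "c2 \<in> U"
    using edge_cut_iff[OF e2E(1) c2(1), of U] U(2,3) b(2) by simp
  have S: "{a, b} \<subseteq> verts G" "card {a, b} = 2" using b(2,3) cls_subset[of b] by auto
  have "U \<inter> verts G - {a, b} \<noteq> {}" using \<open>c2 \<in> U\<close> c2(4) \<open>c2 \<notin> {a, b}\<close> by blast
  moreover have "verts G - U - {a, b} \<noteq> {}" using c1(4) \<open>c1 \<notin> U\<close> U(3) b(2) by auto
  \<comment> \<open>Deleting \<open>{a, b}\<close> leaves \<open>c2\<close> and \<open>c1\<close> on
    different sides, yet every edge of the cut has an end in the class of \<open>b\<close>, which is
    \<open>{a, b}\<close>.\<close>
  ultimately obtain e where e: "e \<in> edge_cut G U" "ends G e \<inter> {a, b} = {}"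
    by (rule separating_pair[OF conn S])
  have "cls ` ends G e = cls ` ends G e1" using e(1) U(2) by (simp add: fib_def)
  then have "cls b \<in> cls ` ends G e" using e1'(2) by simp
  then obtain x where x: "x \<in> ends G e" "cls x = cls b" by auto
  have "x \<in> verts G" using x(1) cut_edgesD[OF e(1)] g(3) by (auto simp: incidence_def)
  then have "x \<in> cls b" using x(2) self_in_cls[of x] by simp
  then show False using e(2) x(1) b(2) by auto
qed

text \<open>Three splits into positive multiplicities as 3, 1 + 2 or 1 + 1 + 1; in the middle case
  \<open>no_pair_class\<close> applies to the vertex of multiplicity one.\<close>

lemma class_cases:
  assumes v: "v \<in> verts G"
  obtains "cls v = {v}" "mlt v = 3" | "card (cls v) = 3" "\<forall>w\<in>cls v. mlt w = 1"
proof -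
  have pos: "0 < mlt w" if "w \<in> cls v" for w using that cls_subset mlt_pos by blast
  have "card (cls v) = (\<Sum>w\<in>cls v. 1)" by simp
  also have "\<dots> \<le> (\<Sum>w\<in>cls v. mlt w)"
    by (rule sum_mono) (use pos in \<open>simp add: Suc_le_eq\<close>)
  finally have le: "card (cls v) \<le> 3" by (simp add: sum_mlt[OF v])
  have "card (cls v) \<noteq> 0" using self_in_cls[OF v] finite_cls[of v] by auto
  with le consider "card (cls v) = 1" | "card (cls v) = 2" | "card (cls v) = 3" by linarith
  then show thesis
  proof cases
    case 1
    then have "cls v = {v}" using self_in_cls[OF v] by (auto simp: card_1_singleton_iff)
    moreover from this have "mlt v = 3" using sum_mlt[OF v] by simp
    ultimately show thesis by (rule that(1))
  next
    case 2
    then obtain a b where ab: "cls v = {a, b}" "a \<noteq> b" by (auto simp: card_2_iff)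
    have in_cls: "a \<in> cls v" "b \<in> cls v" using ab(1) by simp_all
    then have V: "a \<in> verts G" "b \<in> verts G" using cls_subset by blast+
    have cls: "cls a = {a, b}" "cls b = {a, b}" using cls_cong[OF v] in_cls ab(1) by simp_all
    have "mlt a + mlt b = 3" using sum_mlt[OF v] ab by simp
    moreover have "0 < mlt a" "0 < mlt b" using pos in_cls by simp_all
    ultimately consider "mlt a = 1" | "mlt b = 1" by linarith
    then show thesis
    proof cases
      case 1
      have "cls a = {b, a}" using cls(1) by (simp add: insert_commute)
      from no_pair_class[OF V(1) this ab(2)[symmetric] 1] show thesis ..
    next
      case 2
      from no_pair_class[OF V(2) cls(2) ab(2) 2] show thesis ..
    qed
  next
    case 3
    then obtain a b c where abc: "cls v = {a, b, c}" "a \<noteq> b" "b \<noteq> c" "a \<noteq> c"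
      by (auto simp: card_3_iff)
    then have "mlt a + mlt b + mlt c = 3" using sum_mlt[OF v] by simp
    moreover have "0 < mlt a" "0 < mlt b" "0 < mlt c" using pos abc(1) by simp_all
    ultimately have "\<forall>w\<in>cls v. mlt w = 1" using abc(1) by simp
    with 3 show thesis by (rule that(2))
  qed
qed

lemma mlt_triple: "v \<in> verts G \<Longrightarrow> card (cls v) = 3 \<Longrightarrow> mlt v = 1"
  by (rule class_cases[of v]) (auto dest: self_in_cls)

lemma cls_single: "v \<in> verts G \<Longrightarrow> card (cls v) \<noteq> 3 \<Longrightarrow> cls v = {v}"
  by (rule class_cases[of v]) auto

lemma card_cls_le: "v \<in> verts G \<Longrightarrow> card (cls v) \<le> 3"
  by (rule class_cases[of v]) auto

section \<open>Matchings between classes and compatible colorings\<close>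

lemma partner_exists:
  assumes e: "e \<in> edges G" "ends G e = {u, v}" "cls u \<noteq> cls v" and w: "w \<in> cls u"
  obtains x e' where "x \<in> cls v" "e' \<in> fib e" "ends G e' = {w, x}"
proof -
  have uv: "u \<in> verts G" "v \<in> verts G" using e g(3) by (auto simp: incidence_def)
  have wV: "w \<in> verts G" using w cls_subset by blast
  have clsw: "cls w = cls u" by (rule cls_cong[OF uv(1) w])
  have "cross e" using e by (simp add: cross_iff)
  then have "card {e' \<in> fib e. w \<in> ends G e'} = mlt w"
    using e(2) clsw by (intro card_fib_at[OF e(1) _ wV]) auto
  then have "card {e' \<in> fib e. w \<in> ends G e'} \<noteq> 0" using mlt_pos[OF wV] by simp
  then have "{e' \<in> fib e. w \<in> ends G e'} \<noteq> {}" by (intro notI) (simp only: card.empty)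
  then obtain e' where e': "e' \<in> fib e" "w \<in> ends G e'" by blast
  obtain x where x: "ends G e' = {w, x}" "x \<in> verts G"
    by (rule edge_other_endE[OF g(3) fib_edges[OF e'(1)] e'(2)])
  have "cls ` ends G e' = cls ` ends G e" using e'(1) by (simp add: fib_def)
  then have "{cls u, cls x} = {cls u, cls v}" using x(1) e(2) clsw by simp
  then have "cls x = cls v" using e(3) by (auto simp: doubleton_eq_iff)
  then have "x \<in> cls v" using self_in_cls[OF x(2)] by simp
  with e'(1) x(1) show thesis by (intro that)
qed

text \<open>In a class of three vertices every multiplicity is one, so \<open>w\<close> lies on a
  single edge of the fibre. With \<open>partner_exists\<close>, this makes the fibre between two
  such classes a perfect matching.\<close>

lemma partner_unique:
  assumes e: "e \<in> edges G" "cross e" and w: "w \<in> verts G" "card (cls w) = 3"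
    and e': "e' \<in> fib e" "ends G e' = {w, x}" and e'': "e'' \<in> fib e" "ends G e'' = {w, y}"
  shows "x = y"
proof -
  have "cls ` ends G e' = cls ` ends G e" using e'(1) by (simp add: fib_def)
  then have "cls w \<in> cls ` ends G e" using e'(2) by auto
  then have "card {e' \<in> fib e. w \<in> ends G e'} = 1"
    using card_fib_at[OF e w(1)] mlt_triple[OF w] by simp
  then obtain z where z: "{e' \<in> fib e. w \<in> ends G e'} = {z}" by (auto simp: card_1_singleton_iff)
  have "e' \<in> {z}" "e'' \<in> {z}" using e' e'' unfolding z[symmetric] by simp_all
  then have "{w, x} = {w, y}" using e'(2) e''(2) by simp
  then show ?thesis by (auto simp: doubleton_eq_iff)
qed

text \<open>Two adjacent one-vertex classes would be joined by three parallel edges.\<close>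

lemma adjacent_triple:
  assumes e: "e \<in> edges G" "ends G e = {u, v}" "cls u \<noteq> cls v"
  shows "card (cls u) = 3 \<or> card (cls v) = 3"
proof (rule ccontr)
  assume no: "\<not> ?thesis"
  have uv: "u \<in> verts G" "v \<in> verts G" using e g(3) by (auto simp: incidence_def)
  then have single: "cls u = {u}" "cls v = {v}" using no cls_single by blast+
  have "fib e \<subseteq> {e}"
  proof
    fix e' assume e': "e' \<in> fib e"
    then have eE: "e' \<in> edges G" by (rule fib_edges)
    obtain p q where pq: "ends G e' = {p, q}" "p \<noteq> q" "p \<in> verts G" "q \<in> verts G"
      by (rule edge_endsE[OF g(3) eE])
    have "{cls p, cls q} = {{u}, {v}}" using e' pq(1) e(2) single by (simp add: fib_def)
    then have "p \<in> {u, v}" "q \<in> {u, v}" using self_in_cls[OF pq(3)] self_in_cls[OF pq(4)]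
      by (auto simp: doubleton_eq_iff)
    then have "ends G e' = ends G e" using pq(1,2) e(2) by auto
    then show "e' \<in> {e}" using simple_eq[OF eE e(1)] by simp
  qed
  then have "card (fib e) \<le> 1" using card_mono[of "{e}" "fib e"] by simp
  then show False using card_fib[OF e(1)] e(2,3) by (simp add: cross_iff)
qed

text \<open>Restricted to the classes in \<open>W\<close> so that it can be extended along the tree.
  Pairs with a one-vertex class are exempt, since that vertex is joined to all colors of its
  neighbouring class.\<close>

definition coloring :: "'v set set \<Rightarrow> ('v \<Rightarrow> nat) \<Rightarrow> bool" where
  "coloring W c \<longleftrightarrow> (\<forall>X\<in>W. inj_on c X \<and> c ` X \<subseteq> {..<3}) \<and>
    (\<forall>e\<in>edges G. \<forall>u v. ends G e = {u, v} \<longrightarrow> cls u \<in> W \<longrightarrow> cls v \<in> W \<longrightarrow> cls u \<noteq> cls v \<longrightarrow>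
      card (cls u) = 3 \<longrightarrow> card (cls v) = 3 \<longrightarrow> c u = c v)"

lemma color_class:
  assumes "v \<in> verts G"
  obtains f :: "'v \<Rightarrow> nat" where "inj_on f (cls v)" "f ` cls v \<subseteq> {..<3}"
proof -
  obtain f :: "'v \<Rightarrow> nat" and n where f: "f ` cls v = {i. i < n}" "inj_on f (cls v)"
    using finite_imp_inj_to_nat_seg[OF finite_cls] by blast
  then have "n = card (cls v)" by (metis card_Collect_less_nat card_image)
  then have "f ` cls v \<subseteq> {..<3}" using f(1) card_cls_le[OF assms] by auto
  with f(2) show thesis by (rule that)
qed

text \<open>\<open>Y\<close> meets \<open>W\<close> only through \<open>h\<close>, so all new
  constraints come from the single class \<open>X\<close>; they are met by copying colors along the
  matching.\<close>

lemma coloring_step: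
  assumes c: "coloring W c" and W: "W \<subseteq> verts T" and h: "h \<in> edges T" "ends T h = {X, Y}"
    and X: "X \<in> W" and Y: "Y \<in> verts T" "Y \<notin> W"
    and uniq: "\<And>h'. h' \<in> edges T \<Longrightarrow> Y \<in> ends T h' \<Longrightarrow> ends T h' \<inter> W \<noteq> {} \<Longrightarrow> h' = h"
  shows "\<exists>c. coloring (insert Y W) c"
proof -
  obtain e0 where e0: "e0 \<in> edges G" "cross e0" "h = fib e0" using h(1) by (auto simp: T_simps)
  then have im: "cls ` ends G e0 = {X, Y}" using h(2) by (simp add: ends_T)
  then have "X \<in> cls ` ends G e0" "Y \<in> cls ` ends G e0" by simp_all
  then obtain x0 y0 where xy0: "x0 \<in> ends G e0" "cls x0 = X" "y0 \<in> ends G e0" "cls y0 = Y" by auto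
  have XY: "X \<noteq> Y" using X Y(2) by blast
  then have "x0 \<noteq> y0" using xy0 by auto
  obtain z where z: "ends G e0 = {x0, z}" by (rule edge_other_endE[OF g(3) e0(1) xy0(1)])
  then have ends0: "ends G e0 = {x0, y0}" "ends G e0 = {y0, x0}" using xy0(3) \<open>x0 \<noteq> y0\<close> by auto
  have V0: "x0 \<in> verts G" "y0 \<in> verts G" using xy0(1,3) e0(1) g(3) by (auto simp: incidence_def)
  have neq: "cls x0 \<noteq> cls y0" "cls y0 \<noteq> cls x0" using XY xy0 by simp_all
  have in_h: "e \<in> fib e0" if e: "e \<in> edges G" "cls ` ends G e = {cls u, cls v}" "cls u \<noteq> cls v"
      "cls u = Y" "cls v \<in> W" for e u v
  proof -
    have "cross e" using e(2,3) by (simp add: cross_def)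
    then have "fib e \<in> edges T" using e(1) by (simp add: T_simps)
    then have "fib e = h" by (rule uniq) (use e in \<open>auto simp: ends_T\<close>)
    then show ?thesis using fib_eq_iff[OF e(1)] e0(3) by simp
  qed
  have inY: "z \<in> Y \<longleftrightarrow> cls z = Y" if "z \<in> verts G" for z
    using cls_eq_iff[OF V0(2) that] xy0(4) by simp
  have Y_sub: "Y \<subseteq> verts G" using xy0(4) cls_subset by blast
  define R where "R f = (\<lambda>z. if z \<in> Y then f z else c z)" for f :: "'v \<Rightarrow> nat"
  \<comment> \<open>The condition \<open>m\<close> is vacuous unless both classes have three
    vertices, so one argument covers both ways of choosing \<open>f\<close>.\<close>
  have goal: "coloring (insert Y W) (R f)"
    if f: "inj_on f Y" "f ` Y \<subseteq> {..<3}"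
      and m: "\<And>e u v. \<lbrakk>card X = 3; card Y = 3; e \<in> fib e0; ends G e = {u, v}; u \<in> Y; v \<in> X\<rbrakk> \<Longrightarrow> f u = c v"
    for f
    unfolding coloring_def
  proof (intro conjI ballI allI impI)
    fix Z assume "Z \<in> insert Y W"
    then consider "Z = Y" | "Z \<in> W" "Z \<noteq> Y" by blast
    then have "inj_on (R f) Z \<and> R f ` Z \<subseteq> {..<3}"
    proof cases
      case 1 then show ?thesis using f by (auto simp: R_def inj_on_def)
    next
      case 2
      obtain a where a: "a \<in> verts G" "Z = cls a" using 2(1) W by (auto simp: T_simps)
      have "z \<notin> Y" if "z \<in> Z" for z
      proof
        assume "z \<in> Y"
        then have "cls z = Y" using inY Y_sub by blast
        moreover have "cls z = Z" using cls_cong[OF a(1)] that a(2) by simp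
        ultimately show False using 2(2) by simp
      qed
      moreover have "inj_on c Z \<and> c ` Z \<subseteq> {..<3}" using c 2(1) by (simp add: coloring_def)
      ultimately show ?thesis by (auto simp: R_def inj_on_def)
    qed
    then show "inj_on (R f) Z" "R f ` Z \<subseteq> {..<3}" by simp_all
  next
    fix e u v
    assume e: "e \<in> edges G" "ends G e = {u, v}" and W': "cls u \<in> insert Y W" "cls v \<in> insert Y W"
      and ne: "cls u \<noteq> cls v" and t: "card (cls u) = 3" "card (cls v) = 3"
    have uv: "u \<in> verts G" "v \<in> verts G" using e g(3) by (auto simp: incidence_def)
    have one: "R f a = R f b"
      if ab: "ends G e = {a, b}" "a \<in> verts G" "b \<in> verts G" "cls a = Y" "cls b \<in> W"
        "card (cls a) = 3" "card (cls b) = 3" for a b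
    proof -
      have "cls a \<noteq> cls b" using ab(4,5) Y(2) by auto
      moreover have im_e: "cls ` ends G e = {cls a, cls b}" using ab(1) by simp
      ultimately have eh: "e \<in> fib e0" using in_h[OF e(1) im_e] ab(4,5) by simp
      then have "{cls a, cls b} = {X, Y}" using im_e im by (simp add: fib_def)
      then have "cls b = X" using ab(4) XY by (auto simp: doubleton_eq_iff)
      moreover have "a \<in> Y" "b \<notin> Y" using inY[OF ab(2)] inY[OF ab(3)] ab(4,5) Y(2) by auto
      moreover have "b \<in> cls b" using ab(3) by (rule self_in_cls)
      ultimately show ?thesis using m[OF _ _ eh ab(1)] ab(4,6,7) by (simp add: R_def)
    qed
    consider "cls u = Y" "cls v \<in> W" | "cls v = Y" "cls u \<in> W" | "cls u \<in> W" "cls v \<in> W"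
      using W' ne by blast
    then show "R f u = R f v"
    proof cases
      case 1 then show ?thesis using one[OF e(2) uv] t by simp
    next
      case 2
      have "ends G e = {v, u}" using e(2) by (simp add: insert_commute)
      then show ?thesis using one[OF _ uv(2,1)] 2 t by simp
    next
      case 3
      then have "u \<notin> Y" "v \<notin> Y" using inY uv Y(2) by auto
      then show ?thesis using c e 3 ne t by (simp add: coloring_def R_def)
    qed
  qed
  show ?thesis
  proof (cases "card X = 3 \<and> card Y = 3")
    case False
    obtain f :: "'v \<Rightarrow> nat" where "inj_on f (cls y0)" "f ` cls y0 \<subseteq> {..<3}"
      by (rule color_class[OF V0(2)])
    then have "coloring (insert Y W) (R f)" using False unfolding xy0(4) by (intro goal) auto
    then show ?thesis by blast
  next
    case True
    define p where "p z = (SOME x. x \<in> X \<and> (\<exists>e\<in>fib e0. ends G e = {z, x}))" for z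
    have p: "p z \<in> X \<and> (\<exists>e\<in>fib e0. ends G e = {z, p z})" if z: "z \<in> Y" for z
    proof -
      obtain x e where "x \<in> cls x0" "e \<in> fib e0" "ends G e = {z, x}"
        by (rule partner_exists[OF e0(1) ends0(2) neq(2), of z]) (use z xy0(4) in auto)
      then have "\<exists>x. x \<in> X \<and> (\<exists>e\<in>fib e0. ends G e = {z, x})" using xy0(2) by blast
      then show ?thesis unfolding p_def by (rule someI_ex)
    qed
    have cX: "inj_on c X" "c ` X \<subseteq> {..<3}" using c X by (simp_all add: coloring_def)
    have triple: "z \<in> verts G \<and> card (cls z) = 3" if "z \<in> X \<union> Y" for z
    proof -
      have "cls z = X \<or> cls z = Y"
        using that cls_cong[OF V0(1), of z] cls_cong[OF V0(2), of z] xy0(2,4) by auto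
      moreover have "z \<in> verts G" using that xy0(2,4) cls_subset by blast
      ultimately show ?thesis using True by auto
    qed
    have "coloring (insert Y W) (R (\<lambda>z. c (p z)))"
    proof (rule goal)
      \<comment> \<open>Colors are distinct on \<open>X\<close>, so equal colors mean a common
        partner, which by \<open>partner_unique\<close> has only one partner in turn.\<close>
      show "inj_on (\<lambda>z. c (p z)) Y"
      proof (rule inj_onI)
        fix y y' assume y: "y \<in> Y" "y' \<in> Y" "c (p y) = c (p y')"
        then have eq: "p y = p y'" using p[OF y(1)] p[OF y(2)] cX(1) by (simp add: inj_on_eq_iff)
        obtain e e' where e: "e \<in> fib e0" "ends G e = {y, p y}" "e' \<in> fib e0" "ends G e' = {y', p y'}"
          using p[OF y(1)] p[OF y(2)] by blast
        have "ends G e = {p y, y}" "ends G e' = {p y, y'}" using e(2,4) eq by auto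
        then show "y = y'"
          using triple[of "p y"] p[OF y(1)] e(1,3)
          by (intro partner_unique[OF e0(1,2), of "p y" e y e' y']) simp_all
      qed
      show "(\<lambda>z. c (p z)) ` Y \<subseteq> {..<3}" using p cX(2) by blast
      fix e u v assume e: "e \<in> fib e0" "ends G e = {u, v}" "u \<in> Y" "v \<in> X"
      obtain e' where e': "e' \<in> fib e0" "ends G e' = {u, p u}" using p[OF e(3)] by blast
      have "p u = v"
        using triple[of u] e(3) by (intro partner_unique[OF e0(1,2) _ _ e' e(1,2)]) simp_all
      then show "c (p u) = c v" by simp
    qed
    then show ?thesis by blast
  qed
qed

lemma exists_coloring: "\<exists>c. coloring (verts T) c"
proof -
  obtain v where v: "v \<in> verts G" using g(5) by blast
  show ?thesis
  proof (rule tree_induct[OF is_tree_T, of "cls v" "\<lambda>W. \<exists>c. coloring W c"])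
    show "cls v \<in> verts T" using v by (simp add: T_simps)
    obtain f :: "'v \<Rightarrow> nat" where "inj_on f (cls v)" "f ` cls v \<subseteq> {..<3}" by (rule color_class[OF v])
    then have "coloring {cls v} f" by (simp add: coloring_def)
    then show "\<exists>c. coloring {cls v} c" by blast
  next
    fix W X Y h
    assume "\<exists>c. coloring W c" "W \<subseteq> verts T" "h \<in> edges T" "ends T h = {X, Y}" "X \<in> W"
      "Y \<in> verts T - W"
      and uniq: "\<And>h'. \<lbrakk>h' \<in> edges T; Y \<in> ends T h'; ends T h' \<inter> W \<noteq> {}\<rbrakk> \<Longrightarrow> h' = h"
    then obtain c where "coloring W c" by blast
    then show "\<exists>c. coloring (insert Y W) c"
      by (rule coloring_step[OF _ \<open>W \<subseteq> verts T\<close> \<open>h \<in> edges T\<close> \<open>ends T h = {X, Y}\<close> \<open>X \<in> W\<close>])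
        (use \<open>Y \<in> verts T - W\<close> uniq in auto)
  qed
qed

end

section \<open>The rotation of colors and its quotient\<close>

locale colored_system = zero_three_system G D0
  for G :: "('v, 'e) mgraph" and D0 :: "'v \<Rightarrow> int" +
  fixes c :: "'v \<Rightarrow> nat"
  assumes c: "coloring (verts T) c"
begin

abbreviation "triple v \<equiv> card (cls v) = 3"

lemma color_inj: "v \<in> verts G \<Longrightarrow> inj_on c (cls v)"
  and color_range: "v \<in> verts G \<Longrightarrow> c ` cls v \<subseteq> {..<3}"
  using c by (simp_all add: coloring_def T_simps)

lemma color_eq:
  assumes e: "e \<in> edges G" "ends G e = {u, v}" "cls u \<noteq> cls v" "triple u" "triple v"
  shows "c u = c v"
proof -
  have "u \<in> verts G" "v \<in> verts G" using e(1,2) g(3) by (auto simp: incidence_def)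
  then have "cls u \<in> verts T" "cls v \<in> verts T" by (simp_all add: T_simps)
  then show ?thesis using c e unfolding coloring_def by blast
qed

lemma color_image:
  assumes "v \<in> verts G" "triple v"
  shows "c ` cls v = {..<3}"
  using color_range[OF assms(1)] color_inj[OF assms(1)] assms(2)
  by (intro card_subset_eq) (simp_all add: card_image)

definition s :: "'v \<Rightarrow> 'v" where
  "s v = (if v \<in> verts G \<and> triple v then THE w. w \<in> cls v \<and> c w = (c v + 1) mod 3 else v)"

lemma s_triple:
  assumes "v \<in> verts G" "triple v"
  shows "s v \<in> cls v" "c (s v) = (c v + 1) mod 3"
proof -
  have "(c v + 1) mod 3 \<in> c ` cls v" using color_image[OF assms] by simp
  then obtain w where w: "w \<in> cls v" "c w = (c v + 1) mod 3" by auto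
  have "s v = w"
    unfolding s_def using assms w inj_onD[OF color_inj[OF assms(1)]] by (auto intro!: the_equality)
  with w show "s v \<in> cls v" "c (s v) = (c v + 1) mod 3" by simp_all
qed

lemma s_single: "\<not> triple v \<Longrightarrow> s v = v"
  by (simp add: s_def)

lemma s_in_cls: "v \<in> verts G \<Longrightarrow> s v \<in> cls v"
  using s_triple(1) s_single self_in_cls by (cases "triple v") simp_all

lemma s_verts: "v \<in> verts G \<Longrightarrow> s v \<in> verts G"
  using s_in_cls cls_subset by blast

lemma cls_s: "v \<in> verts G \<Longrightarrow> cls (s v) = cls v"
  by (rule cls_cong[OF _ s_in_cls])

lemma color_lt: "v \<in> verts G \<Longrightarrow> c v < 3"
  using color_range self_in_cls by blast

lemma color_cls_eqI: "v \<in> verts G \<Longrightarrow> x \<in> cls v \<Longrightarrow> y \<in> cls v \<Longrightarrow> c x = c y \<Longrightarrow> x = y"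
  using inj_onD[OF color_inj] by metis

lemma color_s:
  assumes "v \<in> verts G" "triple v"
  shows "c (s v) = (c v + 1) mod 3" "c (s (s v)) = (c v + 2) mod 3" "c (s (s (s v))) = c v"
proof -
  have 1: "c (s v) = (c v + 1) mod 3" by (rule s_triple(2)[OF assms])
  have 2: "c (s (s v)) = (c (s v) + 1) mod 3"
    using assms by (intro s_triple(2)) (simp_all add: s_verts cls_s)
  have 3: "c (s (s (s v))) = (c (s (s v)) + 1) mod 3"
    using assms by (intro s_triple(2)) (simp_all add: s_verts cls_s)
  show "c (s v) = (c v + 1) mod 3" by (fact 1)
  show "c (s (s v)) = (c v + 2) mod 3" unfolding 2 1 by presburger
  show "c (s (s (s v))) = c v" unfolding 3 2 1 using color_lt[OF assms(1)] by presburger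
qed

lemma s3:
  assumes v: "v \<in> verts G"
  shows "s (s (s v)) = v"
proof (cases "triple v")
  case True
  have "s (s (s v)) \<in> cls (s (s v))" using v by (intro s_in_cls s_verts)
  then have "s (s (s v)) \<in> cls v" using v by (simp add: cls_s s_verts)
  then show ?thesis using self_in_cls[OF v] color_s(3)[OF v True] by (intro color_cls_eqI[OF v])
qed (simp add: s_single)

lemma s_neq:
  assumes "v \<in> verts G" "triple v"
  shows "s v \<noteq> v" "s (s v) \<noteq> v" "s (s v) \<noteq> s v"
proof -
  have "c (s v) \<noteq> c v" "c (s (s v)) \<noteq> c v" "c (s (s v)) \<noteq> c (s v)"
    unfolding color_s(1,2)[OF assms] using color_lt[OF assms(1)] by presburger+
  then show "s v \<noteq> v" "s (s v) \<noteq> v" "s (s v) \<noteq> s v" by metis+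
qed

lemma bij_s: "bij_betw s (verts G) (verts G)"
  by (rule bij_betw_byWitness[where f' = "\<lambda>v. s (s v)"]) (auto simp: s3 s_verts)

text \<open>The rotation is transitive on each class; this identifies the quotient with the tree of
  classes.\<close>

lemma orbit_s:
  assumes v: "v \<in> verts G"
  shows "orbit s v = cls v"
proof -
  have orb: "orbit s v = {v, s v, s (s v)}" by (rule orbit_order_3[of s v, OF s3[OF v]])
  show ?thesis
  proof (cases "triple v")
    case True
    have "s (s v) \<in> cls (s v)" using v by (intro s_in_cls s_verts)
    then have "{v, s v, s (s v)} \<subseteq> cls v"
      using v self_in_cls[OF v] s_in_cls[OF v] by (simp add: cls_s)
    moreover have "card {v, s v, s (s v)} = 3" using s_neq[OF v True] by auto
    ultimately show ?thesis unfolding orb using True finite_cls by (intro card_subset_eq) simp_all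
  next
    case False
    then show ?thesis using cls_single[OF v False] by (simp add: orb s_single)
  qed
qed

text \<open>Here the zero-three condition enters: a class with one inner edge is a triangle.\<close>

lemma triangle:
  assumes v: "v \<in> verts G" "triple v" and e: "e \<in> edges G" "ends G e \<subseteq> cls v"
    and xy: "x \<in> cls v" "y \<in> cls v" "x \<noteq> y"
  obtains e' where "e' \<in> edges G" "ends G e' = {x, y}"
proof -
  obtain a b d where abd: "cls v = {a, b, d}" "a \<noteq> b" "b \<noteq> d" "a \<noteq> d"
    using v(2) by (auto simp: card_3_iff)
  have V: "a \<in> verts G" "b \<in> verts G" "d \<in> verts G" using abd(1) cls_subset[of v] by auto
  \<comment> \<open>All multiplicities in the class are one, so its divisor is the sum of its three
    points and \<open>zero_three\<close> applies to it.\<close>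
  have dv_pt: "dv v w = point a w + point b w + point d w" for w
  proof (cases "w \<in> cls v")
    case True
    then have "w \<in> verts G" using cls_subset by blast
    moreover have "triple w" using v cls_cong[OF v(1) True] by simp
    ultimately have "dv v w = 1" using dv_mlt[OF v(1) True] mlt_triple by simp
    then show ?thesis using True abd by (auto simp: point_def)
  next
    case False
    have "dv v w = 0"
    proof (cases "w \<in> verts G")
      case True
      then have "\<not> 1 \<le> dv v w" using False by (simp add: cls_def)
      then show ?thesis using effective_nonneg[OF sysD(1)[OF dv(1)[OF v(1)]], of w] by simp
    next
      case False
      then show ?thesis using sysD(1)[OF dv(1)[OF v(1)]] by (simp add: effective_def divisors_def)
    qed
    then show ?thesis using False abd(1) by (simp add: point_def)
  qed
  let ?F = "{e \<in> edges G. ends G e \<subseteq> {a, b, d}}"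
  have "lin_equiv G D0 (\<lambda>w. point a w + point b w + point d w)"
    using sysD(3)[OF dv(1)[OF v(1)]] unfolding dv_pt[abs_def] .
  then have "card ?F \<in> {0, 3}" using zero_three[OF V abd(2-4)] by simp
  moreover have "e \<in> ?F" using e abd(1) by simp
  then have "card ?F \<noteq> 0" using g(2) by auto
  ultimately have "card ?F = 3" by simp
  moreover have "inj_on (ends G) ?F" by (rule inj_onI) (simp add: simple_eq)
  ultimately have card: "card (ends G ` ?F) = 3" by (simp add: card_image)
  let ?P = "{{a, b}, {b, d}, {a, d}}"
  have "ends G ` ?F \<subseteq> ?P"
  proof
    fix X assume "X \<in> ends G ` ?F"
    then obtain e' where e': "e' \<in> edges G" "X = ends G e'" "ends G e' \<subseteq> {a, b, d}" by auto
    obtain p q where pq: "ends G e' = {p, q}" "p \<noteq> q" by (rule edge_endsE[OF g(3) e'(1)])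
    then have "p \<in> {a, b, d}" "q \<in> {a, b, d}" using e'(3) by simp_all
    then show "X \<in> ?P" unfolding e'(2) pq(1) using pq(2) by (auto simp: insert_commute)
  qed
  \<comment> \<open>There are three distinct pairs of ends and only three possible ones, so every
    pair occurs.\<close>
  then have "ends G ` ?F = ?P"
    using card abd by (intro card_seteq) (auto simp: card_insert_if doubleton_eq_iff)
  moreover have "{x, y} \<in> ?P" using xy abd(1) by (auto simp: insert_commute)
  ultimately have "{x, y} \<in> ends G ` ?F" by simp
  then show thesis using that by auto
qed

lemma same_class_triple:
  assumes "u \<in> verts G" "v \<in> cls u" "u \<noteq> v"
  shows "triple u"
proof (rule ccontr)
  assume "\<not> triple u"
  then have "cls u = {u}" by (rule cls_single[OF assms(1)])
  then show False using assms(2,3) by simp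
qed

text \<open>Inside a class, \<open>triangle\<close> supplies the image edge. Between classes it is a
  fibre edge at the rotated vertex of a class of three: its other end is determined by its color, or
  is the only vertex of its class.\<close>

lemma edge_image:
  assumes e: "e \<in> edges G"
  shows "\<exists>e'\<in>edges G. ends G e' = s ` ends G e"
proof -
  obtain u v where uv: "ends G e = {u, v}" "u \<noteq> v" "u \<in> verts G" "v \<in> verts G"
    by (rule edge_endsE[OF g(3) e])
  have step: "\<exists>e'\<in>edges G. ends G e' = {s x, s y}"
    if xy: "ends G e = {x, y}" "x \<in> verts G" "y \<in> verts G" "cls x \<noteq> cls y" "triple x" for x y
  proof -
    obtain y' e' where y': "y' \<in> cls y" "e' \<in> fib e" "ends G e' = {s x, y'}"
      by (rule partner_exists[OF e xy(1,4) s_in_cls[OF xy(2)]])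
    have y'V: "y' \<in> verts G" using y'(1) cls_subset by blast
    have clsy': "cls y' = cls y" by (rule cls_cong[OF xy(3) y'(1)])
    have "y' = s y"
    proof (cases "triple y")
      case True
      have "c (s x) = c y'"
        using clsy' xy True by (intro color_eq[OF fib_edges[OF y'(2)] y'(3)]) (simp_all add: cls_s)
      moreover have "c x = c y" by (rule color_eq[OF e xy(1,4,5) True])
      ultimately have "c y' = c (s y)" using color_s(1)[OF xy(2,5)] color_s(1)[OF xy(3) True] by simp
      then show ?thesis using y'(1) s_in_cls[OF xy(3)] by (intro color_cls_eqI[OF xy(3)])
    next
      case False
      then show ?thesis using y'(1) cls_single[OF xy(3) False] by (simp add: s_single)
    qed
    then have "ends G e' = {s x, s y}" using y'(3) by simp
    with fib_edges[OF y'(2)] show ?thesis ..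
  qed
  show ?thesis
  proof (cases "cls u = cls v")
    case True
    then have v_in: "v \<in> cls u" using self_in_cls[OF uv(4)] by simp
    then have tr: "triple u" using same_class_triple uv(2,3) by simp
    have su: "s u \<in> cls u" "s v \<in> cls u" using s_in_cls[OF uv(3)] s_in_cls[OF uv(4)] True by simp_all
    have "s u \<noteq> s v"
    proof
      assume "s u = s v"
      then have "s (s (s u)) = s (s (s v))" by simp
      then show False using uv s3 by simp
    qed
    have sub: "ends G e \<subseteq> cls u" using uv(1) v_in self_in_cls[OF uv(3)] by simp
    obtain e' where e': "e' \<in> edges G" "ends G e' = {s u, s v}"
      by (rule triangle[OF uv(3) tr e sub su \<open>s u \<noteq> s v\<close>])
    then have "ends G e' = s ` ends G e" using uv(1) by simp
    with e'(1) show ?thesis ..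
  next
    case False
    then consider "triple u" | "triple v" using adjacent_triple[OF e uv(1)] by blast
    then show ?thesis
    proof cases
      case 1 then show ?thesis using step[OF uv(1,3,4) False] uv(1) by simp
    next
      case 2
      have "ends G e = {v, u}" using uv(1) by (simp add: insert_commute)
      then show ?thesis using step[OF _ uv(4,3) False[symmetric] 2] by simp
    qed
  qed
qed

text \<open>Simplicity makes the chosen edge unique, so \<open>t\<close> inherits order three from
  \<open>s\<close>.\<close>

definition t :: "'e \<Rightarrow> 'e" where
  "t e = (SOME e'. e' \<in> edges G \<and> ends G e' = s ` ends G e)"

lemma t:
  assumes "e \<in> edges G"
  shows "t e \<in> edges G \<and> ends G (t e) = s ` ends G e"
proof -
  have "\<exists>e'. e' \<in> edges G \<and> ends G e' = s ` ends G e" using edge_image[OF assms] by blast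
  then show ?thesis unfolding t_def by (rule someI_ex)
qed

lemma t3:
  assumes e: "e \<in> edges G"
  shows "t (t (t e)) = e"
proof (rule simple_eq)
  show "t (t (t e)) \<in> edges G" using e by (simp add: t)
  obtain u v where "ends G e = {u, v}" "u \<in> verts G" "v \<in> verts G" by (rule edge_endsE[OF g(3) e])
  then show "ends G (t (t (t e))) = ends G e" using e by (simp add: t s3)
qed (fact e)

text \<open>Every edge has an end in a class of three vertices. If \<open>t\<close> fixed the edge,
  \<open>s\<close> would fix or swap its ends, so \<open>s\<close> applied twice would fix both,
  which fails at that end.\<close>

lemma t_neq:
  assumes e: "e \<in> edges G"
  shows "t e \<noteq> e"
proof
  assume "t e = e"
  obtain u v where uv: "ends G e = {u, v}" "u \<noteq> v" "u \<in> verts G" "v \<in> verts G"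
    by (rule edge_endsE[OF g(3) e])
  have "triple u \<or> triple v"
  proof (cases "cls u = cls v")
    case True
    then have "v \<in> cls u" using self_in_cls[OF uv(4)] by simp
    then show ?thesis using same_class_triple uv(2,3) by simp
  next
    case False then show ?thesis by (rule adjacent_triple[OF e uv(1)])
  qed
  moreover have "{s u, s v} = {u, v}" using t[OF e] \<open>t e = e\<close> uv(1) by simp
  then have "s u = u \<and> s v = v \<or> s u = v \<and> s v = u" by (auto simp: doubleton_eq_iff)
  then have "s (s u) = u" "s (s v) = v" by auto
  ultimately show False using s_neq(2)[OF uv(3)] s_neq(2)[OF uv(4)] by blast
qed

lemma automorphism_st: "automorphism G s t"
  unfolding automorphism_def
proof (intro conjI ballI)
  show "bij_betw t (edges G) (edges G)"
    by (rule bij_betw_byWitness[where f' = "\<lambda>e. t (t e)"]) (auto simp: t3 t)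
qed (simp_all add: bij_s t)

sublocale aut: order_3_automorphism G s t
  by standard (rule G automorphism_st s3 t3 t_neq; assumption?)+

lemma aut_cross: "e \<in> edges G \<Longrightarrow> aut.cross e \<longleftrightarrow> cross e"
proof -
  assume e: "e \<in> edges G"
  obtain u v where "ends G e = {u, v}" "u \<in> verts G" "v \<in> verts G" by (rule edge_endsE[OF g(3) e])
  then show ?thesis by (simp add: aut.cross_iff cross_iff orbit_s)
qed

lemma orbit_image:
  assumes "e \<in> edges G"
  shows "orbit s ` ends G e = cls ` ends G e"
proof -
  have "orbit s v = cls v" if "v \<in> ends G e" for v
    using that assms g(3) by (intro orbit_s) (auto simp: incidence_def)
  then show ?thesis by (rule image_cong[OF refl])
qed

text \<open>The edges of the orbit all join the same two classes, and both sets have three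
  elements.\<close>

lemma orbit_t:
  assumes e: "e \<in> edges G" "cross e"
  shows "orbit t e = fib e"
proof (rule card_subset_eq)
  show "finite (fib e)" using g(2) by (simp add: fib_def)
  show "card (orbit t e) = card (fib e)" using card_fib[OF e] aut.card_orbit_t[OF e(1)] by simp
  have mem: "e' \<in> fib e" if "e' \<in> edges G" "orbit s ` ends G e' = orbit s ` ends G e" for e'
    using that e(1) by (simp add: fib_def orbit_image)
  have "t e \<in> edges G" "t (t e) \<in> edges G" using e(1) by (simp_all add: t)
  then have "e \<in> fib e" "t e \<in> fib e" "t (t e) \<in> fib e"
    using e(1) by (simp_all add: mem aut.orbit_ends_t)
  then show "orbit t e \<subseteq> fib e" by (simp add: aut.orbit_t[OF e(1)])
qed

lemma quotient_tree: "is_tree (quotient G s t)"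
proof (rule is_tree_class_graph)
  show "verts (quotient G s t) = cls ` verts G"
    unfolding quotient_def by (simp add: orbit_s cong: image_cong)
  show "edges (quotient G s t) = fib ` {e \<in> edges G. cross e}"
    unfolding aut.edges_Q by (intro image_cong) (auto simp: aut_cross orbit_t)
  show "ends (quotient G s t) (fib e) = cls ` ends G e" if "e \<in> edges G" "cross e" for e
    using aut.ends_Q[OF that(1)] that by (simp add: orbit_t orbit_image)
qed

lemma exists_triple: "\<exists>v\<in>verts G. triple v"
proof -
  obtain v where "v \<in> verts G" using g(5) by blast
  then obtain e where e: "e \<in> edges G" "cross e" by (rule exists_cross_edge)
  obtain u w where "ends G e = {u, w}" "u \<in> verts G" "w \<in> verts G" by (rule edge_endsE[OF g(3) e(1)])
  then show ?thesis using adjacent_triple[OF e(1), of u w] e(2) by (auto simp: cross_iff)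
qed

lemma aut_order_st: "aut_order G s t = 3"
  unfolding aut_order_def
proof (rule Least_equality)
  show "0 < (3::nat) \<and> (\<forall>v\<in>verts G. (s ^^ 3) v = v) \<and> (\<forall>e\<in>edges G. (t ^^ 3) e = e)"
    by (simp add: numeral_3_eq_3 s3 t3)
  fix n :: nat assume n: "0 < n \<and> (\<forall>v\<in>verts G. (s ^^ n) v = v) \<and> (\<forall>e\<in>edges G. (t ^^ n) e = e)"
  obtain v where v: "v \<in> verts G" "triple v" using exists_triple by blast
  then have "(s ^^ n) v = v" using n by blast
  then have "n \<noteq> 1" "n \<noteq> 2" using s_neq(1,2)[OF v] by (auto simp: numeral_2_eq_2)
  then show "3 \<le> n" using n by linarith
qed

lemma has_tree_quotient_3: "has_tree_quotient G 3"
  unfolding has_tree_quotient_def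
  using automorphism_st aut_order_st t_neq quotient_tree by blast

end

lemma (in zero_three_system) has_tree_quotient_3: "has_tree_quotient G 3"
proof -
  obtain c where "coloring (verts T) c" using exists_coloring by blast
  then interpret colored_system G D0 c by unfold_locales
  show ?thesis by (rule has_tree_quotient_3)
qed

section \<open>Small graphs and the equivalences\<close>

lemma gonality_leI:
  "effective G D \<Longrightarrow> deg G D = int d \<Longrightarrow> 1 \<le> rank G D \<Longrightarrow> gonality G \<le> d"
  unfolding gonality_def by (rule Least_le) blast

lemma rank_ge_1_if_cover:
  assumes G: "is_graph G" and D: "effective G D"
    and cover: "\<And>v. v \<in> verts G \<Longrightarrow> \<exists>D'. effective G D' \<and> lin_equiv G D D' \<and> 1 \<le> D' v"
  shows "1 \<le> rank G D"
proof (rule iffD2[OF rank_ge_1_iff[OF G]])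
  show "D \<in> divisors G" using D by (simp add: effective_def)
qed (use cover in blast)

lemma gonality_le_card:
  assumes G: "is_graph G"
  shows "gonality G \<le> card (verts G)"
proof (rule gonality_leI)
  let ?D = "\<lambda>v. if v \<in> verts G then 1 else 0 :: int"
  show D: "effective G ?D" by (auto simp: effective_def divisors_def)
  show "deg G ?D = int (card (verts G))" by (simp add: deg_def)
  show "1 \<le> rank G ?D"
  proof (rule rank_ge_1_if_cover[OF G D])
    fix v assume "v \<in> verts G"
    then show "\<exists>D'. effective G D' \<and> lin_equiv G ?D D' \<and> 1 \<le> D' v"
      using D by (intro exI[of _ ?D]) (simp add: effective_def lin_equiv_refl)
  qed
qed

text \<open>Put one chip on \<open>a\<close> for each incident edge; firing \<open>a\<close> sends a
  chip to every other vertex.\<close>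

lemma gonality_le_star:
  assumes G: "is_graph G" and a: "a \<in> verts G"
    and adj: "\<And>v. v \<in> verts G \<Longrightarrow> \<exists>e\<in>edge_cut G {a}. v \<in> ends G e"
  shows "gonality G \<le> card (edge_cut G {a})"
proof (rule gonality_leI)
  note g = is_graphD[OF G]
  have sub: "{a} \<subseteq> verts G" using a by simp
  show eff: "effective G (boundary G {a})" by (rule effective_boundary[OF sub])
  show "deg G (boundary G {a}) = int (card (edge_cut G {a}))" by (rule deg_boundary[OF G sub])
  have pos: "0 < cut_degree G {a} v" if "v \<in> verts G" for v
  proof -
    have "{e \<in> edge_cut G {a}. v \<in> ends G e} \<noteq> {}" using adj[OF that] by blast
    then show ?thesis unfolding cut_degree_def using finite_cut[OF g(2)] by (simp add: card_gt_0_iff)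
  qed
  show "1 \<le> rank G (boundary G {a})"
  proof (rule rank_ge_1_if_cover[OF G eff])
    fix v assume v: "v \<in> verts G"
    show "\<exists>D'. effective G D' \<and> lin_equiv G (boundary G {a}) D' \<and> 1 \<le> D' v"
    proof (cases "v = a")
      case True
      then show ?thesis
        using eff pos[OF v] lin_equiv_refl[OF boundary_in_divisors[OF sub]]
        by (intro exI[of _ "boundary G {a}"]) (simp add: boundary_def)
    next
      case False
      then have "1 \<le> boundary G (verts G - {a}) v"
        using v pos[OF v] by (simp add: boundary_def cut_degree_compl[OF g(3)])
      then show ?thesis
        using effective_boundary[of "verts G - {a}" G] boundary_compl_equiv[OF G sub] by blast
    qed
  qed
qed

lemma card_edges_simple_le:
  assumes G: "is_graph G" and "simple G"
  shows "card (edges G) \<le> card (verts G) choose 2"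
proof -
  note g = is_graphD[OF G]
  have "card (edges G) = card (ends G ` edges G)"
    using assms(2) by (simp add: simple_def card_image)
  also have "\<dots> \<le> card {X. X \<subseteq> verts G \<and> card X = 2}"
    using g(1,3) by (intro card_mono) (auto simp: incidence_def)
  also have "\<dots> = card (verts G) choose 2" by (rule n_subsets[OF g(1)])
  finally show ?thesis .
qed

text \<open>Two spanning edges on three vertices share a vertex \<open>a\<close> adjacent to both
  others; by simplicity \<open>a\<close> has valency two, and the star bound applies.\<close>

lemma gonality_simple_3:
  assumes G: "is_graph G" and simple: "simple G" and V: "card (verts G) = 3"
  shows "gonality G \<le> 2"
proof -
  note g = is_graphD[OF G]
  from spanning_edges[OF G] obtain S where S: "S \<subseteq> edges G" "card S + 1 = card (verts G)"
    by (elim exE conjE)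
  then have "card S = 2" using V by simp
  then obtain e1 e2 where e12: "S = {e1, e2}" "e1 \<noteq> e2" by (auto simp: card_2_iff)
  then have E: "e1 \<in> edges G" "e2 \<in> edges G" using S(1) by simp_all
  have ends_neq: "ends G e1 \<noteq> ends G e2"
    using simple E e12(2) by (auto simp: simple_def inj_on_eq_iff)
  have sub: "ends G e1 \<union> ends G e2 \<subseteq> verts G" and two: "card (ends G e1) = 2" "card (ends G e2) = 2"
    using E g(3) by (auto simp: incidence_def)
  have fin: "finite (ends G e1)" "finite (ends G e2)" using two by (auto intro: card_ge_0_finite)
  have "ends G e1 \<inter> ends G e2 \<noteq> {}"
  proof
    assume "ends G e1 \<inter> ends G e2 = {}"
    then have "card (ends G e1 \<union> ends G e2) = 4" using card_Un_disjoint[OF fin] two by simp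
    then show False using card_mono[OF g(1) sub] V by simp
  qed
  then obtain a where a: "a \<in> ends G e1" "a \<in> ends G e2" by blast
  obtain b where b: "ends G e1 = {a, b}" "a \<noteq> b" "a \<in> verts G" "b \<in> verts G"
    by (rule edge_other_endE[OF g(3) E(1) a(1)])
  obtain d where d: "ends G e2 = {a, d}" "a \<noteq> d" "a \<in> verts G" "d \<in> verts G"
    by (rule edge_other_endE[OF g(3) E(2) a(2)])
  have "b \<noteq> d" using ends_neq b(1) d(1) by auto
  then have "card {a, b, d} = 3" using b(2) d(2) by simp
  then have verts: "{a, b, d} = verts G"
    using b(3,4) d(4) V by (intro card_subset_eq[OF g(1)]) simp_all
  have cut: "e1 \<in> edge_cut G {a}" "e2 \<in> edge_cut G {a}"
    using E b d by (simp_all add: edge_cut_def)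
  have "gonality G \<le> card (edge_cut G {a})"
  proof (rule gonality_le_star[OF G b(3)])
    fix v assume "v \<in> verts G"
    then have "v \<in> ends G e1 \<or> v \<in> ends G e2" using b(1) d(1) verts by auto
    then show "\<exists>e\<in>edge_cut G {a}. v \<in> ends G e" using cut by blast
  qed
  also have "card (edge_cut G {a}) = card (ends G ` edge_cut G {a})"
    using simple by (intro card_image[symmetric]) (auto simp: simple_def inj_on_def edge_cut_def)
  also have "\<dots> \<le> card {{a, b}, {a, d}}"
  proof (rule card_mono)
    show "ends G ` edge_cut G {a} \<subseteq> {{a, b}, {a, d}}"
    proof
      fix X assume "X \<in> ends G ` edge_cut G {a}"
      then obtain e where e: "e \<in> edge_cut G {a}" "X = ends G e" by blast
      obtain x y where "ends G e = {x, y}" "x \<in> {a}" "y \<notin> {a}" "y \<in> verts G"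
        by (rule cut_endsE[OF g(3) e(1)])
      then show "X \<in> {{a, b}, {a, d}}" using e(2) verts by auto
    qed
  qed simp
  also have "\<dots> \<le> 2" by (simp add: card_insert_if)
  finally show ?thesis .
qed

text \<open>On two vertices all edges are parallel, and parallel edges of a tree coincide, so a
  single fibre contains every edge.\<close>

lemma tree_morphism_small:
  assumes G: "is_graph G" and mor: "has_tree_morphism G d" and d: "0 < d" and V: "card (verts G) \<le> 2"
  shows "card (verts G) = 2 \<and> card (edges G) = d"
proof -
  note g = is_graphD[OF G]
  obtain T :: "(nat, nat) mgraph" and p q where T: "is_tree T" and har: "harmonic G T p q"
    and dg: "morphism_degree G T q = d"
    using mor unfolding has_tree_morphism_def by blast
  have mor: "morphism G T p q" using har by (simp add: harmonic_def)
  define h0 where "h0 = (SOME h. h \<in> edges T)"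
  have ne: "edges T \<noteq> {}" using dg d by (auto simp: morphism_degree_def)
  have fib0: "card {e \<in> edges G. q e = Inl h0} = d"
    using dg ne by (simp add: morphism_degree_def h0_def)
  then have "{e \<in> edges G. q e = Inl h0} \<noteq> {}" using d by (intro notI) (simp only: card.empty)
  then obtain e0 where e0: "e0 \<in> edges G" "q e0 = Inl h0" by blast
  have h0: "h0 \<in> edges T" "ends T h0 = p ` ends G e0"
    using morphism_edge[OF mor g(3) e0] by simp_all
  have V_eq: "ends G e = verts G" if "e \<in> edges G" for e
  proof (rule card_seteq[OF g(1)])
    show "ends G e \<subseteq> verts G" "card (verts G) \<le> card (ends G e)"
      using that V g(3) by (auto simp: incidence_def)
  qed
  have "card (verts G) = 2" using V_eq[OF e0(1)] e0(1) g(3) by (auto simp: incidence_def)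
  moreover have "q e = Inl h0" if e: "e \<in> edges G" for e
  proof -
    obtain u v where uv: "ends G e0 = {u, v}" by (rule edge_endsE[OF g(3) e0(1)])
    have ends: "ends G e = {u, v}" using V_eq[OF e] V_eq[OF e0(1)] uv by simp
    have m: "if p u = p v then q e' = Inr (p u)
        else \<exists>h\<in>edges T. q e' = Inl h \<and> ends T h = {p u, p v}"
      if "e' \<in> edges G" "ends G e' = {u, v}" for e'
      using mor that unfolding morphism_def by blast
    have "p u \<noteq> p v" using m[OF e0(1) uv] e0(2) by (auto split: if_splits)
    then obtain h where h: "h \<in> edges T" "q e = Inl h" "ends T h = {p u, p v}"
      using m[OF e ends] by auto
    obtain W where W: "edge_cut T W = {h0}" by (rule tree_bridge[OF T h0(1)])
    have "h0 \<in> edge_cut T W" using W by simp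
    moreover have "ends T h = ends T h0" using h(3) h0(2) uv by simp
    ultimately have "h \<in> edge_cut T W" using h(1) by (simp add: edge_cut_def)
    then show ?thesis using W h(2) by simp
  qed
  then have "{e \<in> edges G. q e = Inl h0} = edges G" by auto
  ultimately show ?thesis using fib0 by simp
qed

text \<open>The triangle with its rotation satisfies the other hypotheses, but its quotient is one
  vertex and its gonality is at most 2.\<close>

lemma tree_quotient_imp:
  assumes G: "is_graph G" and simple: "simple G" and conn: "vertex_connected 3 G"
    and quot: "has_tree_quotient G 3"
    and not_triangle: "\<not> (card (verts G) = 3 \<and> card (edges G) = 3)"
  shows "gonality G = 3 \<and> has_tree_morphism G 3"
proof -
  note g = is_graphD[OF G]
  obtain s t where aut: "automorphism G s t" and ord: "aut_order G s t = 3"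
    and neq: "\<forall>e\<in>edges G. t e \<noteq> e" and tree: "is_tree (quotient G s t)"
    using quot unfolding has_tree_quotient_def by blast
  interpret order_3_automorphism G s t
  proof
    show "s (s (s v)) = v" if "v \<in> verts G" for v
      using aut_order_power(2)[OF G aut that] unfolding ord by (simp add: numeral_3_eq_3)
    show "t (t (t e)) = e" if "e \<in> edges G" for e
      using aut_order_power(3)[OF G aut that] unfolding ord by (simp add: numeral_3_eq_3)
  qed (use G aut neq in auto)
  \<comment> \<open>Without edges the graph is a single vertex and the automorphism has order
    1.\<close>
  have "edges G \<noteq> {}"
  proof
    assume E: "edges G = {}"
    have "verts G \<subseteq> {v}" if v: "v \<in> verts G" for v
    proof (rule ccontr)
      assume "\<not> verts G \<subseteq> {v}"
      then have "edge_cut G {v} \<noteq> {}" using v by (intro connected_cutD[OF g(4)]) blast+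
      then show False using E by (simp add: edge_cut_def)
    qed
    then have "s v = v" if "v \<in> verts G" for v using that s_verts[OF that] by blast
    then have "aut_order G s t \<le> 1" unfolding aut_order_def by (intro Least_le) (simp add: E)
    then show False using ord by simp
  qed
  then obtain e where e: "e \<in> edges G" by blast
  have "{e, t e, t (t e)} \<subseteq> edges G" using e t_edges by simp
  then have "card (orbit t e) \<le> card (edges G)"
    unfolding orbit_t[OF e] by (rule card_mono[OF g(2)])
  then have E3: "3 \<le> card (edges G)" using card_orbit_t[OF e] by simp
  have le: "card (edges G) \<le> card (verts G) choose 2" by (rule card_edges_simple_le[OF G simple])
  \<comment> \<open>A simple graph with three edges has at least three vertices, and on exactly
    three it is the triangle.\<close>
  have V: "4 \<le> card (verts G)"
  proof (rule ccontr)
    assume "\<not> 4 \<le> card (verts G)"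
    then consider "card (verts G) \<le> 1" | "card (verts G) = 2" | "card (verts G) = 3" by linarith
    then show False
    proof cases
      case 1
      then have "card (verts G) choose 2 = 0" by (intro binomial_eq_0) simp
      then show False using le E3 by linarith
    next
      case 2 then show False using le E3 by simp
    next
      case 3
      then have "card (edges G) = 3" using le E3 by (simp add: choose_two)
      with 3 not_triangle show False by blast
    qed
  qed
  \<comment> \<open>A tree without edges has one vertex, so all of \<open>G\<close> would be one
    orbit of at most three vertices.\<close>
  have "edges Q \<noteq> {}"
  proof
    assume "edges Q = {}"
    then have "card (verts Q) = 1" using tree by (simp add: is_tree_def)
    then obtain X where "verts Q = {X}" by (auto simp: card_1_singleton_iff)
    then have X: "orbit s ` verts G = {X}" by (simp add: quotient_def)
    obtain v where v: "v \<in> verts G" using g(5) by blast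
    have "verts G \<subseteq> orbit s v"
    proof
      fix w assume w: "w \<in> verts G"
      have "orbit s w \<in> {X}" "orbit s v \<in> {X}" unfolding X[symmetric] using v w by simp_all
      then have "orbit s w = orbit s v" by simp
      moreover have "w \<in> orbit s w" by (simp add: orbit_s[OF w])
      ultimately show "w \<in> orbit s v" by simp
    qed
    then have "card (verts G) \<le> card (orbit s v)" by (rule card_mono[rotated]) (simp add: orbit_s[OF v])
    also have "\<dots> \<le> 3" unfolding orbit_s[OF v] by (simp add: card_insert_if)
    finally show False using V by simp
  qed
  with tree have mor: "has_tree_morphism G 3" by (rule has_tree_morphism_if_quotient)
  have "cuts_ge 3 G" by (rule cuts_ge_if_vertex_connected[OF G conn V])
  then have "gonality G = 3" using V by (intro gonality_if_tree_morphism[OF G _ _ _ mor]) simp_all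
  with mor show ?thesis by simp
qed

text \<open>Dropping any of the exclusions makes an implication fail. Three vertices with each pair
  joined by four edges have gonality 3, but every cut has eight edges while the fibre of a degree 3
  morphism would be a cut of three. Two vertices joined by three edges map onto one edge with degree
  3, yet have gonality at most 2. The triangle has its rotation, yet gonality at most 2. The last
  implication excludes nothing, because a simple graph on three vertices never has gonality
  3.\<close>

theorem theorem1p2:
  fixes G :: "('v, 'e) mgraph"
  assumes "is_graph G"
  shows
    "(edge_connected 3 G \<longrightarrow>
       (card (verts G) \<noteq> 3 \<longrightarrow> gonality G = 3 \<longrightarrow> has_tree_morphism G 3) \<and>
       (\<not> (card (verts G) = 2 \<and> card (edges G) = 3) \<longrightarrow>
          has_tree_morphism G 3 \<longrightarrow> gonality G = 3)) \<and>
     (simple G \<and> vertex_connected 3 G \<longrightarrow>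
       (\<not> (card (verts G) = 3 \<and> card (edges G) = 3) \<longrightarrow>
          has_tree_quotient G 3 \<longrightarrow> gonality G = 3 \<and> has_tree_morphism G 3) \<and>
       (zero_three G \<longrightarrow> gonality G = 3 \<longrightarrow> has_tree_quotient G 3))"
proof (intro conjI impI; (elim conjE)?)
  assume conn: "edge_connected 3 G" and V: "card (verts G) \<noteq> 3" and gon: "gonality G = 3"
  have V4: "3 < card (verts G)" using gonality_le_card[OF assms] gon V by simp
  obtain D where D: "effective G D" "deg G D = int (gonality G)" "1 \<le> rank G D"
    by (rule gonality_divisor[OF assms])
  have "cuts_ge 3 G" using V4 by (intro cuts_ge_if_edge_connected[OF assms conn]) simp
  then interpret tight_system G 3 D
    using assms D gon V4 by unfold_locales (simp_all add: effective_def)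
  show "has_tree_morphism G 3" by (rule has_tree_morphism_T)
next
  assume conn: "edge_connected 3 G" and small: "\<not> (card (verts G) = 2 \<and> card (edges G) = 3)"
    and mor: "has_tree_morphism G 3"
  have V: "3 \<le> card (verts G)" using tree_morphism_small[OF assms mor] small by fastforce
  show "gonality G = 3"
    by (rule gonality_if_tree_morphism[OF assms cuts_ge_if_edge_connected[OF assms conn V] V _ mor]) simp
next
  assume "simple G" "vertex_connected 3 G" "has_tree_quotient G 3"
    "\<not> (card (verts G) = 3 \<and> card (edges G) = 3)"
  from tree_quotient_imp[OF assms this]
  show "gonality G = 3" "has_tree_morphism G 3" by simp_all
next
  assume simple: "simple G" and conn: "vertex_connected 3 G" and zt: "zero_three G"
    and gon: "gonality G = 3"
  have "card (verts G) \<noteq> 3" using gonality_simple_3[OF assms simple] gon by auto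
  then have V4: "3 < card (verts G)" using gonality_le_card[OF assms] gon by simp
  obtain D where D: "D \<in> divisors G" "deg G D = 3" "rank G D = 1"
    and D_zt: "\<forall>a\<in>verts G. \<forall>b\<in>verts G. \<forall>c\<in>verts G. a \<noteq> b \<and> b \<noteq> c \<and> a \<noteq> c \<and>
       lin_equiv G D (\<lambda>v. point a v + point b v + point c v) \<longrightarrow>
       card {e \<in> edges G. ends G e \<subseteq> {a, b, c}} \<in> {0, 3}"
    using zt unfolding zero_three_def by blast
  have "cuts_ge 3 G" using V4 by (intro cuts_ge_if_vertex_connected[OF assms conn]) simp
  then interpret tight_system G 3 D
    using assms D V4 by unfold_locales simp_all
  interpret zero_three_system G D
    by unfold_locales (use simple conn D_zt in blast)+
  show "has_tree_quotient G 3" by (rule has_tree_quotient_3)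
qed

end
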